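(* Let $\underline E=\prod_{p\in\mathbb P}E_p$ be a compact subset of $\widehat{\mathbb Z}=\prod_{p\in\mathbb P}\mathbb Z_p$ (with $E_p\subseteq\mathbb Z_p$) such that all the $E_p$ are infinite and, for each $n\ge 0$, $\#(E_p \bmod p)>n$ for all but finitely many primes $p$. Then there exist bases of the $\mathbb Z$-module $\mathrm{Int}_{\mathbb Q}(\underline E,\widehat{\mathbb Z})$, and, for any such basis $\{f_n\}_{n\ge 0}$, every $\underline\varphi\in\prod_{p\in\mathbb P}\mathcal C(E_p,\mathbb Z_p)$ may be uniquely written as a series $\underline\varphi=\sum_{n\ge 0}\underline c_n f_n$ where $\underline c_n\in\widehat{\mathbb Z}$ and $\lim_{n\to\infty}\underline c_n=\underline 0$.
   Context: $\mathbb P$ is the set of primes; $\widehat{\mathbb Z}=\prod_p\mathbb Z_p$ has the product topology. $\#(E_p\bmod p)$ is the number of residue classes modulo $p$ met by $E_p$, i.e. the cardinality of the image of $E_p$ in $\mathbb Z_p/p\mathbb Z_p$. Polynomials $f\in\mathbb Q[x]$ are evaluated componentwise: $f((\alpha_p)_p)=(f(\alpha_p))_p$. $\mathrm{Int}_{\mathbb Q}(\underline E,\widehat{\mathbb Z})=\{f\in\mathbb Q[x]\mid f(\underline E)\subseteq\widehat{\mathbb Z}\}$. $\mathcal C(E_p,\mathbb Z_p)$ is the ring of continuous functions $E_p\to\mathbb Z_p$; an element $\underline\varphi=(\varphi_p)_p$ of $\prod_p\mathcal C(E_p,\mathbb Z_p)$ is regarded as the function $\underline E\to\widehat{\mathbb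 Z}$, $(\alpha_p)_p\mapsto(\varphi_p(\alpha_p))_p$. Series of functions are taken with respect to the uniform convergence topology on continuous functions $\underline E\to\widehat{\mathbb Z}$; the coefficient $\underline c_n=(c_{n,p})_p$ multiplies $f_n$ componentwise. *)

theory Defs
  imports
    "HOL-Analysis.Analysis"
    "HOL-Computational_Algebra.Polynomial"
    "HOL-Algebra.QuotRing"
begin

section \<open>The field of p-adic numbers\<close>

definition padic_val :: "nat \<Rightarrow> rat \<Rightarrow> int" where
  "padic_val p r = int (multiplicity (int p) (fst (quotient_of r)))
                   - int (multiplicity (int p) (snd (quotient_of r)))"

definition padic_abs :: "nat \<Rightarrow> rat \<Rightarrow> real" where
  "padic_abs p r = (if r = 0 then 0 else real p powi (- padic_val p r))"

text \<open>The completion of the rationals for the p-adic absolute value: the ring of p-adic Cauchy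
  sequences of rationals modulo the ideal of p-adic null sequences. A p-adic number is thus a coset,
  that is, a set of rational sequences.\<close>

definition padic_cauchy_ring :: "nat \<Rightarrow> (nat \<Rightarrow> rat) ring" where
  "padic_cauchy_ring p =
    \<lparr>carrier = {x. Metric_space.MCauchy UNIV (\<lambda>r s. padic_abs p (r - s)) x},
     mult = (\<lambda>x y n. x n * y n), one = (\<lambda>n. 1),
     zero = (\<lambda>n. 0), add = (\<lambda>x y n. x n + y n)\<rparr>"

definition padic_null_ideal :: "nat \<Rightarrow> (nat \<Rightarrow> rat) set" where
  "padic_null_ideal p = {x. (\<lambda>n. padic_abs p (x n)) \<longlonglongrightarrow> 0}"

type_synonym padic = "(nat \<Rightarrow> rat) set"

definition Qp :: "nat \<Rightarrow> padic ring" where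
  "Qp p = padic_cauchy_ring p Quot padic_null_ideal p"

definition Qp_of_rat :: "nat \<Rightarrow> rat \<Rightarrow> padic" where
  "Qp_of_rat p r = padic_null_ideal p +>\<^bsub>padic_cauchy_ring p\<^esub> (\<lambda>n. r)"

text \<open>The extension of the absolute value: the limit does not depend on the Cauchy sequence
  representing the p-adic number.\<close>

definition Qp_abs :: "nat \<Rightarrow> padic \<Rightarrow> real" where
  "Qp_abs p a = (THE l. \<forall>x\<in>a. (\<lambda>n. padic_abs p (x n)) \<longlonglongrightarrow> l)"

text \<open>The value outside the carrier makes the distance total, symmetric and nonnegative, as
  the locale \<open>Metric_space\<close> requires.\<close>

definition Qp_dist :: "nat \<Rightarrow> padic \<Rightarrow> padic \<Rightarrow> real" where
  "Qp_dist p a b =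
    (if a \<in> carrier (Qp p) \<and> b \<in> carrier (Qp p) then Qp_abs p (a \<ominus>\<^bsub>Qp p\<^esub> b) else 0)"

definition Qp_topology :: "nat \<Rightarrow> padic topology" where
  "Qp_topology p = Metric_space.mtopology (carrier (Qp p)) (Qp_dist p)"

definition Qp_eval :: "nat \<Rightarrow> rat poly \<Rightarrow> padic \<Rightarrow> padic" where
  "Qp_eval p f a =
    (\<Oplus>\<^bsub>Qp p\<^esub>i\<in>{..degree f}. Qp_of_rat p (coeff f i) \<otimes>\<^bsub>Qp p\<^esub> (a [^]\<^bsub>Qp p\<^esub> i))"


section \<open>The p-adic integers and the profinite integers\<close>

definition Zp :: "nat \<Rightarrow> padic ring" where
  "Zp p = (Qp p) \<lparr>carrier := {a \<in> carrier (Qp p). Qp_abs p a \<le> 1}\<rparr>"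

definition Zp_topology :: "nat \<Rightarrow> padic topology" where
  "Zp_topology p = subtopology (Qp_topology p) (carrier (Zp p))"

text \<open>The image of \<open>S\<close> in the quotient of the p-adic integers by their principal ideal
  generated by \<open>p\<close>.\<close>

definition residue_classes :: "nat \<Rightarrow> padic set \<Rightarrow> padic set set" where
  "residue_classes p S =
    (\<lambda>a. cgenideal (Zp p) (Qp_of_rat p (of_nat p)) +>\<^bsub>Zp p\<^esub> a) ` S"

abbreviation primes :: "nat set" where
  "primes \<equiv> {p. prime p}"

text \<open>Elements of the product over the primes are families indexed by all naturals with the
  value \<open>undefined\<close> outside the primes.\<close>

definition Zhat :: "(nat \<Rightarrow> padic) ring" where
  "Zhat =
    \<lparr>carrier = (\<Pi>\<^sub>E p\<in>primes. carrier (Zp p)),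
     mult = (\<lambda>a b. \<lambda>p\<in>primes. a p \<otimes>\<^bsub>Zp p\<^esub> b p), one = (\<lambda>p\<in>primes. \<one>\<^bsub>Zp p\<^esub>),
     zero = (\<lambda>p\<in>primes. \<zero>\<^bsub>Zp p\<^esub>), add = (\<lambda>a b. \<lambda>p\<in>primes. a p \<oplus>\<^bsub>Zp p\<^esub> b p)\<rparr>"

definition Zhat_topology :: "(nat \<Rightarrow> padic) topology" where
  "Zhat_topology = product_topology Zp_topology primes"


section \<open>Integer-valued polynomials and series of functions\<close>

text \<open>Componentwise evaluation; the value lies in the product of the fields of p-adic numbers,
  not necessarily in \<open>Zhat\<close>.\<close>

definition adelic_eval :: "rat poly \<Rightarrow> (nat \<Rightarrow> padic) \<Rightarrow> (nat \<Rightarrow> padic)" where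
  "adelic_eval f a = (\<lambda>p\<in>primes. Qp_eval p f (a p))"

definition Int_Q :: "(nat \<Rightarrow> padic) set \<Rightarrow> rat poly set" where
  "Int_Q S = {f. adelic_eval f ` S \<subseteq> carrier Zhat}"

abbreviation zscale :: "int \<Rightarrow> rat poly \<Rightarrow> rat poly" where
  "zscale k f \<equiv> smult (of_int k) f"

lemma module_zscale: "module zscale"
  by unfold_locales (simp_all add: smult_add_right smult_add_left)

definition is_Z_basis :: "rat poly set \<Rightarrow> (nat \<Rightarrow> rat poly) \<Rightarrow> bool" where
  "is_Z_basis M f \<longleftrightarrow>
    inj f \<and> \<not> module.dependent zscale (range f) \<and> module.span zscale (range f) = M"

definition family_map :: "(nat \<Rightarrow> padic \<Rightarrow> padic) \<Rightarrow> (nat \<Rightarrow> padic) \<Rightarrow> (nat \<Rightarrow> padic)" where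
  "family_map \<phi> a = (\<lambda>p\<in>primes. \<phi> p (a p))"

text \<open>Uniform convergence on \<open>S\<close> for the uniform structure of the topological group \<open>Zhat\<close>
  (the product of the p-adic uniform structures), whose entourages are given by
  the neighbourhoods of zero.\<close>

definition uniformly_sums ::
  "(nat \<Rightarrow> (nat \<Rightarrow> padic) \<Rightarrow> (nat \<Rightarrow> padic)) \<Rightarrow> ((nat \<Rightarrow> padic) \<Rightarrow> (nat \<Rightarrow> padic))
    \<Rightarrow> (nat \<Rightarrow> padic) set \<Rightarrow> bool" where
  "uniformly_sums g h S \<longleftrightarrow>
    (\<forall>U. openin Zhat_topology U \<and> \<zero>\<^bsub>Zhat\<^esub> \<in> U \<longrightarrow>
      (\<forall>\<^sub>F m in sequentially. \<forall>a\<in>S. (\<Oplus>\<^bsub>Zhat\<^esub>n\<in>{..<m}. g n a) \<ominus>\<^bsub>Zhat\<^esub> h a \<in> U))"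

end

theory Submission imports Defs begin

text \<open>
  Dividing by \<open>p\<close> shows that an element of \<open>M = Int_Q E\<close> that vanishes modulo \<open>p\<close> on \<open>E\<^sub>p\<close> lies in
  \<open>p M\<close>, and polynomials are dense in the continuous functions on the compact set \<open>E\<^sub>p\<close>, already with
  coefficients having no denominators prime to \<open>p\<close>. Hence every basis of \<open>M\<close> is, modulo each \<open>p\<close>, a
  basis of the locally constant functions from \<open>E\<^sub>p\<close> to the residue field, and lifting modulo higher
  powers of \<open>p\<close> gives existence and uniqueness of the expansions, prime by prime. The residue
  condition is needed only for the existence of a basis: it bounds the denominators of the \<open>n\<close>-th
  coefficients of the polynomials of degree at most \<open>n\<close> in \<open>M\<close>, so that one may choose in each degree
  a polynomial whose leading coefficient generates all the others.
\<close>

section \<open>The p-adic absolute value on the rationals\<close>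

text \<open>Nothing relates the \<open>n\<close>-th element of an arbitrary basis to degree
  \<open>n\<close>, so coordinates cannot be computed by elimination on degrees; moreover the basis
  property speaks of finite combinations over \<int>, whereas the series has p-adic coefficients.
  Both obstacles vanish modulo \<open>p ^ K\<close>: p-adic integers are rounded to integers, and
  the ultrametric inequality makes the rounding error of a sum independent of its length. Finitely
  many coordinates occur at each level \<open>K\<close>, which is why the coefficients tend to zero.
  The passage between one prime and the module, which sees all primes at once, rests on two remarks:
  \<open>p\<close> is a unit at every other prime, so division by \<open>p ^ K\<close> is tested at
  \<open>p\<close> alone; and denominators prime to \<open>p\<close> are removed by an integer
  congruent to 1 modulo \<open>p ^ K\<close>, which leaves the values at \<open>p\<close> almost
  unchanged. A neighbourhood of zero in \<open>Zhat\<close> restricts finitely many components, so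
  every estimate may depend on \<open>p\<close>.\<close>

lemma padic_val_Fract:
  assumes p: "prime p" and a: "a \<noteq> 0" and b: "b \<noteq> 0"
  shows "padic_val p (Fract a b) = int (multiplicity (int p) a) - int (multiplicity (int p) b)"
proof -
  obtain c d where q: "quotient_of (Fract a b) = (c, d)" by fastforce
  have d: "d > 0" using quotient_of_denom_pos[OF q] .
  have eq: "Fract c d = Fract a b" using quotient_of_eq[OF q] .
  then have *: "c * b = a * d" using b d by (simp add: eq_rat)
  have c: "c \<noteq> 0" using * a d by auto
  have "prime (int p)" using p by simp
  then have pe: "prime_elem (int p)" by blast
  have "multiplicity (int p) (c * b) = multiplicity (int p) c + multiplicity (int p) b"
    "multiplicity (int p) (a * d) = multiplicity (int p) a + multiplicity (int p) d"
    using a b c d pe by (simp_all add: prime_elem_multiplicity_mult_distrib)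
  then show ?thesis using * by (simp add: padic_val_def q)
qed

lemma padic_abs_0 [simp]: "padic_abs p 0 = 0"
  by (simp add: padic_abs_def)

locale prime_padic =
  fixes p :: nat
  assumes prime_p: "prime p"
begin

lemma p_gt_1: "real p > 1" and p_pos: "real p > 0"
  using prime_gt_1_nat[OF prime_p] by auto

lemma padic_abs_nonneg [simp]: "0 \<le> padic_abs p x"
  using p_pos by (simp add: padic_abs_def)

lemma padic_abs_eq_0_iff [simp]: "padic_abs p x = 0 \<longleftrightarrow> x = 0"
  using p_pos by (simp add: padic_abs_def)

lemma padic_abs_Fract:
  assumes "a \<noteq> 0" "b \<noteq> 0"
  shows "padic_abs p (Fract a b)
    = real p powi (int (multiplicity (int p) b) - int (multiplicity (int p) a))"
proof -
  have "Fract a b \<noteq> 0" using assms by (simp add: Zero_rat_def eq_rat)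
  then show ?thesis using padic_val_Fract[OF prime_p assms] by (simp add: padic_abs_def)
qed

lemma padic_abs_of_int:
  assumes "a \<noteq> 0"
  shows "padic_abs p (of_int a) = 1 / real p ^ multiplicity (int p) a"
  using padic_abs_Fract[OF assms, of 1]
  by (simp add: Fract_of_int_eq power_int_minus field_simps)

lemma padic_abs_mult: "padic_abs p (x * y) = padic_abs p x * padic_abs p y"
proof (cases "x = 0 \<or> y = 0")
  case False
  obtain a b where x: "x = Fract a b" "b > 0" by (cases x) auto
  obtain c d where y: "y = Fract c d" "d > 0" by (cases y) auto
  from False x y have nz: "a \<noteq> 0" "b \<noteq> 0" "c \<noteq> 0" "d \<noteq> 0" by (auto simp: rat_number_collapse)
  have "prime (int p)" using prime_p by simp
  then have pe: "prime_elem (int p)" by blast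
  show ?thesis using nz p_pos pe
    by (simp add: x y padic_abs_Fract prime_elem_multiplicity_mult_distrib algebra_simps flip: power_int_add)
qed auto

lemma padic_abs_one [simp]: "padic_abs p 1 = 1"
  using padic_abs_of_int[of 1] by simp

lemma padic_abs_minus [simp]: "padic_abs p (- x) = padic_abs p x"
proof -
  have "padic_abs p (-1) = 1"
    using padic_abs_of_int[of "-1"] by (simp add: multiplicity_unit_right)
  then show ?thesis using padic_abs_mult[of "-1" x] by simp
qed

lemma padic_abs_minus_commute: "padic_abs p (x - y) = padic_abs p (y - x)"
  using padic_abs_minus[of "x - y"] by simp

lemma padic_abs_power: "padic_abs p (x ^ n) = padic_abs p x ^ n"
  by (induction n) (simp_all add: padic_abs_mult)

lemma padic_abs_inverse: "padic_abs p (inverse x) = inverse (padic_abs p x)"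
  using padic_abs_mult[of x "inverse x"] by (cases "x = 0") (auto simp: field_simps)

lemma padic_abs_divide: "padic_abs p (x / y) = padic_abs p x / padic_abs p y"
  by (simp add: divide_inverse padic_abs_mult padic_abs_inverse)

text \<open>Dictionary between distances and congruences: the closed bounds
  \<open>1 / real p ^ k\<close> are used throughout because on integers they mean exactly
  divisibility by \<open>p ^ k\<close>.\<close>

lemma padic_abs_of_int_le_iff: "padic_abs p (of_int a) \<le> 1 / real p ^ k \<longleftrightarrow> int p ^ k dvd a"
proof (cases "a = 0")
  case False
  have pi: "prime (int p)" using prime_p by simp
  have "padic_abs p (of_int a) \<le> 1 / real p ^ k \<longleftrightarrow> real p ^ k \<le> real p ^ multiplicity (int p) a"
    using p_pos by (simp add: padic_abs_of_int[OF False] field_simps)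
  also have "\<dots> \<longleftrightarrow> k \<le> multiplicity (int p) a"
    using p_gt_1 by simp
  also have "\<dots> \<longleftrightarrow> int p ^ k dvd a"
    using False pi by (intro power_dvd_iff_le_multiplicity[symmetric]) auto
  finally show ?thesis .
qed auto

lemma padic_abs_of_int_le_1: "padic_abs p (of_int a) \<le> 1"
  using padic_abs_of_int_le_iff[of a 0] by simp

lemma padic_abs_p_power [simp]: "padic_abs p (of_nat p ^ k) = 1 / real p ^ k"
proof -
  have "prime (int p)" using prime_p by simp
  then have "multiplicity (int p) (int p) = 1" "p \<noteq> 0" using p_pos by auto
  then show ?thesis
    using padic_abs_of_int[of "int p"] by (simp add: padic_abs_power power_one_over)
qed

lemma padic_abs_of_int_eq_1:
  assumes "\<not> int p dvd a"
  shows "padic_abs p (of_int a) = 1"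
  using assms by (subst padic_abs_of_int) (auto simp: not_dvd_imp_multiplicity_0)

text \<open>Over a common denominator the claim concerns two integers, and a power of
  \<open>p\<close> dividing both divides their sum. The smaller multiplicity belongs to the larger
  absolute value.\<close>

lemma padic_abs_add: "padic_abs p (x + y) \<le> max (padic_abs p x) (padic_abs p y)"
proof (cases "x = 0 \<or> y = 0")
  case False
  obtain a b where x: "x = Fract a b" "b > 0" by (cases x) auto
  obtain c d where y: "y = Fract c d" "d > 0" by (cases y) auto
  define r s :: rat where "r = of_int (a * d)" and "s = of_int (c * b)"
  have xr: "x = r / of_int (b * d)" and ys: "y = s / of_int (b * d)"
    using x y by (auto simp: Fract_of_int_quotient r_def s_def field_simps)
  have nz: "a * d \<noteq> 0" "c * b \<noteq> 0"
    using False x y by (auto simp: rat_number_collapse)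
  have "padic_abs p (r + s) \<le> max (padic_abs p r) (padic_abs p s)"
  proof -
    define k where "k = min (multiplicity (int p) (a * d)) (multiplicity (int p) (c * b))"
    have "int p ^ k dvd a * d" "int p ^ k dvd c * b"
      unfolding k_def by (auto intro: multiplicity_dvd')
    then have "int p ^ k dvd a * d + c * b" by (rule dvd_add)
    then have le: "padic_abs p (r + s) \<le> 1 / real p ^ k"
      unfolding r_def s_def using padic_abs_of_int_le_iff by (metis of_int_add)
    have "padic_abs p r = 1 / real p ^ k \<or> padic_abs p s = 1 / real p ^ k"
      unfolding r_def s_def padic_abs_of_int[OF nz(1)] padic_abs_of_int[OF nz(2)] k_def
      by (auto simp: min_def)
    with le show ?thesis by auto
  qed
  then have "padic_abs p (r + s) / padic_abs p (of_int (b * d))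
      \<le> max (padic_abs p r) (padic_abs p s) / padic_abs p (of_int (b * d))"
    by (intro divide_right_mono) auto
  also have "\<dots> \<le> max (padic_abs p x) (padic_abs p y)"
    by (auto simp: xr ys padic_abs_divide max_def)
  finally show ?thesis
    by (simp add: xr ys padic_abs_divide flip: add_divide_distrib)
qed auto

lemma padic_abs_add_le: "padic_abs p x \<le> e \<Longrightarrow> padic_abs p y \<le> e \<Longrightarrow> padic_abs p (x + y) \<le> e"
  using padic_abs_add[of x y] by linarith

lemma padic_abs_diff_le: "padic_abs p x \<le> e \<Longrightarrow> padic_abs p y \<le> e \<Longrightarrow> padic_abs p (x - y) \<le> e"
  using padic_abs_add_le[of x e "- y"] by simp

lemma padic_abs_diff_trans:
  "padic_abs p (x - y) \<le> e \<Longrightarrow> padic_abs p (y - z) \<le> e \<Longrightarrow> padic_abs p (x - z) \<le> e"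
  using padic_abs_add_le[of "x - y" e "y - z"] by simp

lemma padic_abs_sum_le:
  "(\<And>i. i \<in> I \<Longrightarrow> padic_abs p (f i) \<le> e) \<Longrightarrow> 0 \<le> e \<Longrightarrow> padic_abs p (sum f I) \<le> e"
  by (induction I rule: infinite_finite_induct) (auto intro: padic_abs_add_le)

lemma abs_padic_abs_diff: "\<bar>padic_abs p x - padic_abs p y\<bar> \<le> padic_abs p (x - y)"
  using padic_abs_add[of "x - y" y] padic_abs_add[of "y - x" x] padic_abs_minus_commute[of x y]
    padic_abs_nonneg[of x] padic_abs_nonneg[of y] padic_abs_nonneg[of "x - y"]
  unfolding diff_add_cancel max_def by (smt (verit))

text \<open>Nonzero absolute values are integral powers of \<open>p\<close>, so a strict bound by
  one power is a weak bound by the next smaller one. This recovers exact congruences from the strict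
  inequalities that limits provide.\<close>

lemma padic_abs_lt_p_power_imp_le:
  assumes "padic_abs p x < real p / real p ^ k"
  shows "padic_abs p x \<le> 1 / real p ^ k"
proof (cases "x = 0")
  case False
  then have v: "padic_abs p x = real p powi (- padic_val p x)" by (simp add: padic_abs_def)
  have "real p / real p ^ k = real p powi (1 - int k)"
    using p_pos by (simp add: power_int_diff)
  with assms v have "real p powi (- padic_val p x) < real p powi (1 - int k)" by simp
  then have "- padic_val p x < 1 - int k"
    using p_gt_1 power_int_increasing[of "1 - int k" "- padic_val p x" "real p"] by linarith
  then have "real p powi (- padic_val p x) \<le> real p powi (- int k)"
    using p_gt_1 by (intro power_int_increasing) auto
  with v show ?thesis by (simp add: power_int_minus field_simps)
qed auto

lemma padic_abs_lt_1_imp_le: "padic_abs p x < 1 \<Longrightarrow> padic_abs p x \<le> 1 / real p"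
  using padic_abs_lt_p_power_imp_le[of x 1] p_pos by simp

lemma padic_abs_lt_p_imp_le_1: "padic_abs p x < real p \<Longrightarrow> padic_abs p x \<le> 1"
  using padic_abs_lt_p_power_imp_le[of x 0] by simp

lemma obtain_p_power_less:
  assumes "e > 0"
  obtains k where "1 / real p ^ k < e"
  using real_arch_pow_inv[of e "1 / real p"] assms p_gt_1 by (auto simp: power_one_over)

text \<open>An \<open>r\<close> integral at \<open>p\<close> has a denominator \<open>b\<close>
  prime to \<open>p\<close>; with an inverse \<open>b'\<close> of \<open>b\<close> modulo
  \<open>p ^ k\<close> from Bezout, the integer \<open>a * b'\<close> works.\<close>

lemma approx_by_int:
  assumes "padic_abs p r \<le> 1"
  shows "\<exists>m. padic_abs p (r - of_int m) \<le> 1 / real p ^ k"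
proof -
  obtain a b where r: "r = Fract a b" "b > 0" "coprime a b" by (cases r) auto
  have nd: "\<not> int p dvd b"
  proof
    assume d: "int p dvd b"
    with r(3) have "\<not> int p dvd a"
      using prime_p by (metis coprime_common_divisor not_prime_unit prime_nat_int_transfer)
    then have "padic_abs p (of_int a) = 1" by (rule padic_abs_of_int_eq_1)
    moreover have "padic_abs p (of_int b) \<le> 1 / real p"
      using d padic_abs_of_int_le_iff[of b 1] by simp
    moreover have "padic_abs p (of_int b) > 0"
      using r(2) by (simp add: order_less_le)
    moreover have "1 / real p < 1" using p_gt_1 by simp
    ultimately show False
      using assms by (auto simp: r Fract_of_int_quotient padic_abs_divide field_simps)
  qed
  then have "coprime b (int p ^ k)"
    using prime_p by (metis coprime_commute coprime_power_right_iff prime_imp_coprime prime_nat_int_transfer)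
  then obtain b' c where bc: "b' * b + c * int p ^ k = 1"
    using bezout_int[of b "int p ^ k"] by (auto simp: coprime_iff_gcd_eq_1)
  have "r - of_int (a * b') = of_int (a * (c * int p ^ k)) / of_int b"
  proof -
    have "c * int p ^ k = 1 - b' * b" using bc by simp
    then have "of_int (a * (c * int p ^ k)) = (of_int (a * (1 - b' * b)) :: rat)" by simp
    then show ?thesis using r by (simp add: Fract_of_int_quotient field_simps)
  qed
  moreover have "padic_abs p (of_int (a * (c * int p ^ k))) \<le> 1 / real p ^ k"
    by (subst padic_abs_of_int_le_iff) auto
  ultimately have "padic_abs p (r - of_int (a * b')) \<le> 1 / real p ^ k"
    using padic_abs_of_int_eq_1[OF nd] by (simp add: padic_abs_divide)
  then show ?thesis by blast
qed

end

text \<open>A prime dividing the denominator in lowest terms makes the absolute value exceed 1, so a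
  common denominator can be verified one prime at a time.\<close>

lemma rat_is_int_if_padic_abs_le_1:
  assumes "\<And>p. prime p \<Longrightarrow> padic_abs p r \<le> 1"
  shows "r \<in> \<int>"
proof -
  obtain a b where r: "r = Fract a b" "b > 0" "coprime a b" by (cases r) auto
  have "b = 1"
  proof (rule ccontr)
    assume "b \<noteq> 1"
    with r(2) obtain q where q: "prime q" "q dvd b"
      using prime_divisor_exists[of b] by auto
    define p where "p = nat q"
    have p: "prime p" "int p = q" using q prime_gt_0_int[of q] by (auto simp: p_def)
    interpret prime_padic p by unfold_locales fact
    have "\<not> int p dvd a"
      using r(3) p q by (metis coprime_common_divisor not_prime_unit)
    then have "padic_abs p (of_int a) = 1" by (rule padic_abs_of_int_eq_1)
    moreover have "padic_abs p (of_int b) \<le> 1 / real p"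
      using q p padic_abs_of_int_le_iff[of b 1] by simp
    moreover have "padic_abs p (of_int b) > 0"
      using r(2) by (simp add: order_less_le)
    moreover have "1 / real p < 1" using p_gt_1 by simp
    ultimately show False
      using assms[OF p(1)] by (auto simp: r Fract_of_int_quotient padic_abs_divide field_simps)
  qed
  then show ?thesis by (simp add: r Fract_of_int_quotient)
qed

section \<open>The field of p-adic numbers as a normed ring\<close>

definition padic_class :: "nat \<Rightarrow> (nat \<Rightarrow> rat) \<Rightarrow> padic" where
  "padic_class p x = padic_null_ideal p +>\<^bsub>padic_cauchy_ring p\<^esub> x"

lemma Qp_of_rat_eq_class: "Qp_of_rat p r = padic_class p (\<lambda>n. r)"
  by (simp add: Qp_of_rat_def padic_class_def)

context prime_padic
begin

section \<open>The ring of p-adic Cauchy sequences and its ideal of null sequences\<close>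

abbreviation cauchy_seqs :: "(nat \<Rightarrow> rat) set" where
  "cauchy_seqs \<equiv> carrier (padic_cauchy_ring p)"

lemma Metric_space_padic: "Metric_space UNIV (\<lambda>r s. padic_abs p (r - s))"
proof
  fix x y z :: rat
  show "padic_abs p (x - z) \<le> padic_abs p (x - y) + padic_abs p (y - z)"
    using padic_abs_add[of "x - y" "y - z"] padic_abs_nonneg[of "x - y"] padic_abs_nonneg[of "y - z"]
    unfolding diff_add_cancel add_diff_eq by linarith
qed (auto simp: padic_abs_minus_commute)

lemma cauchy_seqs_iff:
  "x \<in> cauchy_seqs \<longleftrightarrow> (\<forall>e>0. \<exists>N. \<forall>m\<ge>N. \<forall>n\<ge>N. padic_abs p (x m - x n) < e)"
proof -
  interpret Metric_space UNIV "\<lambda>r s. padic_abs p (r - s)" by (rule Metric_space_padic)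
  show ?thesis by (simp add: padic_cauchy_ring_def MCauchy_def)
qed

lemma cauchy_seqsD:
  assumes "x \<in> cauchy_seqs" "e > 0"
  obtains N where "\<And>m n. m \<ge> N \<Longrightarrow> n \<ge> N \<Longrightarrow> padic_abs p (x m - x n) < e"
  using assms unfolding cauchy_seqs_iff by blast

lemma cauchy_seqs_const [simp]: "(\<lambda>n. r) \<in> cauchy_seqs"
  by (simp add: cauchy_seqs_iff)

lemma cauchy_seqs_add:
  assumes "x \<in> cauchy_seqs" "y \<in> cauchy_seqs"
  shows "(\<lambda>n. x n + y n) \<in> cauchy_seqs"
  unfolding cauchy_seqs_iff
proof (intro allI impI)
  fix e :: real assume e: "e > 0"
  obtain M where M: "\<And>m n. m \<ge> M \<Longrightarrow> n \<ge> M \<Longrightarrow> padic_abs p (x m - x n) < e"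
    using cauchy_seqsD[OF assms(1) e] by blast
  obtain N where N: "\<And>m n. m \<ge> N \<Longrightarrow> n \<ge> N \<Longrightarrow> padic_abs p (y m - y n) < e"
    using cauchy_seqsD[OF assms(2) e] by blast
  have "padic_abs p (x m + y m - (x n + y n)) < e" if "m \<ge> max M N" "n \<ge> max M N" for m n
    using padic_abs_add[of "x m - x n" "y m - y n"] M[of m n] N[of m n] that
    by (simp add: algebra_simps)
  then show "\<exists>N. \<forall>m\<ge>N. \<forall>n\<ge>N. padic_abs p (x m + y m - (x n + y n)) < e" by blast
qed

lemma convergent_padic_abs:
  assumes "x \<in> cauchy_seqs"
  shows "convergent (\<lambda>n. padic_abs p (x n))"
proof (rule real_Cauchy_convergent, rule CauchyI)
  fix e :: real assume "e > 0"
  with assms obtain N where "\<And>m n. m \<ge> N \<Longrightarrow> n \<ge> N \<Longrightarrow> padic_abs p (x m - x n) < e"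
    using cauchy_seqsD by metis
  then show "\<exists>M. \<forall>m\<ge>M. \<forall>n\<ge>M. norm (padic_abs p (x m) - padic_abs p (x n)) < e"
    using abs_padic_abs_diff by (metis order_le_less_trans real_norm_def)
qed

lemma cauchy_seqs_bounded:
  assumes "x \<in> cauchy_seqs"
  obtains B where "B > 0" "\<And>n. padic_abs p (x n) \<le> B"
  using convergent_imp_Bseq[OF convergent_padic_abs[OF assms]] unfolding Bseq_def by auto

lemma cauchy_seqs_mult:
  assumes "x \<in> cauchy_seqs" "y \<in> cauchy_seqs"
  shows "(\<lambda>n. x n * y n) \<in> cauchy_seqs"
  unfolding cauchy_seqs_iff
proof (intro allI impI)
  fix e :: real assume e: "e > 0"
  obtain B where B: "B > 0" "\<And>n. padic_abs p (x n) \<le> B" using cauchy_seqs_bounded[OF assms(1)] by blast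
  obtain C where C: "C > 0" "\<And>n. padic_abs p (y n) \<le> C" using cauchy_seqs_bounded[OF assms(2)] by blast
  obtain M where M: "\<And>m n. m \<ge> M \<Longrightarrow> n \<ge> M \<Longrightarrow> padic_abs p (x m - x n) < e / C"
    using cauchy_seqsD[OF assms(1), of "e / C"] e C by auto
  obtain N where N: "\<And>m n. m \<ge> N \<Longrightarrow> n \<ge> N \<Longrightarrow> padic_abs p (y m - y n) < e / B"
    using cauchy_seqsD[OF assms(2), of "e / B"] e B by auto
  have "padic_abs p (x m * y m - x n * y n) < e" if mn: "m \<ge> max M N" "n \<ge> max M N" for m n
  proof -
    have "padic_abs p (x m * (y m - y n)) < e"
    proof -
      have "padic_abs p (x m) * padic_abs p (y m - y n) \<le> B * padic_abs p (y m - y n)"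
        using B by (intro mult_right_mono) auto
      also have "\<dots> < B * (e / B)" using N[of m n] mn B by (intro mult_strict_left_mono) auto
      finally show ?thesis using B by (simp add: padic_abs_mult)
    qed
    moreover have "padic_abs p ((x m - x n) * y n) < e"
    proof -
      have "padic_abs p (x m - x n) * padic_abs p (y n) \<le> padic_abs p (x m - x n) * C"
        using C by (intro mult_left_mono) auto
      also have "\<dots> < e / C * C" using M[of m n] mn C by (intro mult_strict_right_mono) auto
      finally show ?thesis using C by (simp add: padic_abs_mult)
    qed
    moreover have "x m * y m - x n * y n = x m * (y m - y n) + (x m - x n) * y n"
      by (simp add: algebra_simps)
    ultimately show ?thesis
      using padic_abs_add[of "x m * (y m - y n)" "(x m - x n) * y n"] by auto
  qed
  then show "\<exists>N. \<forall>m\<ge>N. \<forall>n\<ge>N. padic_abs p (x m * y m - x n * y n) < e" by blast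
qed

lemma cauchy_seqs_uminus: "x \<in> cauchy_seqs \<Longrightarrow> (\<lambda>n. - x n) \<in> cauchy_seqs"
  using cauchy_seqs_mult[OF cauchy_seqs_const[of "-1"], of x] by simp

lemma cauchy_seqs_diff:
  "x \<in> cauchy_seqs \<Longrightarrow> y \<in> cauchy_seqs \<Longrightarrow> (\<lambda>n. x n - y n) \<in> cauchy_seqs"
  using cauchy_seqs_add[OF _ cauchy_seqs_uminus, of x y] by simp

lemma cauchy_ring_simps [simp]:
  "x \<otimes>\<^bsub>padic_cauchy_ring p\<^esub> y = (\<lambda>n. x n * y n)"
  "x \<oplus>\<^bsub>padic_cauchy_ring p\<^esub> y = (\<lambda>n. x n + y n)"
  "\<one>\<^bsub>padic_cauchy_ring p\<^esub> = (\<lambda>n. 1)"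
  "\<zero>\<^bsub>padic_cauchy_ring p\<^esub> = (\<lambda>n. 0)"
  by (simp_all add: padic_cauchy_ring_def)

lemma cring_cauchy_ring: "cring (padic_cauchy_ring p)"
proof (rule cringI)
  show "abelian_group (padic_cauchy_ring p)"
  proof (rule abelian_groupI)
    fix x assume x: "x \<in> cauchy_seqs"
    show "\<exists>y\<in>cauchy_seqs. y \<oplus>\<^bsub>padic_cauchy_ring p\<^esub> x = \<zero>\<^bsub>padic_cauchy_ring p\<^esub>"
      by (rule bexI[OF _ cauchy_seqs_uminus[OF x]]) simp
  qed (auto simp: algebra_simps intro: cauchy_seqs_add)
  show "comm_monoid (padic_cauchy_ring p)"
    by (rule comm_monoidI) (auto simp: algebra_simps intro: cauchy_seqs_mult)
qed (auto simp: algebra_simps)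

lemma a_inv_cauchy_ring:
  assumes "x \<in> cauchy_seqs"
  shows "\<ominus>\<^bsub>padic_cauchy_ring p\<^esub> x = (\<lambda>n. - x n)"
proof -
  interpret cring "padic_cauchy_ring p" by (rule cring_cauchy_ring)
  show ?thesis using assms by (intro minus_equality) (auto intro: cauchy_seqs_uminus)
qed

lemma null_ideal_subset: "padic_null_ideal p \<subseteq> cauchy_seqs"
proof
  fix x assume "x \<in> padic_null_ideal p"
  then have lim: "(\<lambda>n. padic_abs p (x n)) \<longlonglongrightarrow> 0" by (simp add: padic_null_ideal_def)
  show "x \<in> cauchy_seqs"
    unfolding cauchy_seqs_iff
  proof (intro allI impI)
    fix e :: real assume "e > 0"
    then obtain N where N: "\<And>n. n \<ge> N \<Longrightarrow> padic_abs p (x n) < e"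
      using LIMSEQ_D[OF lim] by fastforce
    have "padic_abs p (x m - x n) < e" if "m \<ge> N" "n \<ge> N" for m n
      using padic_abs_add[of "x m" "- x n"] N[of m] N[of n] that by auto
    then show "\<exists>N. \<forall>m\<ge>N. \<forall>n\<ge>N. padic_abs p (x m - x n) < e" by blast
  qed
qed

lemma null_ideal_mult:
  assumes a: "a \<in> padic_null_ideal p" and x: "x \<in> cauchy_seqs"
  shows "(\<lambda>n. a n * x n) \<in> padic_null_ideal p"
proof -
  obtain l where l: "(\<lambda>n. padic_abs p (x n)) \<longlonglongrightarrow> l"
    using convergent_padic_abs[OF x] by (auto simp: convergent_def)
  have "(\<lambda>n. padic_abs p (a n) * padic_abs p (x n)) \<longlonglongrightarrow> 0 * l"
    using a l unfolding padic_null_ideal_def by (intro tendsto_mult) auto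
  then show ?thesis by (simp add: padic_null_ideal_def padic_abs_mult)
qed

lemma null_ideal_add:
  assumes "x \<in> padic_null_ideal p" "y \<in> padic_null_ideal p"
  shows "(\<lambda>n. x n + y n) \<in> padic_null_ideal p"
proof -
  have "(\<lambda>n. padic_abs p (x n) + padic_abs p (y n)) \<longlonglongrightarrow> 0"
    using assms unfolding padic_null_ideal_def by (intro tendsto_add_zero) auto
  moreover have "norm (padic_abs p (x n + y n)) \<le> padic_abs p (x n) + padic_abs p (y n)" for n
    using padic_abs_add[of "x n" "y n"] padic_abs_nonneg[of "x n"] padic_abs_nonneg[of "y n"]
      padic_abs_nonneg[of "x n + y n"]
    unfolding real_norm_def by linarith
  ultimately have "(\<lambda>n. padic_abs p (x n + y n)) \<longlonglongrightarrow> 0"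
    by (rule Lim_null_comparison[OF always_eventually, OF allI, rotated])
  then show ?thesis by (simp add: padic_null_ideal_def)
qed

lemma ideal_null_ideal: "ideal (padic_null_ideal p) (padic_cauchy_ring p)"
proof (rule idealI)
  show "ring (padic_cauchy_ring p)" using cring_cauchy_ring by (rule cring.axioms(1))
  show "subgroup (padic_null_ideal p) (add_monoid (padic_cauchy_ring p))"
  proof
    show "padic_null_ideal p \<subseteq> carrier (add_monoid (padic_cauchy_ring p))"
      using null_ideal_subset by simp
    show "x \<otimes>\<^bsub>add_monoid (padic_cauchy_ring p)\<^esub> y \<in> padic_null_ideal p"
      if "x \<in> padic_null_ideal p" "y \<in> padic_null_ideal p" for x y
      using null_ideal_add[OF that] by simp
    show "\<one>\<^bsub>add_monoid (padic_cauchy_ring p)\<^esub> \<in> padic_null_ideal p"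
      by (simp add: padic_null_ideal_def)
    fix x assume x: "x \<in> padic_null_ideal p"
    then have "\<ominus>\<^bsub>padic_cauchy_ring p\<^esub> x = (\<lambda>n. - x n)"
      using null_ideal_subset by (intro a_inv_cauchy_ring) auto
    then show "inv\<^bsub>add_monoid (padic_cauchy_ring p)\<^esub> x \<in> padic_null_ideal p"
      using x by (simp add: a_inv_def padic_null_ideal_def)
  qed
  fix a x assume "a \<in> padic_null_ideal p" "x \<in> cauchy_seqs"
  from null_ideal_mult[OF this]
  show "x \<otimes>\<^bsub>padic_cauchy_ring p\<^esub> a \<in> padic_null_ideal p"
    "a \<otimes>\<^bsub>padic_cauchy_ring p\<^esub> x \<in> padic_null_ideal p"
    by (simp_all add: mult.commute)
qed

section \<open>Passage to classes and the absolute value on them\<close>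

lemma class_ring_hom_cring: "ring_hom_cring (padic_cauchy_ring p) (Qp p) (padic_class p)"
  using ideal.rcos_ring_hom_cring[OF ideal_null_ideal cring_cauchy_ring]
  unfolding Qp_def padic_class_def[abs_def] .

sublocale cls: ring_hom_cring "padic_cauchy_ring p" "Qp p" "padic_class p"
  by (rule class_ring_hom_cring)

lemma class_closed [simp]: "x \<in> cauchy_seqs \<Longrightarrow> padic_class p x \<in> carrier (Qp p)"
  by (rule cls.hom_closed)

lemma class_add:
  "x \<in> cauchy_seqs \<Longrightarrow> y \<in> cauchy_seqs
    \<Longrightarrow> padic_class p x \<oplus>\<^bsub>Qp p\<^esub> padic_class p y = padic_class p (\<lambda>n. x n + y n)"
  using cls.hom_add[of x y] by simp

lemma class_mult:
  "x \<in> cauchy_seqs \<Longrightarrow> y \<in> cauchy_seqs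
    \<Longrightarrow> padic_class p x \<otimes>\<^bsub>Qp p\<^esub> padic_class p y = padic_class p (\<lambda>n. x n * y n)"
  using cls.hom_mult[of x y] by simp

lemma class_minus:
  "x \<in> cauchy_seqs \<Longrightarrow> y \<in> cauchy_seqs
    \<Longrightarrow> padic_class p x \<ominus>\<^bsub>Qp p\<^esub> padic_class p y = padic_class p (\<lambda>n. x n - y n)"
  by (simp add: a_minus_def class_add cauchy_seqs_uminus a_inv_cauchy_ring flip: cls.hom_a_inv)

lemma Qp_one_zero: "\<one>\<^bsub>Qp p\<^esub> = padic_class p (\<lambda>n. 1)" "\<zero>\<^bsub>Qp p\<^esub> = padic_class p (\<lambda>n. 0)"
  using cls.hom_one cls.hom_zero by simp_all

lemma Qp_cases:
  assumes "a \<in> carrier (Qp p)"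
  obtains x where "x \<in> cauchy_seqs" "a = padic_class p x"
  using assms by (auto simp: Qp_def FactRing_def A_RCOSETS_def' padic_class_def)

text \<open>Justifies the definite description in \<open>Qp_abs\<close>: two representatives differ
  by a null sequence, and absolute values differ by at most the absolute value of the
  difference.\<close>

lemma padic_abs_class_tendsto:
  assumes x: "x \<in> cauchy_seqs"
  shows "(\<lambda>n. padic_abs p (x n)) \<longlonglongrightarrow> Qp_abs p (padic_class p x)"
proof -
  obtain l where l: "(\<lambda>n. padic_abs p (x n)) \<longlonglongrightarrow> l"
    using convergent_padic_abs[OF x] by (auto simp: convergent_def)
  have lim: "(\<lambda>n. padic_abs p (y n)) \<longlonglongrightarrow> l" if y: "y \<in> padic_class p x" for y
  proof -
    obtain z where z: "z \<in> padic_null_ideal p" "y = (\<lambda>n. z n + x n)"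
      using y by (auto simp: padic_class_def a_r_coset_def')
    have "(\<lambda>n. padic_abs p (y n) - padic_abs p (x n)) \<longlonglongrightarrow> 0"
    proof (rule Lim_null_comparison[where g = "\<lambda>n. padic_abs p (z n)"])
      show "\<forall>\<^sub>F n in sequentially. norm (padic_abs p (y n) - padic_abs p (x n)) \<le> padic_abs p (z n)"
      proof (intro always_eventually allI)
        fix n show "norm (padic_abs p (y n) - padic_abs p (x n)) \<le> padic_abs p (z n)"
          using abs_padic_abs_diff[of "y n" "x n"] by (simp add: z(2))
      qed
      show "(\<lambda>n. padic_abs p (z n)) \<longlonglongrightarrow> 0" using z(1) by (simp add: padic_null_ideal_def)
    qed
    from tendsto_add[OF this l] show ?thesis by simp
  qed
  have mem: "x \<in> padic_class p x"
    unfolding padic_class_def a_r_coset_def'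
    by (rule UN_I[of "\<lambda>n. 0"]) (auto simp: padic_null_ideal_def)
  have "Qp_abs p (padic_class p x) = l"
    unfolding Qp_abs_def
  proof (rule the_equality)
    show "\<forall>y\<in>padic_class p x. (\<lambda>n. padic_abs p (y n)) \<longlonglongrightarrow> l" using lim by blast
    show "l' = l" if "\<forall>y\<in>padic_class p x. (\<lambda>n. padic_abs p (y n)) \<longlonglongrightarrow> l'" for l'
      using that mem l LIMSEQ_unique by blast
  qed
  with l show ?thesis by simp
qed

lemma Qp_abs_class_eqI:
  "x \<in> cauchy_seqs \<Longrightarrow> (\<lambda>n. padic_abs p (x n)) \<longlonglongrightarrow> l \<Longrightarrow> Qp_abs p (padic_class p x) = l"
  using padic_abs_class_tendsto LIMSEQ_unique by blast

lemma Qp_abs_class_leI: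
  assumes "x \<in> cauchy_seqs" "\<And>n. n \<ge> N \<Longrightarrow> padic_abs p (x n) \<le> e"
  shows "Qp_abs p (padic_class p x) \<le> e"
  using assms by (intro LIMSEQ_le_const2[OF padic_abs_class_tendsto]) auto

lemma Qp_abs_nonneg [simp]: "a \<in> carrier (Qp p) \<Longrightarrow> 0 \<le> Qp_abs p a"
  by (erule Qp_cases) (auto intro: LIMSEQ_le_const[OF padic_abs_class_tendsto])

lemma Qp_abs_mult:
  assumes "a \<in> carrier (Qp p)" "b \<in> carrier (Qp p)"
  shows "Qp_abs p (a \<otimes>\<^bsub>Qp p\<^esub> b) = Qp_abs p a * Qp_abs p b"
proof -
  obtain x where x: "x \<in> cauchy_seqs" "a = padic_class p x" using Qp_cases assms(1) .
  obtain y where y: "y \<in> cauchy_seqs" "b = padic_class p y" using Qp_cases assms(2) .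
  show ?thesis
    using tendsto_mult[OF padic_abs_class_tendsto[OF x(1)] padic_abs_class_tendsto[OF y(1)]] x y
    by (auto simp: class_mult padic_abs_mult cauchy_seqs_mult intro!: Qp_abs_class_eqI)
qed

lemma Qp_abs_add:
  assumes "a \<in> carrier (Qp p)" "b \<in> carrier (Qp p)"
  shows "Qp_abs p (a \<oplus>\<^bsub>Qp p\<^esub> b) \<le> max (Qp_abs p a) (Qp_abs p b)"
proof -
  obtain x where x: "x \<in> cauchy_seqs" "a = padic_class p x" using Qp_cases assms(1) .
  obtain y where y: "y \<in> cauchy_seqs" "b = padic_class p y" using Qp_cases assms(2) .
  have "(\<lambda>n. padic_abs p (x n + y n)) \<longlonglongrightarrow> Qp_abs p (a \<oplus>\<^bsub>Qp p\<^esub> b)"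
    using x y by (simp add: class_add cauchy_seqs_add padic_abs_class_tendsto)
  moreover have "(\<lambda>n. max (padic_abs p (x n)) (padic_abs p (y n))) \<longlonglongrightarrow> max (Qp_abs p a) (Qp_abs p b)"
    unfolding x(2) y(2) by (intro tendsto_max padic_abs_class_tendsto x(1) y(1))
  moreover have "\<exists>N. \<forall>n\<ge>N. padic_abs p (x n + y n) \<le> max (padic_abs p (x n)) (padic_abs p (y n))"
    by (simp add: padic_abs_add)
  ultimately show ?thesis
    by (rule LIMSEQ_le)
qed

lemma Qp_abs_of_rat [simp]: "Qp_abs p (Qp_of_rat p r) = padic_abs p r"
  unfolding Qp_of_rat_eq_class by (rule Qp_abs_class_eqI) auto

lemma Qp_of_rat_closed [simp]: "Qp_of_rat p r \<in> carrier (Qp p)"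
  by (simp add: Qp_of_rat_eq_class)

lemma Qp_of_rat_add: "Qp_of_rat p r \<oplus>\<^bsub>Qp p\<^esub> Qp_of_rat p s = Qp_of_rat p (r + s)"
  and Qp_of_rat_mult: "Qp_of_rat p r \<otimes>\<^bsub>Qp p\<^esub> Qp_of_rat p s = Qp_of_rat p (r * s)"
  and Qp_of_rat_minus: "Qp_of_rat p r \<ominus>\<^bsub>Qp p\<^esub> Qp_of_rat p s = Qp_of_rat p (r - s)"
  by (simp_all add: Qp_of_rat_eq_class class_add class_mult class_minus)

lemma Qp_of_rat_0: "Qp_of_rat p 0 = \<zero>\<^bsub>Qp p\<^esub>" and Qp_of_rat_1: "Qp_of_rat p 1 = \<one>\<^bsub>Qp p\<^esub>"
  by (simp_all add: Qp_of_rat_eq_class Qp_one_zero)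

lemma Qp_abs_zero [simp]: "Qp_abs p \<zero>\<^bsub>Qp p\<^esub> = 0"
  using Qp_abs_of_rat[of 0] by (simp add: Qp_of_rat_0)

lemma Qp_abs_one [simp]: "Qp_abs p \<one>\<^bsub>Qp p\<^esub> = 1"
  using Qp_abs_of_rat[of 1] by (simp add: Qp_of_rat_1)

lemma Qp_abs_eq_0_iff:
  assumes "a \<in> carrier (Qp p)"
  shows "Qp_abs p a = 0 \<longleftrightarrow> a = \<zero>\<^bsub>Qp p\<^esub>"
proof
  assume 0: "Qp_abs p a = 0"
  obtain x where x: "x \<in> cauchy_seqs" "a = padic_class p x" using Qp_cases assms .
  with 0 have "x \<in> padic_null_ideal p"
    using padic_abs_class_tendsto[OF x(1)] by (simp add: padic_null_ideal_def)
  then have "padic_class p x = padic_null_ideal p"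
    unfolding padic_class_def using ideal_null_ideal
    by (intro abelian_subgroup.a_rcos_const abelian_subgroupI3)
       (auto simp: ideal_def cring_cauchy_ring cring.axioms(1) ring.is_abelian_group)
  then show "a = \<zero>\<^bsub>Qp p\<^esub>" using x by (simp add: Qp_def FactRing_def)
qed simp

lemma Qp_abs_uminus [simp]:
  assumes "a \<in> carrier (Qp p)"
  shows "Qp_abs p (\<ominus>\<^bsub>Qp p\<^esub> a) = Qp_abs p a"
proof -
  have "\<ominus>\<^bsub>Qp p\<^esub> a = Qp_of_rat p (-1) \<otimes>\<^bsub>Qp p\<^esub> a"
  proof (rule cls.S.minus_equality)
    have "Qp_of_rat p (-1) \<otimes>\<^bsub>Qp p\<^esub> a \<oplus>\<^bsub>Qp p\<^esub> a
        = (Qp_of_rat p (-1) \<oplus>\<^bsub>Qp p\<^esub> Qp_of_rat p 1) \<otimes>\<^bsub>Qp p\<^esub> a"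
      using assms by (simp add: cls.S.l_distr Qp_of_rat_1)
    then show "Qp_of_rat p (-1) \<otimes>\<^bsub>Qp p\<^esub> a \<oplus>\<^bsub>Qp p\<^esub> a = \<zero>\<^bsub>Qp p\<^esub>"
      using assms by (simp add: Qp_of_rat_add Qp_of_rat_0)
  qed (use assms in auto)
  then show ?thesis using assms by (simp add: Qp_abs_mult)
qed

text \<open>If the limit is below the next power of \<open>p\<close>, so are eventually the terms,
  and discreteness on the rationals bounds them; the gap between powers thus survives
  completion.\<close>

lemma Qp_abs_lt_imp_le:
  assumes "a \<in> carrier (Qp p)" "Qp_abs p a < real p / real p ^ k"
  shows "Qp_abs p a \<le> 1 / real p ^ k"
proof -
  obtain x where x: "x \<in> cauchy_seqs" "a = padic_class p x" using Qp_cases assms(1) .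
  have "\<forall>\<^sub>F n in sequentially. padic_abs p (x n) < real p / real p ^ k"
    using order_tendstoD(2)[OF padic_abs_class_tendsto[OF x(1)]] assms x by simp
  then have "\<forall>\<^sub>F n in sequentially. padic_abs p (x n) \<le> 1 / real p ^ k"
    by (rule eventually_mono) (rule padic_abs_lt_p_power_imp_le)
  then show ?thesis
    using tendsto_upperbound[OF padic_abs_class_tendsto[OF x(1)]] x by simp
qed

section \<open>The ultrametric on the p-adic numbers\<close>

lemma Qp_dist_eq:
  "a \<in> carrier (Qp p) \<Longrightarrow> b \<in> carrier (Qp p) \<Longrightarrow> Qp_dist p a b = Qp_abs p (a \<ominus>\<^bsub>Qp p\<^esub> b)"
  by (simp add: Qp_dist_def)

lemma Qp_dist_nonneg [simp]: "0 \<le> Qp_dist p a b"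
  by (simp add: Qp_dist_def)

lemma Qp_dist_commute: "Qp_dist p a b = Qp_dist p b a"
proof (cases "a \<in> carrier (Qp p) \<and> b \<in> carrier (Qp p)")
  case True
  then have "a \<ominus>\<^bsub>Qp p\<^esub> b = \<ominus>\<^bsub>Qp p\<^esub> (b \<ominus>\<^bsub>Qp p\<^esub> a)"
    by (simp add: a_minus_def cls.S.minus_add cls.S.a_comm)
  with True show ?thesis by (simp add: Qp_dist_eq)
qed (auto simp: Qp_dist_def)

lemma Qp_dist_ultra:
  assumes "a \<in> carrier (Qp p)" "b \<in> carrier (Qp p)" "c \<in> carrier (Qp p)"
  shows "Qp_dist p a c \<le> max (Qp_dist p a b) (Qp_dist p b c)"
proof -
  have "a \<ominus>\<^bsub>Qp p\<^esub> c = (a \<ominus>\<^bsub>Qp p\<^esub> b) \<oplus>\<^bsub>Qp p\<^esub> (b \<ominus>\<^bsub>Qp p\<^esub> c)"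
    using assms by algebra
  then show ?thesis
    using assms Qp_abs_add[of "a \<ominus>\<^bsub>Qp p\<^esub> b" "b \<ominus>\<^bsub>Qp p\<^esub> c"] by (simp add: Qp_dist_eq)
qed

lemma Qp_dist_trans_le:
  "Qp_dist p a b \<le> e \<Longrightarrow> Qp_dist p b c \<le> e \<Longrightarrow> a \<in> carrier (Qp p) \<Longrightarrow> b \<in> carrier (Qp p)
    \<Longrightarrow> c \<in> carrier (Qp p) \<Longrightarrow> Qp_dist p a c \<le> e"
  using Qp_dist_ultra[of a b c] by linarith

lemma Qp_dist_eq_0_iff:
  assumes "a \<in> carrier (Qp p)" "b \<in> carrier (Qp p)"
  shows "Qp_dist p a b = 0 \<longleftrightarrow> a = b"
proof
  assume "Qp_dist p a b = 0"
  then have "a \<ominus>\<^bsub>Qp p\<^esub> b = \<zero>\<^bsub>Qp p\<^esub>" using assms by (simp add: Qp_dist_eq Qp_abs_eq_0_iff)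
  moreover have "a = (a \<ominus>\<^bsub>Qp p\<^esub> b) \<oplus>\<^bsub>Qp p\<^esub> b" using assms by algebra
  ultimately show "a = b" using assms by simp
next
  assume "a = b"
  then show "Qp_dist p a b = 0" using assms by (simp add: Qp_dist_eq a_minus_def cls.S.r_neg)
qed

lemma Metric_space_Qp: "Metric_space (carrier (Qp p)) (Qp_dist p)"
proof
  fix a b c assume "a \<in> carrier (Qp p)" "b \<in> carrier (Qp p)" "c \<in> carrier (Qp p)"
  from Qp_dist_ultra[OF this] show "Qp_dist p a c \<le> Qp_dist p a b + Qp_dist p b c"
    using Qp_dist_nonneg[of a b] Qp_dist_nonneg[of b c] by linarith
qed (auto simp: Qp_dist_eq_0_iff Qp_dist_commute)

lemma Qp_dist_of_rat [simp]: "Qp_dist p (Qp_of_rat p r) (Qp_of_rat p s) = padic_abs p (r - s)"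
  by (simp add: Qp_dist_eq Qp_of_rat_minus)

lemma Qp_dist_add_le:
  assumes "a \<in> carrier (Qp p)" "b \<in> carrier (Qp p)" "c \<in> carrier (Qp p)" "d \<in> carrier (Qp p)"
    and "Qp_dist p a c \<le> e" "Qp_dist p b d \<le> e"
  shows "Qp_dist p (a \<oplus>\<^bsub>Qp p\<^esub> b) (c \<oplus>\<^bsub>Qp p\<^esub> d) \<le> e"
proof -
  have "(a \<oplus>\<^bsub>Qp p\<^esub> b) \<ominus>\<^bsub>Qp p\<^esub> (c \<oplus>\<^bsub>Qp p\<^esub> d) = (a \<ominus>\<^bsub>Qp p\<^esub> c) \<oplus>\<^bsub>Qp p\<^esub> (b \<ominus>\<^bsub>Qp p\<^esub> d)"
    using assms(1-4) by algebra
  then show ?thesis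
    using assms Qp_abs_add[of "a \<ominus>\<^bsub>Qp p\<^esub> c" "b \<ominus>\<^bsub>Qp p\<^esub> d"] by (simp add: Qp_dist_eq)
qed

lemma Qp_dist_mult_right:
  assumes "a \<in> carrier (Qp p)" "b \<in> carrier (Qp p)" "c \<in> carrier (Qp p)"
  shows "Qp_dist p (a \<otimes>\<^bsub>Qp p\<^esub> c) (b \<otimes>\<^bsub>Qp p\<^esub> c) = Qp_dist p a b * Qp_abs p c"
proof -
  have "a \<otimes>\<^bsub>Qp p\<^esub> c \<ominus>\<^bsub>Qp p\<^esub> b \<otimes>\<^bsub>Qp p\<^esub> c = (a \<ominus>\<^bsub>Qp p\<^esub> b) \<otimes>\<^bsub>Qp p\<^esub> c"
    using assms by algebra
  then show ?thesis using assms by (simp add: Qp_dist_eq Qp_abs_mult)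
qed

lemma Qp_abs_le_if_dist_le:
  assumes "a \<in> carrier (Qp p)" "b \<in> carrier (Qp p)" "Qp_dist p a b \<le> e" "Qp_abs p b \<le> e"
  shows "Qp_abs p a \<le> e"
proof -
  have "a = (a \<ominus>\<^bsub>Qp p\<^esub> b) \<oplus>\<^bsub>Qp p\<^esub> b" using assms(1,2) by algebra
  then show ?thesis
    using assms Qp_abs_add[of "a \<ominus>\<^bsub>Qp p\<^esub> b" b] by (simp add: Qp_dist_eq)
qed

end

section \<open>p-adic integers and evaluation of polynomials\<close>

lemma Zp_carrier: "carrier (Zp p) = {a \<in> carrier (Qp p). Qp_abs p a \<le> 1}"
  and Zp_simps [simp]: "mult (Zp p) = mult (Qp p)" "add (Zp p) = add (Qp p)"
    "one (Zp p) = one (Qp p)" "zero (Zp p) = zero (Qp p)"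
  by (simp_all add: Zp_def)

context prime_padic
begin

lemma Zp_closed_Qp: "a \<in> carrier (Zp p) \<Longrightarrow> a \<in> carrier (Qp p)"
  and Zp_abs_le_1: "a \<in> carrier (Zp p) \<Longrightarrow> Qp_abs p a \<le> 1"
  by (simp_all add: Zp_carrier)

lemma Zp_mult_closed:
  "a \<in> carrier (Zp p) \<Longrightarrow> b \<in> carrier (Zp p) \<Longrightarrow> a \<otimes>\<^bsub>Qp p\<^esub> b \<in> carrier (Zp p)"
  by (simp add: Zp_carrier Qp_abs_mult mult_le_one)

lemma Zp_add_closed:
  assumes "a \<in> carrier (Zp p)" "b \<in> carrier (Zp p)"
  shows "a \<oplus>\<^bsub>Qp p\<^esub> b \<in> carrier (Zp p)"
  using assms Qp_abs_add[of a b] by (auto simp: Zp_carrier)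

lemma Zp_uminus_closed: "a \<in> carrier (Zp p) \<Longrightarrow> \<ominus>\<^bsub>Qp p\<^esub> a \<in> carrier (Zp p)"
  by (simp add: Zp_carrier)

lemma Zp_zero_one_closed: "\<zero>\<^bsub>Qp p\<^esub> \<in> carrier (Zp p)" "\<one>\<^bsub>Qp p\<^esub> \<in> carrier (Zp p)"
  by (simp_all add: Zp_carrier)

lemma cring_Zp: "cring (Zp p)"
proof (rule cringI)
  show "abelian_group (Zp p)"
  proof (rule abelian_groupI)
    fix x assume x: "x \<in> carrier (Zp p)"
    then show "\<exists>y\<in>carrier (Zp p). y \<oplus>\<^bsub>Zp p\<^esub> x = \<zero>\<^bsub>Zp p\<^esub>"
      by (intro bexI[of _ "\<ominus>\<^bsub>Qp p\<^esub> x"]) (simp_all add: cls.S.l_neg Zp_closed_Qp Zp_uminus_closed)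
  qed (simp_all add: Zp_add_closed Zp_zero_one_closed Zp_closed_Qp cls.S.a_ac)
  show "comm_monoid (Zp p)"
    by (rule comm_monoidI)
       (simp_all add: Zp_mult_closed Zp_zero_one_closed Zp_closed_Qp cls.S.m_ac)
qed (simp add: Zp_closed_Qp cls.S.l_distr)

lemma Zp_of_int [simp]: "Qp_of_rat p (of_int m) \<in> carrier (Zp p)"
  by (simp add: Zp_carrier padic_abs_of_int_le_1)

text \<open>A limit at most 1 does not by itself bound the terms by 1; but they are eventually below
  \<open>p\<close>, and no absolute value lies strictly between 1 and \<open>p\<close>.\<close>

lemma Zp_cases:
  assumes "a \<in> carrier (Zp p)"
  obtains x N where "x \<in> cauchy_seqs" "a = padic_class p x" "\<And>n. n \<ge> N \<Longrightarrow> padic_abs p (x n) \<le> 1"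
proof -
  obtain x where x: "x \<in> cauchy_seqs" "a = padic_class p x" using Qp_cases[OF Zp_closed_Qp[OF assms]] .
  have "Qp_abs p a < real p" using Zp_abs_le_1[OF assms] p_gt_1 by linarith
  then have "\<forall>\<^sub>F n in sequentially. padic_abs p (x n) < real p"
    using order_tendstoD(2)[OF padic_abs_class_tendsto[OF x(1)]] x(2) by simp
  then obtain N where "\<And>n. n \<ge> N \<Longrightarrow> padic_abs p (x n) < real p"
    by (auto simp: eventually_sequentially)
  then show ?thesis using that[OF x] padic_abs_lt_p_imp_le_1 by blast
qed

text \<open>Rounding in two stages: to a term of a representing sequence, which is a rational of
  absolute value at most 1, and then to an integer.\<close>

lemma Zp_approx_by_int:
  assumes "a \<in> carrier (Zp p)"
  shows "\<exists>m. Qp_dist p a (Qp_of_rat p (of_int m)) \<le> 1 / real p ^ k"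
proof -
  obtain x N where x: "x \<in> cauchy_seqs" "a = padic_class p x"
    and N: "\<And>n. n \<ge> N \<Longrightarrow> padic_abs p (x n) \<le> 1" using Zp_cases[OF assms] by metis
  have "1 / real p ^ k > 0" using p_pos by simp
  then obtain M where M: "\<And>m n. m \<ge> M \<Longrightarrow> n \<ge> M \<Longrightarrow> padic_abs p (x m - x n) < 1 / real p ^ k"
    using cauchy_seqsD[OF x(1)] by blast
  \<comment> \<open>The index \<open>max M N\<close> makes \<open>r\<close> both integral at
    \<open>p\<close> and close to all terms from \<open>M\<close> on.\<close>
  define r where "r = x (max M N)"
  have "padic_abs p r \<le> 1" unfolding r_def by (rule N) simp
  then obtain m where m: "padic_abs p (r - of_int m) \<le> 1 / real p ^ k"
    using approx_by_int by blast
  have "padic_abs p (x n - of_int m) \<le> 1 / real p ^ k" if "n \<ge> M" for n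
    using M[of n "max M N"] that m padic_abs_diff_trans[of "x n" r _ "of_int m"] by (simp add: r_def)
  then have "Qp_dist p a (Qp_of_rat p (of_int m)) \<le> 1 / real p ^ k"
    using x by (simp add: Qp_dist_eq class_minus Qp_of_rat_eq_class)
      (intro Qp_abs_class_leI[of _ M] cauchy_seqs_diff; simp)
  then show ?thesis ..
qed

text \<open>Will produce the coefficients of the expansion from digits \<open>d k\<close>, which may
  be arbitrary integers. The partial sums are themselves a Cauchy sequence of rationals, so their
  class is the limit; from \<open>K\<close> on they change only by multiples of
  \<open>p ^ K\<close>.\<close>

lemma int_series_limit:
  fixes d :: "nat \<Rightarrow> int"
  shows "\<exists>c\<in>carrier (Zp p). \<forall>K.
    Qp_dist p c (Qp_of_rat p (of_int (\<Sum>k<K. int p ^ k * d k))) \<le> 1 / real p ^ K"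
proof -
  define s where "s K = (\<Sum>k<K. int p ^ k * d k)" for K
  have dvd: "int p ^ K dvd s m - s K" if "m \<ge> K" for m K
    using that
  proof (induction m rule: dec_induct)
    case (step m)
    have "s (Suc m) - s K = (s m - s K) + int p ^ m * d m" by (simp add: s_def)
    moreover have "int p ^ K dvd int p ^ m * d m"
      using step(1) by (simp add: le_imp_power_dvd dvd_mult2)
    ultimately show ?case using step by (metis dvd_add)
  qed simp
  have le: "padic_abs p (of_int (s m) - of_int (s K)) \<le> 1 / real p ^ K" if "m \<ge> K" for m K
    using dvd[OF that] padic_abs_of_int_le_iff by (metis of_int_diff)
  have cau: "(\<lambda>n. of_int (s n)) \<in> cauchy_seqs"
    unfolding cauchy_seqs_iff
  proof (intro allI impI)
    fix e :: real assume "e > 0"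
    then obtain K where K: "1 / real p ^ K < e" using obtain_p_power_less by blast
    have "padic_abs p (of_int (s m) - of_int (s n)) < e" if "m \<ge> K" "n \<ge> K" for m n
      using padic_abs_diff_trans[of "of_int (s m)" "of_int (s K)" _ "of_int (s n)"]
        le[OF that(1)] le[OF that(2)] K by (force simp: padic_abs_minus_commute)
    then show "\<exists>N. \<forall>m\<ge>N. \<forall>n\<ge>N. padic_abs p (of_int (s m) - of_int (s n)) < e" by blast
  qed
  define c where "c = padic_class p (\<lambda>n. of_int (s n))"
  have "c \<in> carrier (Zp p)"
    unfolding c_def Zp_carrier using cau padic_abs_of_int_le_1
    by (auto intro: Qp_abs_class_leI)
  moreover have "Qp_dist p c (Qp_of_rat p (of_int (s K))) \<le> 1 / real p ^ K" for K
    unfolding c_def using cau le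
    by (simp add: Qp_dist_eq class_minus Qp_of_rat_eq_class)
      (intro Qp_abs_class_leI[of _ K] cauchy_seqs_diff; simp)
  ultimately show ?thesis unfolding s_def by blast
qed

section \<open>Estimates and identities for polynomial evaluation\<close>

text \<open>Follows Horner's recursion; the value bound is carried along because the Lipschitz step
  for \<open>pCons\<close> consumes it.\<close>

lemma poly_padic_bound:
  assumes "\<And>i. padic_abs p (coeff f i) \<le> C" "padic_abs p x \<le> 1" "padic_abs p y \<le> 1"
  shows "padic_abs p (poly f x) \<le> C \<and> padic_abs p (poly f x - poly f y) \<le> C * padic_abs p (x - y)"
  using assms(1)
proof (induction f)
  case 0
  then have "0 \<le> C" by (metis padic_abs_0 coeff_0)
  then show ?case by simp
next
  case (pCons a f)
  have C: "0 \<le> C" using pCons.prems padic_abs_nonneg order_trans by blast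
  have IH: "padic_abs p (poly f x) \<le> C" "padic_abs p (poly f x - poly f y) \<le> C * padic_abs p (x - y)"
    using pCons.IH pCons.prems[of "Suc _"] by auto
  have a: "padic_abs p a \<le> C" using pCons.prems[of 0] by simp
  have 1: "padic_abs p (x * poly f x) \<le> C"
    using mult_mono[OF assms(2) IH(1)] by (simp add: padic_abs_mult)
  have eq: "poly (pCons a f) x - poly (pCons a f) y
      = y * (poly f x - poly f y) + (x - y) * poly f x"
    by (simp add: algebra_simps)
  have "padic_abs p (y * (poly f x - poly f y)) \<le> C * padic_abs p (x - y)"
    using mult_mono[OF assms(3) IH(2)] by (simp add: padic_abs_mult)
  moreover have "padic_abs p ((x - y) * poly f x) \<le> C * padic_abs p (x - y)"
    using mult_left_mono[OF IH(1), of "padic_abs p (x - y)"] by (simp add: padic_abs_mult mult.commute)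
  ultimately have "padic_abs p (poly (pCons a f) x - poly (pCons a f) y) \<le> C * padic_abs p (x - y)"
    unfolding eq by (rule padic_abs_add_le)
  with padic_abs_add_le[OF a 1] show ?case by simp
qed

lemma poly_coeff_bound: "\<exists>C>0. \<forall>i. padic_abs p (coeff f i) \<le> C"
proof (intro exI conjI allI)
  \<comment> \<open>The summand \<open>1\<close> keeps the bound positive for the zero polynomial,
    since a later estimate divides by it.\<close>
  let ?C = "1 + (\<Sum>i\<le>degree f. padic_abs p (coeff f i))"
  show "?C > 0" by (intro add_pos_nonneg sum_nonneg) auto
  show "padic_abs p (coeff f i) \<le> ?C" for i
  proof (cases "i \<le> degree f")
    case True
    then show ?thesis
      using member_le_sum[of i "{..degree f}" "\<lambda>i. padic_abs p (coeff f i)"] by simp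
  next
    case False
    then show ?thesis using \<open>?C > 0\<close> by (simp add: coeff_eq_0)
  qed
qed

lemma cauchy_seqs_poly: "x \<in> cauchy_seqs \<Longrightarrow> (\<lambda>n. poly f (x n)) \<in> cauchy_seqs"
  by (induction f) (auto intro!: cauchy_seqs_add cauchy_seqs_mult)

text \<open>Evaluation is computed term by term on a representing sequence, which turns identities
  between values into identities about \<open>poly\<close>.\<close>

lemma Qp_eval_class:
  assumes x: "x \<in> cauchy_seqs"
  shows "Qp_eval p f (padic_class p x) = padic_class p (\<lambda>n. poly f (x n))"
proof -
  have pow: "(\<lambda>n. x n ^ i) \<in> cauchy_seqs \<and> padic_class p x [^]\<^bsub>Qp p\<^esub> i = padic_class p (\<lambda>n. x n ^ i)" for i :: nat
    by (induction i) (use x in \<open>auto simp: Qp_one_zero class_mult cauchy_seqs_mult mult.commute\<close>)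
  have sum: "(\<lambda>n. \<Sum>i\<le>k. g i n) \<in> cauchy_seqs \<and>
      (\<Oplus>\<^bsub>Qp p\<^esub>i\<in>{..k}. padic_class p (g i)) = padic_class p (\<lambda>n. \<Sum>i\<le>k. g i n)"
    if "\<And>i. g i \<in> cauchy_seqs" for g :: "nat \<Rightarrow> nat \<Rightarrow> rat" and k
    using that by (induction k) (auto simp: class_add cauchy_seqs_add add.commute)
  have "Qp_eval p f (padic_class p x)
      = (\<Oplus>\<^bsub>Qp p\<^esub>i\<in>{..degree f}. padic_class p (\<lambda>n. coeff f i * x n ^ i))"
    unfolding Qp_eval_def
    by (simp add: pow Qp_of_rat_eq_class class_mult)
  also have "\<dots> = padic_class p (\<lambda>n. \<Sum>i\<le>degree f. coeff f i * x n ^ i)"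
    using sum[of "\<lambda>i n. coeff f i * x n ^ i" "degree f"] pow cauchy_seqs_mult[OF cauchy_seqs_const]
    by simp
  finally show ?thesis by (simp add: poly_altdef)
qed

lemma Qp_eval_closed [simp]: "a \<in> carrier (Qp p) \<Longrightarrow> Qp_eval p f a \<in> carrier (Qp p)"
  by (erule Qp_cases) (simp add: Qp_eval_class cauchy_seqs_poly)

lemma Qp_eval_of_rat: "Qp_eval p f (Qp_of_rat p r) = Qp_of_rat p (poly f r)"
  by (simp add: Qp_of_rat_eq_class Qp_eval_class)

lemma Qp_eval_0: "a \<in> carrier (Qp p) \<Longrightarrow> Qp_eval p 0 a = \<zero>\<^bsub>Qp p\<^esub>"
  by (erule Qp_cases) (simp add: Qp_eval_class Qp_one_zero)

lemma Qp_eval_add: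
  "a \<in> carrier (Qp p) \<Longrightarrow> Qp_eval p (f + g) a = Qp_eval p f a \<oplus>\<^bsub>Qp p\<^esub> Qp_eval p g a"
  by (erule Qp_cases) (simp add: Qp_eval_class class_add cauchy_seqs_poly)

lemma Qp_eval_minus:
  "a \<in> carrier (Qp p) \<Longrightarrow> Qp_eval p (f - g) a = Qp_eval p f a \<ominus>\<^bsub>Qp p\<^esub> Qp_eval p g a"
  by (erule Qp_cases) (simp add: Qp_eval_class class_minus cauchy_seqs_poly)

lemma Qp_eval_smult:
  "a \<in> carrier (Qp p) \<Longrightarrow> Qp_eval p (smult r f) a = Qp_of_rat p r \<otimes>\<^bsub>Qp p\<^esub> Qp_eval p f a"
  by (erule Qp_cases) (simp add: Qp_eval_class Qp_of_rat_eq_class class_mult cauchy_seqs_poly)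

lemma finsum_lessThan_Suc:
  "(\<And>n. n \<le> m \<Longrightarrow> g n \<in> carrier (Qp p)) \<Longrightarrow>
    (\<Oplus>\<^bsub>Qp p\<^esub>n\<in>{..<Suc m}. g n) = g m \<oplus>\<^bsub>Qp p\<^esub> (\<Oplus>\<^bsub>Qp p\<^esub>n\<in>{..<m}. g n)"
  unfolding lessThan_Suc by (intro cls.S.finsum_insert) auto

lemma Qp_eval_sum:
  fixes f :: "nat \<Rightarrow> rat poly"
  assumes "a \<in> carrier (Qp p)"
  shows "Qp_eval p (\<Sum>n<m. smult (r n) (f n)) a
    = (\<Oplus>\<^bsub>Qp p\<^esub>n\<in>{..<m}. Qp_of_rat p (r n) \<otimes>\<^bsub>Qp p\<^esub> Qp_eval p (f n) a)"
proof (induction m)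
  case (Suc m)
  show ?case
    by (subst finsum_lessThan_Suc) (use assms Suc in
      \<open>simp_all add: Qp_eval_add Qp_eval_smult cls.S.a_comm cls.S.finsum_closed\<close>)
qed (use assms in \<open>simp add: Qp_eval_0\<close>)

text \<open>Ultrametric error propagation: when coefficients are rounded, the error of the sum is at
  most the worst coefficient error, however many terms there are.\<close>

lemma Qp_dist_finsum_le:
  fixes c d b :: "nat \<Rightarrow> padic"
  assumes "\<And>n. n < m \<Longrightarrow> c n \<in> carrier (Qp p)" "\<And>n. n < m \<Longrightarrow> d n \<in> carrier (Qp p)"
    and "\<And>n. n < m \<Longrightarrow> b n \<in> carrier (Zp p)"
    and "\<And>n. n < m \<Longrightarrow> Qp_dist p (c n) (d n) \<le> e" and e: "0 \<le> e"
  shows "Qp_dist p (\<Oplus>\<^bsub>Qp p\<^esub>n\<in>{..<m}. c n \<otimes>\<^bsub>Qp p\<^esub> b n) (\<Oplus>\<^bsub>Qp p\<^esub>n\<in>{..<m}. d n \<otimes>\<^bsub>Qp p\<^esub> b n) \<le> e"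
  using assms
proof (induction m)
  case 0
  moreover have "Qp_dist p \<zero>\<^bsub>Qp p\<^esub> \<zero>\<^bsub>Qp p\<^esub> = 0" by (simp add: Qp_dist_eq_0_iff)
  ultimately show ?case by simp
next
  case (Suc m)
  have b: "b n \<in> carrier (Qp p)" if "n < Suc m" for n using Suc.prems(3) that Zp_closed_Qp by blast
  have "Qp_dist p (c m \<otimes>\<^bsub>Qp p\<^esub> b m) (d m \<otimes>\<^bsub>Qp p\<^esub> b m) = Qp_dist p (c m) (d m) * Qp_abs p (b m)"
    using Suc.prems b by (intro Qp_dist_mult_right) auto
  also have "\<dots> \<le> e * 1"
    using Suc.prems(4)[of m] Zp_abs_le_1[OF Suc.prems(3)[of m]] b[of m] e by (intro mult_mono) auto
  finally have 1: "Qp_dist p (c m \<otimes>\<^bsub>Qp p\<^esub> b m) (d m \<otimes>\<^bsub>Qp p\<^esub> b m) \<le> e" by simp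
  show ?case
    using Suc b 1
    by (subst (1 2) finsum_lessThan_Suc) (auto intro!: Qp_dist_add_le cls.S.finsum_closed)
qed

lemma Qp_eval_bound:
  assumes C: "\<And>i. padic_abs p (coeff f i) \<le> C" and a: "a \<in> carrier (Zp p)" and b: "b \<in> carrier (Zp p)"
  shows "Qp_abs p (Qp_eval p f a) \<le> C"
    and "Qp_dist p (Qp_eval p f a) (Qp_eval p f b) \<le> C * Qp_dist p a b"
proof -
  obtain x N where x: "x \<in> cauchy_seqs" "a = padic_class p x"
    and N: "\<And>n. n \<ge> N \<Longrightarrow> padic_abs p (x n) \<le> 1" using Zp_cases[OF a] by metis
  obtain y M where y: "y \<in> cauchy_seqs" "b = padic_class p y"
    and M: "\<And>n. n \<ge> M \<Longrightarrow> padic_abs p (y n) \<le> 1" using Zp_cases[OF b] by metis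
  show "Qp_abs p (Qp_eval p f a) \<le> C"
    unfolding x(2) Qp_eval_class[OF x(1)]
    using poly_padic_bound[OF C N N] by (intro Qp_abs_class_leI[of _ N] cauchy_seqs_poly x(1)) blast
  have "(\<lambda>n. padic_abs p (poly f (x n) - poly f (y n))) \<longlonglongrightarrow> Qp_dist p (Qp_eval p f a) (Qp_eval p f b)"
    using x y by (simp add: Qp_dist_eq Qp_eval_class class_minus cauchy_seqs_poly)
      (intro padic_abs_class_tendsto cauchy_seqs_diff cauchy_seqs_poly)
  moreover have "(\<lambda>n. padic_abs p (x n - y n)) \<longlonglongrightarrow> Qp_dist p a b"
    using x y by (simp add: Qp_dist_eq class_minus) (intro padic_abs_class_tendsto cauchy_seqs_diff)
  then have "(\<lambda>n. C * padic_abs p (x n - y n)) \<longlonglongrightarrow> C * Qp_dist p a b"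
    by (rule tendsto_mult_left)
  moreover have "\<exists>L. \<forall>n\<ge>L. padic_abs p (poly f (x n) - poly f (y n)) \<le> C * padic_abs p (x n - y n)"
    using poly_padic_bound[OF C N M] by (intro exI[of _ "max M N"]) auto
  ultimately show "Qp_dist p (Qp_eval p f a) (Qp_eval p f b) \<le> C * Qp_dist p a b"
    by (rule LIMSEQ_le)
qed

text \<open>One integer approximates both the point and the value, so statements about values at
  p-adic integers reduce to values of \<open>poly\<close> at integers.\<close>

lemma Qp_eval_approx:
  assumes "a \<in> carrier (Zp p)"
  shows "\<exists>m. Qp_dist p a (Qp_of_rat p (of_int m)) \<le> 1 / real p ^ L \<and>
    Qp_dist p (Qp_eval p f a) (Qp_of_rat p (poly f (of_int m))) \<le> 1 / real p ^ K"
proof -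
  obtain C where C: "C > 0" "\<And>i. padic_abs p (coeff f i) \<le> C" using poly_coeff_bound by blast
  \<comment> \<open>\<open>C\<close> is a Lipschitz constant of \<open>f\<close>; the level
    \<open>J\<close> compensates for it.\<close>
  obtain J where J: "1 / real p ^ J < 1 / real p ^ K / C"
    using obtain_p_power_less[of "1 / real p ^ K / C"] C p_pos by auto
  obtain m where m: "Qp_dist p a (Qp_of_rat p (of_int m)) \<le> 1 / real p ^ max J L"
    using Zp_approx_by_int[OF assms] by blast
  have "1 / real p ^ max J L \<le> 1 / real p ^ L" "1 / real p ^ max J L \<le> 1 / real p ^ J"
    using p_gt_1 by (auto intro!: divide_left_mono power_increasing)
  with m have L: "Qp_dist p a (Qp_of_rat p (of_int m)) \<le> 1 / real p ^ L"
    and "Qp_dist p a (Qp_of_rat p (of_int m)) \<le> 1 / real p ^ K / C" using J by linarith+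
  then have "C * Qp_dist p a (Qp_of_rat p (of_int m)) \<le> 1 / real p ^ K"
    using C(1) p_pos by (simp add: field_simps)
  with Qp_eval_bound(2)[OF C(2) assms Zp_of_int[of m]] L show ?thesis
    by (intro exI[of _ m]) (simp add: Qp_eval_of_rat)
qed

end

section \<open>Density of polynomials\<close>

context prime_padic
begin

lemma prod_near_one:
  assumes "\<And>i. i \<in> I \<Longrightarrow> padic_abs p (g i - 1) \<le> e" "0 \<le> e" "e \<le> 1"
  shows "padic_abs p (prod g I - 1) \<le> e"
  using assms(1)
proof (induction I rule: infinite_finite_induct)
  case (insert i I)
  let ?P = "prod g I"
  have IH: "padic_abs p (?P - 1) \<le> e" using insert by blast
  then have P: "padic_abs p ?P \<le> 1"
    using padic_abs_add_le[of "?P - 1" 1 1] assms(3) by simp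
  have "padic_abs p ((g i - 1) * ?P) \<le> e * 1"
    unfolding padic_abs_mult using insert.prems P assms(2) by (intro mult_mono) auto
  then have "padic_abs p ((g i - 1) * ?P + (?P - 1)) \<le> e"
    using IH by (intro padic_abs_add_le) auto
  then show ?case using insert.hyps by (simp add: algebra_simps)
qed (use assms(2) in auto)

lemma inverse_p_power_le: "j \<le> k \<Longrightarrow> 1 / real p ^ k \<le> 1 / real p ^ j"
  using p_gt_1 by (auto intro!: divide_left_mono power_increasing)

lemma inverse_p_power_le_1: "1 / real p ^ k \<le> 1"
  using inverse_p_power_le[of 0 k] by simp

text \<open>In \<open>y ^ p - 1 = (y - 1) * (\<Sum>i<p. y ^ i)\<close> the \<open>p\<close> summands
  are each congruent to 1 modulo \<open>p\<close>, so their sum is divisible by \<open>p\<close> and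
  one level of precision is gained.\<close>

lemma power_p_near_one:
  assumes "padic_abs p (y - 1) \<le> 1 / real p ^ Suc j"
  shows "padic_abs p (y ^ p - 1) \<le> 1 / real p ^ Suc (Suc j)"
proof -
  have y: "padic_abs p (y - 1) \<le> 1 / real p"
    using assms inverse_p_power_le[of 1 "Suc j"] by simp
  have "padic_abs p (y ^ i - 1) \<le> 1 / real p" for i
    using prod_near_one[of "{..<i}" "\<lambda>_. y"] y inverse_p_power_le_1[of 1] by simp
  then have "padic_abs p (\<Sum>i<p. y ^ i - 1) \<le> 1 / real p"
    by (intro padic_abs_sum_le) auto
  then have "padic_abs p ((\<Sum>i<p. y ^ i - 1) + of_nat p) \<le> 1 / real p"
    using padic_abs_p_power[of 1] by (intro padic_abs_add_le) auto
  then have "padic_abs p (\<Sum>i<p. y ^ i) \<le> 1 / real p"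
    by (simp add: sum_subtractf)
  then have "padic_abs p (y - 1) * padic_abs p (\<Sum>i<p. y ^ i) \<le> 1 / real p ^ Suc j * (1 / real p)"
    using assms by (intro mult_mono) auto
  then show ?thesis by (simp add: power_diff_1_eq padic_abs_mult mult.commute)
qed

lemma power_p_power_near_one:
  assumes "padic_abs p (y - 1) \<le> 1 / real p"
  shows "padic_abs p (y ^ p ^ k - 1) \<le> 1 / real p ^ Suc k"
proof (induction k)
  case (Suc k)
  from power_p_near_one[OF this] show ?case by (simp add: power_mult[symmetric] mult.commute)
qed (use assms in simp)

text \<open>Modulo \<open>p\<close>, the square of \<open>\<Prod>i = 1..q - 1. (x - i) / i\<close> with \<open>q = p ^ L\<close> is the indicator
  function of \<open>q\<int>\<close>; raising it to the power \<open>p ^ K\<close> makes this an approximation modulo \<open>p ^ K\<close>.\<close>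

lemma indicator_poly:
  "\<exists>w :: rat poly. \<forall>m :: int.
    (int p ^ L dvd m \<longrightarrow> padic_abs p (poly w (of_int m) - 1) \<le> 1 / real p ^ K) \<and>
    (\<not> int p ^ L dvd m \<longrightarrow> padic_abs p (poly w (of_int m)) \<le> 1 / real p ^ K)"
proof (intro exI allI conjI impI)
  define q where "q = p ^ L"
  have q: "q > 0" using p_pos by (simp add: q_def)
  define u :: "rat poly" where "u = (\<Prod>i\<in>{1..<q}. smult (1 / of_nat i) [:- of_nat i, 1:])"
  let ?w = "(u ^ 2) ^ p ^ K"
  fix m :: int
  have u: "poly u (of_int m) = (\<Prod>i\<in>{1..<q}. (of_int m - of_nat i) / of_nat i)"
    unfolding u_def poly_prod by (intro prod.cong refl) (simp add: field_simps)
  have not_dvd: "padic_abs p (of_int n) > 1 / real p ^ L" if "\<not> int p ^ L dvd n" for n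
    using that padic_abs_of_int_le_iff[of n L] by simp
  {
    assume m: "int p ^ L dvd m"
    have sq: "padic_abs p (((of_int m - of_nat i) / of_nat i)\<^sup>2 - 1) \<le> 1 / real p" if i: "i \<in> {1..<q}" for i
    proof -
      \<comment> \<open>For \<open>0 < i < q\<close> the multiplicity of \<open>p\<close> in
        \<open>i\<close> is below \<open>L\<close>, so \<open>m / i\<close> is divisible by
        \<open>p\<close> and the factor \<open>m / i - 1\<close> is close to \<open>-1\<close>;
        squaring removes the sign.\<close>
      have "\<not> int p ^ L dvd int i"
      proof
        assume "int p ^ L dvd int i"
        then have "q dvd i" unfolding q_def by (simp flip: of_nat_power)
        with i show False using dvd_imp_le[of q i] by auto
      qed
      then have "padic_abs p (of_nat i) > 1 / real p ^ L" using not_dvd[of "int i"] by simp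
      moreover have "padic_abs p (of_int m) \<le> 1 / real p ^ L" using m padic_abs_of_int_le_iff by blast
      ultimately have "padic_abs p (of_int m) < padic_abs p (of_nat i)" by linarith
      then have "padic_abs p (of_int m / of_nat i) < 1"
        using i by (simp add: padic_abs_divide divide_less_eq order_less_le)
      then have z: "padic_abs p (of_int m / of_nat i) \<le> 1 / real p" by (rule padic_abs_lt_1_imp_le)
      let ?z = "of_int m / of_nat i :: rat"
      have "padic_abs p (of_int 2) \<le> 1" by (rule padic_abs_of_int_le_1)
      then have "padic_abs p (?z - 2) \<le> 1"
        using z inverse_p_power_le_1[of 1] by (intro padic_abs_diff_le) auto
      then have "padic_abs p ?z * padic_abs p (?z - 2) \<le> 1 / real p * 1"
        using z by (intro mult_mono) auto
      moreover have "((of_int m - of_nat i) / of_nat i)\<^sup>2 - 1 = ?z * (?z - 2)"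
        using i by (simp add: field_simps power2_eq_square)
      ultimately show ?thesis by (simp only: padic_abs_mult)
    qed
    have "padic_abs p (poly (u\<^sup>2) (of_int m) - 1) \<le> 1 / real p"
      unfolding poly_power u prod_power_distrib
      using sq inverse_p_power_le_1[of 1] by (intro prod_near_one) auto
    then have "padic_abs p (poly (u\<^sup>2) (of_int m) ^ p ^ K - 1) \<le> 1 / real p ^ Suc K"
      by (rule power_p_power_near_one)
    then show "padic_abs p (poly ?w (of_int m) - 1) \<le> 1 / real p ^ K"
      using inverse_p_power_le[of K "Suc K"] by (simp add: poly_power)
  next
    assume m: "\<not> int p ^ L dvd m"
    \<comment> \<open>\<open>m\<close> times the value of \<open>u\<close> at \<open>m\<close> is
      \<open>q\<close> times a binomial coefficient, which is the integer \<open>b\<close>. Since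
      \<open>m\<close> has larger absolute value than \<open>q\<close>, this forces the value of
      \<open>u\<close> strictly below 1.\<close>
    have "fact q dvd (\<Prod>i=0..<q. m - int i)"
      by (rule dvdI[OF gbinomial_int_mult_fact[symmetric]])
    then obtain b where b: "(\<Prod>i=0..<q. m - int i) = fact q * b" ..
    have "of_int m * poly u (of_int m) = of_nat q * of_int b"
    proof -
      have "of_int m * (\<Prod>i\<in>{1..<q}. of_int m - of_nat i) = (\<Prod>i=0..<q. of_int m - of_nat i :: rat)"
        using q prod.atLeast_Suc_lessThan[of 0 q "\<lambda>i. of_int m - of_nat i :: rat"] by simp
      also have "\<dots> = of_int (\<Prod>i=0..<q. m - int i)" by simp
      also have "\<dots> = fact q * of_int b" by (simp only: b of_int_mult of_int_fact)
      also have "\<dots> = fact (q - 1) * (of_nat q * of_int b)"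
        using q by (simp add: fact_reduce[of q])
      finally have "of_int m * ((\<Prod>i\<in>{1..<q}. of_int m - of_nat i) / fact (q - 1))
          = of_nat q * (of_int b :: rat)" by (simp add: field_simps)
      moreover have "poly u (of_int m) = (\<Prod>i\<in>{1..<q}. of_int m - of_nat i) / fact (q - 1)"
        using q by (simp add: u prod_dividef fact_prod flip: atLeastLessThanSuc_atLeastAtMost)
      ultimately show ?thesis by simp
    qed
    then have "padic_abs p (of_int m) * padic_abs p (poly u (of_int m))
        = padic_abs p (of_nat q) * padic_abs p (of_int b)"
      by (metis padic_abs_mult)
    also have "\<dots> \<le> 1 / real p ^ L * 1"
      using padic_abs_of_int_le_1 by (intro mult_mono) (auto simp: q_def)
    also have "\<dots> < padic_abs p (of_int m)" using not_dvd[OF m] by simp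
    finally have "padic_abs p (poly u (of_int m)) < 1"
      using mult_left_mono[of 1 "padic_abs p (poly u (of_int m))" "padic_abs p (of_int m)"] by force
    then have "padic_abs p (poly u (of_int m)) \<le> 1 / real p" by (rule padic_abs_lt_1_imp_le)
    then have "padic_abs p (poly u (of_int m)) ^ (2 * p ^ K) \<le> (1 / real p) ^ (2 * p ^ K)"
      by (intro power_mono) auto
    also have "\<dots> = 1 / real p ^ (2 * p ^ K)" by (simp add: power_one_over)
    also have "\<dots> \<le> 1 / real p ^ K"
    proof (rule inverse_p_power_le)
      have "K < p ^ K" using prime_ge_2_nat[OF prime_p] by (intro power_gt_expt) auto
      then show "K \<le> 2 * p ^ K" by linarith
    qed
    finally show "padic_abs p (poly ?w (of_int m)) \<le> 1 / real p ^ K"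
      by (simp add: poly_power padic_abs_power flip: power_mult)
  }
qed

text \<open>A weighted sum of translates of the indicator polynomial, one for each residue modulo
  \<open>p ^ L\<close>; integer weights and the ultrametric inequality keep the error at that of a
  single translate.\<close>

lemma periodic_poly_approx:
  fixes F :: "int \<Rightarrow> int"
  shows "\<exists>g :: rat poly. \<forall>m :: int.
    padic_abs p (poly g (of_int m) - of_int (F (m mod int p ^ L))) \<le> 1 / real p ^ K"
proof -
  obtain w where w: "\<And>m :: int. int p ^ L dvd m \<Longrightarrow> padic_abs p (poly w (of_int m) - 1) \<le> 1 / real p ^ K"
    "\<And>m :: int. \<not> int p ^ L dvd m \<Longrightarrow> padic_abs p (poly w (of_int m)) \<le> 1 / real p ^ K"
    using indicator_poly[of L K] by blast
  let ?q = "int p ^ L"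
  have q: "?q > 0" using prime_gt_0_nat[OF prime_p] by simp
  define g where "g = (\<Sum>r\<in>{0..<?q}. smult (of_int (F r)) (w \<circ>\<^sub>p [:- of_int r, 1:]))"
  have "padic_abs p (poly g (of_int m) - of_int (F (m mod ?q))) \<le> 1 / real p ^ K" for m
  proof -
    have F: "of_int (F (m mod ?q)) = (\<Sum>r\<in>{0..<?q}. of_int (F r) * (if r = m mod ?q then 1 else 0) :: rat)"
      using q by (simp add: if_distrib cong: if_cong)
    have "poly g (of_int m) - of_int (F (m mod ?q))
        = (\<Sum>r\<in>{0..<?q}. of_int (F r) * (poly w (of_int (m - r)) - (if r = m mod ?q then 1 else 0)))"
      unfolding F by (simp add: g_def poly_sum poly_pcompose algebra_simps sum_subtractf)
    also have "padic_abs p \<dots> \<le> 1 / real p ^ K"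
    proof (rule padic_abs_sum_le)
      fix r assume r: "r \<in> {0..<?q}"
      have "r = m mod ?q \<longleftrightarrow> ?q dvd m - r"
        using r by (metis atLeastLessThan_iff mod_eq_dvd_iff mod_pos_pos_trivial)
      then have "padic_abs p (poly w (of_int (m - r)) - (if r = m mod ?q then 1 else 0)) \<le> 1 / real p ^ K"
        using w[of "m - r"] by auto
      then have "padic_abs p (of_int (F r)) * padic_abs p (poly w (of_int (m - r)) - (if r = m mod ?q then 1 else 0))
          \<le> 1 * (1 / real p ^ K)"
        using padic_abs_of_int_le_1 by (intro mult_mono) auto
      then show "padic_abs p (of_int (F r) * (poly w (of_int (m - r)) - (if r = m mod ?q then 1 else 0)))
          \<le> 1 / real p ^ K"
        by (simp add: padic_abs_mult)
    qed simp
    finally show ?thesis .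
  qed
  then show ?thesis by blast
qed

text \<open>Heine-Cantor in the language of congruences: to precision \<open>K\<close>, the function
  depends only on the point modulo \<open>p ^ L\<close>.\<close>

lemma compact_uniformly_continuous:
  assumes S: "S \<subseteq> carrier (Zp p)" "compactin (Zp_topology p) S"
    and \<phi>: "continuous_map (subtopology (Zp_topology p) S) (Zp_topology p) \<phi>"
  shows "\<exists>L. \<forall>x\<in>S. \<forall>y\<in>S. Qp_dist p x y \<le> 1 / real p ^ L \<longrightarrow> Qp_dist p (\<phi> x) (\<phi> y) \<le> 1 / real p ^ K"
proof -
  interpret Metric_space "carrier (Qp p)" "Qp_dist p" by (rule Metric_space_Qp)
  let ?m = "metric (carrier (Qp p), Qp_dist p)"
  have "S \<subseteq> carrier (Qp p)" using S(1) Zp_closed_Qp by blast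
  then have m1: "mtopology_of (submetric ?m S) = subtopology (Zp_topology p) S"
    and ms: "S \<inter> carrier (Qp p) = S"
    using S(1) by (auto simp: mtopology_of_submetric Zp_topology_def Qp_topology_def
        subtopology_subtopology Int_absorb1 Int_absorb2)
  have "compact_space (subtopology (Zp_topology p) S)"
    using S(2) by (simp add: compact_space_subtopology)
  moreover have "continuous_map (subtopology (Zp_topology p) S) mtopology \<phi>"
    using \<phi> by (simp add: Zp_topology_def Qp_topology_def continuous_map_in_subtopology)
  ultimately have "uniformly_continuous_map (submetric ?m S) ?m \<phi>"
    using m1 by (intro continuous_imp_uniformly_continuous_map) simp
  then have "\<forall>e>0. \<exists>d>0. \<forall>x\<in>S. \<forall>y\<in>S. Qp_dist p y x < d \<longrightarrow> Qp_dist p (\<phi> y) (\<phi> x) < e"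
    by (simp add: uniformly_continuous_map_def ms)
  moreover have "1 / real p ^ K > 0" using p_pos by simp
  ultimately obtain d where d: "d > 0"
    "\<forall>x\<in>S. \<forall>y\<in>S. Qp_dist p y x < d \<longrightarrow> Qp_dist p (\<phi> y) (\<phi> x) < 1 / real p ^ K"
    by blast
  obtain L where L: "1 / real p ^ L < d" using obtain_p_power_less[OF d(1)] by blast
  have "Qp_dist p (\<phi> x) (\<phi> y) \<le> 1 / real p ^ K" if "x \<in> S" "y \<in> S" "Qp_dist p x y \<le> 1 / real p ^ L" for x y
    using d(2) that L by (metis less_imp_le order_le_less_trans)
  then show ?thesis by blast
qed

text \<open>A p-adic Weierstrass theorem: to the wanted precision \<open>\<phi>\<close> is an
  integer-valued function of the residue modulo \<open>p ^ L\<close>, and such periodic functions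
  are approximated by polynomials.\<close>

lemma poly_dense:
  assumes S: "S \<subseteq> carrier (Zp p)" "compactin (Zp_topology p) S"
    and \<phi>: "continuous_map (subtopology (Zp_topology p) S) (Zp_topology p) \<phi>"
  shows "\<exists>g. \<forall>x\<in>S. Qp_dist p (Qp_eval p g x) (\<phi> x) \<le> 1 / real p ^ K"
proof -
  have \<phi>_closed: "\<phi> x \<in> carrier (Zp p)" if "x \<in> S" for x
    using \<phi> that S(1) Zp_closed_Qp Metric_space.topspace_mtopology[OF Metric_space_Qp]
    by (auto simp: continuous_map_def Zp_topology_def Qp_topology_def topspace_subtopology Pi_iff)
  obtain L where L: "\<And>x y. x \<in> S \<Longrightarrow> y \<in> S \<Longrightarrow> Qp_dist p x y \<le> 1 / real p ^ L
      \<Longrightarrow> Qp_dist p (\<phi> x) (\<phi> y) \<le> 1 / real p ^ K"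
    using compact_uniformly_continuous[OF assms] by blast
  let ?q = "int p ^ L" and ?i = "\<lambda>m. Qp_of_rat p (of_int m)"
  \<comment> \<open>Any point of \<open>S\<close> close to \<open>r\<close> determines the value up
    to precision \<open>K\<close>; if there is none, every integer \<open>k\<close> will do.\<close>
  have "\<exists>k. \<forall>x\<in>S. Qp_dist p x (?i r) \<le> 1 / real p ^ L \<longrightarrow> Qp_dist p (\<phi> x) (?i k) \<le> 1 / real p ^ K" for r
  proof (cases "\<exists>x\<in>S. Qp_dist p x (?i r) \<le> 1 / real p ^ L")
    case True
    then obtain x where x: "x \<in> S" "Qp_dist p x (?i r) \<le> 1 / real p ^ L" by blast
    obtain k where k: "Qp_dist p (\<phi> x) (?i k) \<le> 1 / real p ^ K"
      using Zp_approx_by_int[OF \<phi>_closed[OF x(1)]] by blast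
    have "Qp_dist p (\<phi> y) (?i k) \<le> 1 / real p ^ K" if y: "y \<in> S" "Qp_dist p y (?i r) \<le> 1 / real p ^ L" for y
    proof -
      have "x \<in> carrier (Qp p)" "y \<in> carrier (Qp p)" using x y S(1) Zp_closed_Qp by auto
      then have "Qp_dist p y x \<le> 1 / real p ^ L"
        using x y Qp_dist_trans_le[of y "?i r" "1 / real p ^ L" x] by (simp add: Qp_dist_commute)
      from Qp_dist_trans_le[OF L[OF y(1) x(1) this] k] show ?thesis
        using \<phi>_closed x(1) y(1) Zp_closed_Qp by simp
    qed
    then show ?thesis by blast
  qed blast
  then obtain F where F: "\<And>r x. x \<in> S \<Longrightarrow> Qp_dist p x (?i r) \<le> 1 / real p ^ L
      \<Longrightarrow> Qp_dist p (\<phi> x) (?i (F r)) \<le> 1 / real p ^ K" by metis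
  obtain g :: "rat poly" where g: "\<And>m. padic_abs p (poly g (of_int m) - of_int (F (m mod ?q))) \<le> 1 / real p ^ K"
    using periodic_poly_approx[of F L K] by blast
  have "Qp_dist p (Qp_eval p g x) (\<phi> x) \<le> 1 / real p ^ K" if x: "x \<in> S" for x
  proof -
    have xZ: "x \<in> carrier (Zp p)" using x S(1) by blast
    obtain m where m: "Qp_dist p x (?i m) \<le> 1 / real p ^ L"
      "Qp_dist p (Qp_eval p g x) (Qp_of_rat p (poly g (of_int m))) \<le> 1 / real p ^ K"
      using Qp_eval_approx[OF xZ] by blast
    \<comment> \<open>\<open>F\<close> is read at the representative \<open>m mod ?q\<close>, which
      is also within \<open>1 / real p ^ L\<close> of \<open>x\<close>.\<close>
    have "?q dvd m - m mod ?q" by (rule dvd_minus_mod)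
    then have "Qp_dist p (?i m) (?i (m mod ?q)) \<le> 1 / real p ^ L"
      using padic_abs_of_int_le_iff[of "m - m mod ?q" L] by (simp only: Qp_dist_of_rat of_int_diff)
    then have "Qp_dist p x (?i (m mod ?q)) \<le> 1 / real p ^ L"
      using m(1) xZ Zp_closed_Qp Qp_dist_trans_le by simp
    then have "Qp_dist p (?i (F (m mod ?q))) (\<phi> x) \<le> 1 / real p ^ K"
      using F[OF x] by (simp add: Qp_dist_commute)
    moreover have "Qp_dist p (Qp_of_rat p (poly g (of_int m))) (?i (F (m mod ?q))) \<le> 1 / real p ^ K"
      using g by simp
    ultimately have "Qp_dist p (Qp_of_rat p (poly g (of_int m))) (\<phi> x) \<le> 1 / real p ^ K"
      using Qp_dist_trans_le \<phi>_closed[OF x] Zp_closed_Qp by (metis Qp_of_rat_closed)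
    with m(2) show ?thesis
      using Qp_dist_trans_le \<phi>_closed[OF x] Zp_closed_Qp xZ by (metis Qp_of_rat_closed Qp_eval_closed)
  qed
  then show ?thesis by blast
qed

end

section \<open>Removing denominators away from one prime\<close>

lemma clear_denominators: "\<exists>m>0. \<forall>i. of_int m * coeff (g :: rat poly) i \<in> \<int>"
proof (induction g)
  case (pCons c g)
  then obtain m where m: "m > 0" "\<And>i. of_int m * coeff g i \<in> \<int>" by blast
  obtain a b where c: "c = Fract a b" "b > 0" by (cases c) auto
  have "of_int (b * m) * coeff (pCons c g) i \<in> \<int>" for i
  proof (cases i)
    case 0
    then show ?thesis using c by (simp add: Fract_of_int_quotient)
  next
    case (Suc j)
    then have "of_int (b * m) * coeff (pCons c g) i = of_int b * (of_int m * coeff g j)" by simp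
    then show ?thesis using m(2) by (metis Ints_mult Ints_of_int)
  qed
  then show ?case using c(2) m(1) by (intro exI[of _ "b * m"]) auto
qed (auto intro: exI[of _ 1])

context prime_padic
begin

lemma padic_abs_other_prime_power:
  assumes "prime q" "q \<noteq> p"
  shows "padic_abs p (of_nat q ^ s) = 1"
proof -
  have "\<not> int p dvd int q"
    using assms prime_p by (auto dest: primes_dvd_imp_eq)
  from padic_abs_of_int_eq_1[OF this] show ?thesis by (simp add: padic_abs_power)
qed

text \<open>A common denominator \<open>m\<close> splits as a power of \<open>p\<close> times an
  \<open>m'\<close> prime to \<open>p\<close>. With \<open>u\<close> inverse to \<open>m'\<close>
  modulo \<open>p ^ K\<close>, the integer \<open>u * m'\<close> serves all other primes at
  once.\<close>

lemma clear_other_denominators: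
  "\<exists>N :: int. int p ^ K dvd N - 1 \<and>
    (\<forall>q i. prime q \<longrightarrow> q \<noteq> p \<longrightarrow> padic_abs q (of_int N * coeff g i) \<le> 1)"
proof -
  obtain m where m: "m > 0" "\<And>i. of_int m * coeff g i \<in> \<int>" using clear_denominators by blast
  have "prime (int p)" using prime_p by simp
  then have "m \<noteq> 0" "\<not> is_unit (int p)" using m(1) by auto
  then obtain m' where m': "m = int p ^ multiplicity (int p) m * m'" "\<not> int p dvd m'"
    using multiplicity_decompose' by metis
  define s where "s = multiplicity (int p) m"
  have "coprime m' (int p ^ K)"
    using \<open>prime (int p)\<close> m'(2) by (metis coprime_commute coprime_power_right_iff prime_imp_coprime)
  then obtain u v where uv: "u * m' + v * int p ^ K = 1"
    using bezout_int[of m' "int p ^ K"] by (auto simp: coprime_iff_gcd_eq_1)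
  then have "u * m' - 1 = int p ^ K * - v" by (simp add: algebra_simps)
  then have "int p ^ K dvd u * m' - 1" by (metis dvd_triv_left)
  moreover have "padic_abs q (of_int (u * m') * coeff g i) \<le> 1" if q: "prime q" "q \<noteq> p" for q i
  proof -
    interpret Q: prime_padic q by unfold_locales fact
    obtain k where k: "of_int m * coeff g i = of_int k" using m(2)[of i] by (auto elim: Ints_cases)
    have "of_int m = (of_nat p ^ s * of_int m' :: rat)"
      using m'(1) unfolding s_def by (metis of_int_mult of_int_power of_int_of_nat_eq)
    then have "of_nat p ^ s * (of_int (u * m') * coeff g i) = of_int u * (of_int m * coeff g i)"
      by simp
    also have "\<dots> = of_int (u * k)" by (simp add: k)
    finally have "padic_abs q (of_nat p ^ s) * padic_abs q (of_int (u * m') * coeff g i) \<le> 1"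
      using Q.padic_abs_of_int_le_1[of "u * k"] by (simp only: flip: Q.padic_abs_mult)
    then show ?thesis using Q.padic_abs_other_prime_power[OF prime_p] q(2) by simp
  qed
  ultimately show ?thesis by blast
qed

end

section \<open>The topological group of profinite integers\<close>

lemma Zhat_simps:
  "carrier Zhat = (\<Pi>\<^sub>E p\<in>primes. carrier (Zp p))"
  "x \<otimes>\<^bsub>Zhat\<^esub> y = (\<lambda>p\<in>primes. x p \<otimes>\<^bsub>Qp p\<^esub> y p)"
  "x \<oplus>\<^bsub>Zhat\<^esub> y = (\<lambda>p\<in>primes. x p \<oplus>\<^bsub>Qp p\<^esub> y p)"
  "\<zero>\<^bsub>Zhat\<^esub> = (\<lambda>p\<in>primes. \<zero>\<^bsub>Qp p\<^esub>)"
  by (simp_all add: Zhat_def)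

lemma Zhat_component: "x \<in> carrier Zhat \<Longrightarrow> prime p \<Longrightarrow> x p \<in> carrier (Zp p)"
  by (auto simp: Zhat_simps)

lemma Zhat_restrictI:
  "(\<And>p. prime p \<Longrightarrow> x p \<in> carrier (Zp p)) \<Longrightarrow> (\<lambda>p\<in>primes. x p) \<in> carrier Zhat"
  by (auto simp: Zhat_simps)

lemma Zhat_eqI:
  "x \<in> carrier Zhat \<Longrightarrow> y \<in> carrier Zhat \<Longrightarrow> (\<And>p. prime p \<Longrightarrow> x p = y p) \<Longrightarrow> x = y"
  unfolding Zhat_simps by (rule PiE_ext) auto

lemma Zhat_zero_closed: "\<zero>\<^bsub>Zhat\<^esub> \<in> carrier Zhat"
  unfolding Zhat_simps(4) using prime_padic.Zp_zero_one_closed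
  by (auto intro!: Zhat_restrictI simp: prime_padic_def)

lemma Zhat_closed:
  assumes "x \<in> carrier Zhat" "y \<in> carrier Zhat"
  shows "x \<oplus>\<^bsub>Zhat\<^esub> y \<in> carrier Zhat" "x \<otimes>\<^bsub>Zhat\<^esub> y \<in> carrier Zhat"
    "(\<lambda>p\<in>primes. \<ominus>\<^bsub>Qp p\<^esub> x p) \<in> carrier Zhat"
  unfolding Zhat_simps(2,3)
  using assms prime_padic.Zp_add_closed prime_padic.Zp_mult_closed
    prime_padic.Zp_uminus_closed
  by (auto intro!: Zhat_restrictI simp: prime_padic_def Zhat_component)

lemma abelian_group_Zhat: "abelian_group Zhat"
proof (rule abelian_groupI)
  show zero: "\<zero>\<^bsub>Zhat\<^esub> \<in> carrier Zhat" by (rule Zhat_zero_closed)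
  fix x y z assume x: "x \<in> carrier Zhat"
  have xp: "x p \<in> carrier (Qp p)" if "prime p" for p
    using Zhat_component[OF x that] by (simp add: Zp_carrier)
  show "\<zero>\<^bsub>Zhat\<^esub> \<oplus>\<^bsub>Zhat\<^esub> x = x"
  proof (rule Zhat_eqI)
    fix p :: nat assume p: "prime p"
    interpret prime_padic p by unfold_locales fact
    show "(\<zero>\<^bsub>Zhat\<^esub> \<oplus>\<^bsub>Zhat\<^esub> x) p = x p" using p xp by (simp add: Zhat_simps)
  qed (use Zhat_closed x zero in auto)
  show "\<exists>y\<in>carrier Zhat. y \<oplus>\<^bsub>Zhat\<^esub> x = \<zero>\<^bsub>Zhat\<^esub>"
  proof (rule bexI, rule Zhat_eqI)
    show neg: "(\<lambda>p\<in>primes. \<ominus>\<^bsub>Qp p\<^esub> x p) \<in> carrier Zhat" using Zhat_closed x by blast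
    show "(\<lambda>p\<in>primes. \<ominus>\<^bsub>Qp p\<^esub> x p) \<oplus>\<^bsub>Zhat\<^esub> x \<in> carrier Zhat" using Zhat_closed neg x by blast
    fix p :: nat assume p: "prime p"
    interpret prime_padic p by unfold_locales fact
    show "((\<lambda>p\<in>primes. \<ominus>\<^bsub>Qp p\<^esub> x p) \<oplus>\<^bsub>Zhat\<^esub> x) p = \<zero>\<^bsub>Zhat\<^esub> p"
      using p xp by (simp add: Zhat_simps cls.S.l_neg)
  qed (fact zero)
  assume y: "y \<in> carrier Zhat"
  have yp: "y p \<in> carrier (Qp p)" if "prime p" for p
    using Zhat_component[OF y that] by (simp add: Zp_carrier)
  show "x \<oplus>\<^bsub>Zhat\<^esub> y \<in> carrier Zhat" using Zhat_closed x y by blast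
  show "x \<oplus>\<^bsub>Zhat\<^esub> y = y \<oplus>\<^bsub>Zhat\<^esub> x"
  proof (rule Zhat_eqI)
    fix p :: nat assume p: "prime p"
    interpret prime_padic p by unfold_locales fact
    show "(x \<oplus>\<^bsub>Zhat\<^esub> y) p = (y \<oplus>\<^bsub>Zhat\<^esub> x) p" using p xp yp by (simp add: Zhat_simps cls.S.a_comm)
  qed (use Zhat_closed x y in auto)
  assume z: "z \<in> carrier Zhat"
  have zp: "z p \<in> carrier (Qp p)" if "prime p" for p
    using Zhat_component[OF z that] by (simp add: Zp_carrier)
  show "(x \<oplus>\<^bsub>Zhat\<^esub> y) \<oplus>\<^bsub>Zhat\<^esub> z = x \<oplus>\<^bsub>Zhat\<^esub> (y \<oplus>\<^bsub>Zhat\<^esub> z)"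
  proof (rule Zhat_eqI)
    fix p :: nat assume p: "prime p"
    interpret prime_padic p by unfold_locales fact
    show "((x \<oplus>\<^bsub>Zhat\<^esub> y) \<oplus>\<^bsub>Zhat\<^esub> z) p = (x \<oplus>\<^bsub>Zhat\<^esub> (y \<oplus>\<^bsub>Zhat\<^esub> z)) p"
      using p xp yp zp by (simp add: Zhat_simps cls.S.a_assoc)
  qed (use Zhat_closed x y z in auto)
qed

interpretation Zhat: abelian_group Zhat by (rule abelian_group_Zhat)

lemma Zhat_mult_apply: "prime p \<Longrightarrow> (x \<otimes>\<^bsub>Zhat\<^esub> y) p = x p \<otimes>\<^bsub>Qp p\<^esub> y p"
  by (simp add: Zhat_simps)

lemma Zhat_minus_apply:
  assumes x: "x \<in> carrier Zhat" and y: "y \<in> carrier Zhat" and p: "prime p"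
  shows "(x \<ominus>\<^bsub>Zhat\<^esub> y) p = x p \<ominus>\<^bsub>Qp p\<^esub> y p"
proof -
  have neg: "(\<lambda>p\<in>primes. \<ominus>\<^bsub>Qp p\<^esub> y p) \<in> carrier Zhat" using Zhat_closed y by blast
  have "(\<lambda>p\<in>primes. \<ominus>\<^bsub>Qp p\<^esub> y p) \<oplus>\<^bsub>Zhat\<^esub> y = \<zero>\<^bsub>Zhat\<^esub>"
  proof (rule Zhat_eqI)
    fix q :: nat assume q: "prime q"
    interpret prime_padic q by unfold_locales fact
    show "((\<lambda>p\<in>primes. \<ominus>\<^bsub>Qp p\<^esub> y p) \<oplus>\<^bsub>Zhat\<^esub> y) q = \<zero>\<^bsub>Zhat\<^esub> q"
      using q Zhat_component[OF y q] Zp_closed_Qp by (simp add: Zhat_simps cls.S.l_neg)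
  qed (use Zhat_closed neg y in auto)
  then have "\<ominus>\<^bsub>Zhat\<^esub> y = (\<lambda>p\<in>primes. \<ominus>\<^bsub>Qp p\<^esub> y p)"
    using neg y by (intro Zhat.minus_equality)
  then show ?thesis using p by (simp add: a_minus_def Zhat_simps)
qed

lemma Zhat_finsum_apply:
  fixes g :: "nat \<Rightarrow> nat \<Rightarrow> padic"
  assumes g: "\<And>n. g n \<in> carrier Zhat" and p: "prime p"
  shows "(\<Oplus>\<^bsub>Zhat\<^esub>n\<in>{..<m}. g n) p = (\<Oplus>\<^bsub>Qp p\<^esub>n\<in>{..<m}. g n p)"
proof -
  interpret prime_padic p by unfold_locales fact
  have "g n p \<in> carrier (Qp p)" for n using Zhat_component[OF g p] Zp_closed_Qp by blast
  then show ?thesis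
  proof (induction m)
    case (Suc m)
    have "(\<Oplus>\<^bsub>Zhat\<^esub>n\<in>{..<Suc m}. g n) = g m \<oplus>\<^bsub>Zhat\<^esub> (\<Oplus>\<^bsub>Zhat\<^esub>n\<in>{..<m}. g n)"
      unfolding lessThan_Suc using g by (intro Zhat.finsum_insert) auto
    then show ?case
      using p Suc by (subst finsum_lessThan_Suc) (auto simp: Zhat_simps)
  qed (use p in \<open>simp add: Zhat_simps\<close>)
qed

section \<open>Neighbourhoods of zero and convergence, prime by prime\<close>

context prime_padic
begin

lemma Qp_dist_zero: "z \<in> carrier (Qp p) \<Longrightarrow> Qp_dist p z \<zero>\<^bsub>Qp p\<^esub> = Qp_abs p z"
  by (simp add: Qp_dist_eq a_minus_def)

lemma topspace_Zp: "topspace (Zp_topology p) = carrier (Zp p)"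
  using Zp_closed_Qp
  by (auto simp: Zp_topology_def Qp_topology_def Metric_space.topspace_mtopology[OF Metric_space_Qp])

lemma Zp_nhds_zero:
  assumes "openin (Zp_topology p) V" "\<zero>\<^bsub>Qp p\<^esub> \<in> V"
  shows "\<exists>K. \<forall>z\<in>carrier (Zp p). Qp_abs p z \<le> 1 / real p ^ K \<longrightarrow> z \<in> V"
proof -
  interpret Metric_space "carrier (Qp p)" "Qp_dist p" by (rule Metric_space_Qp)
  obtain T where T: "openin mtopology T" "V = T \<inter> carrier (Zp p)"
    using assms(1) by (auto simp: Zp_topology_def Qp_topology_def openin_subtopology)
  obtain r where r: "r > 0" "mball \<zero>\<^bsub>Qp p\<^esub> r \<subseteq> T"
    using T assms(2) by (auto simp: openin_mtopology)
  obtain K where K: "1 / real p ^ K < r" using obtain_p_power_less[OF r(1)] by blast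
  have "z \<in> V" if "z \<in> carrier (Zp p)" "Qp_abs p z \<le> 1 / real p ^ K" for z
  proof -
    have "z \<in> mball \<zero>\<^bsub>Qp p\<^esub> r"
      using that K Zp_closed_Qp[OF that(1)] Qp_dist_zero[of z] by (simp add: commute)
    then show ?thesis using T(2) r(2) that(1) by blast
  qed
  then show ?thesis by blast
qed

lemma openin_Zp_ball:
  assumes "e > 0"
  shows "openin (Zp_topology p) {z \<in> carrier (Zp p). Qp_abs p z < e}"
proof -
  interpret Metric_space "carrier (Qp p)" "Qp_dist p" by (rule Metric_space_Qp)
  have "{z \<in> carrier (Zp p). Qp_abs p z < e} = mball \<zero>\<^bsub>Qp p\<^esub> e \<inter> carrier (Zp p)"
    using Zp_closed_Qp Qp_dist_zero by (auto simp: commute)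
  then show ?thesis by (auto simp: Zp_topology_def Qp_topology_def openin_subtopology)
qed

end

lemma topspace_Zhat: "topspace Zhat_topology = carrier Zhat"
  by (auto simp: Zhat_topology_def Zhat_simps topspace_product_topology prime_padic.topspace_Zp
      prime_padic_def intro!: PiE_cong)

text \<open>A basic open set of the product topology restricts finitely many coordinates, and at
  each of these it contains a ball around zero of radius a power of
  \<open>1 / real p\<close>.\<close>

lemma Zhat_nhds_zero:
  assumes "openin Zhat_topology U" "\<zero>\<^bsub>Zhat\<^esub> \<in> U"
  shows "\<exists>F K. finite F \<and> F \<subseteq> primes \<and>
    (\<forall>z\<in>carrier Zhat. (\<forall>p\<in>F. Qp_abs p (z p) \<le> 1 / real p ^ K p) \<longrightarrow> z \<in> U)"
proof -
  obtain V where V: "finite {p \<in> primes. V p \<noteq> topspace (Zp_topology p)}"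
    "\<And>p. p \<in> primes \<Longrightarrow> openin (Zp_topology p) (V p)" "\<zero>\<^bsub>Zhat\<^esub> \<in> Pi\<^sub>E primes V" "Pi\<^sub>E primes V \<subseteq> U"
    using assms unfolding Zhat_topology_def openin_product_topology_alt by meson
  define F where "F = {p \<in> primes. V p \<noteq> topspace (Zp_topology p)}"
  have "\<exists>K. \<forall>z\<in>carrier (Zp p). Qp_abs p z \<le> 1 / real p ^ K \<longrightarrow> z \<in> V p" if p: "prime p" for p
  proof -
    interpret prime_padic p by unfold_locales fact
    have "\<zero>\<^bsub>Qp p\<^esub> \<in> V p" using V(3) p by (auto simp: Zhat_simps)
    with V(2) p show ?thesis by (intro Zp_nhds_zero) auto
  qed
  then obtain K where K: "\<And>p z. prime p \<Longrightarrow> z \<in> carrier (Zp p) \<Longrightarrow> Qp_abs p z \<le> 1 / real p ^ K p \<Longrightarrow> z \<in> V p"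
    by metis
  have "z \<in> U" if z: "z \<in> carrier Zhat" "\<And>p. p \<in> F \<Longrightarrow> Qp_abs p (z p) \<le> 1 / real p ^ K p" for z
  proof -
    have "z p \<in> V p" if p: "prime p" for p
    proof (cases "p \<in> F")
      case True
      then show ?thesis using K p z Zhat_component by blast
    next
      case False
      then have "V p = carrier (Zp p)"
        using p by (simp add: F_def prime_padic.topspace_Zp prime_padic_def)
      then show ?thesis using Zhat_component z(1) p by blast
    qed
    then have "z \<in> Pi\<^sub>E primes V" using z(1) by (auto simp: Zhat_simps PiE_iff)
    with V(4) show ?thesis by blast
  qed
  then have "\<forall>z\<in>carrier Zhat. (\<forall>p\<in>F. Qp_abs p (z p) \<le> 1 / real p ^ K p) \<longrightarrow> z \<in> U" by simp
  moreover have "finite F" "F \<subseteq> primes" using V(1) by (auto simp: F_def)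
  ultimately show ?thesis by metis
qed

lemma limitin_Zhat_zeroI:
  assumes c: "\<And>n. c n \<in> carrier Zhat"
    and lim: "\<And>p K. prime p \<Longrightarrow> \<forall>\<^sub>F n in sequentially. Qp_abs p (c n p) \<le> 1 / real p ^ K"
  shows "limitin Zhat_topology c \<zero>\<^bsub>Zhat\<^esub> sequentially"
  unfolding limitin_def
proof (intro conjI allI impI)
  show "\<zero>\<^bsub>Zhat\<^esub> \<in> topspace Zhat_topology" by (simp add: topspace_Zhat)
  fix U assume "openin Zhat_topology U \<and> \<zero>\<^bsub>Zhat\<^esub> \<in> U"
  then obtain F K where F: "finite F" "F \<subseteq> primes"
    "\<And>z. z \<in> carrier Zhat \<Longrightarrow> (\<forall>p\<in>F. Qp_abs p (z p) \<le> 1 / real p ^ K p) \<Longrightarrow> z \<in> U"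
    using Zhat_nhds_zero by metis
  have "\<forall>\<^sub>F n in sequentially. \<forall>p\<in>F. Qp_abs p (c n p) \<le> 1 / real p ^ K p"
    using F lim by (intro eventually_ball_finite) auto
  then show "\<forall>\<^sub>F n in sequentially. c n \<in> U"
    by (rule eventually_mono) (use F(3) c in blast)
qed

text \<open>Forwards, a ball at one prime is pulled back along the coordinate projection. Backwards,
  a neighbourhood involves finitely many primes, so finitely many eventual statements are
  intersected, each already uniform in \<open>a\<close>.\<close>

lemma uniformly_sums_iff:
  assumes g: "\<And>n a. a \<in> S \<Longrightarrow> g n a \<in> carrier Zhat" and h: "\<And>a. a \<in> S \<Longrightarrow> h a \<in> carrier Zhat"
  shows "uniformly_sums g h S \<longleftrightarrow> (\<forall>p\<in>primes. \<forall>K. \<forall>\<^sub>F m in sequentially. \<forall>a\<in>S.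
    Qp_dist p (\<Oplus>\<^bsub>Qp p\<^esub>n\<in>{..<m}. g n a p) (h a p) \<le> 1 / real p ^ K)" (is "_ \<longleftrightarrow> ?R")
proof -
  let ?t = "\<lambda>m a. (\<Oplus>\<^bsub>Zhat\<^esub>n\<in>{..<m}. g n a) \<ominus>\<^bsub>Zhat\<^esub> h a"
  have sum_closed: "(\<Oplus>\<^bsub>Zhat\<^esub>n\<in>{..<m}. g n a) \<in> carrier Zhat" if "a \<in> S" for m a
    using g that by (intro Zhat.finsum_closed) auto
  have t_closed: "?t m a \<in> carrier Zhat" if "a \<in> S" for m a
    using sum_closed h that by (intro Zhat.minus_closed)
  have t_apply: "Qp_abs p (?t m a p) = Qp_dist p (\<Oplus>\<^bsub>Qp p\<^esub>n\<in>{..<m}. g n a p) (h a p)"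
    if a: "a \<in> S" and p: "prime p" for m a p
  proof -
    interpret prime_padic p by unfold_locales fact
    have "?t m a p = (\<Oplus>\<^bsub>Qp p\<^esub>n\<in>{..<m}. g n a p) \<ominus>\<^bsub>Qp p\<^esub> h a p"
      using Zhat_minus_apply[OF sum_closed[OF a] h[OF a] p] Zhat_finsum_apply[OF g[OF a] p] by simp
    moreover have "(\<Oplus>\<^bsub>Qp p\<^esub>n\<in>{..<m}. g n a p) \<in> carrier (Qp p)"
      using Zhat_component[OF g[OF a] p] Zp_closed_Qp by (intro cls.S.finsum_closed) auto
    moreover have "h a p \<in> carrier (Qp p)"
      using Zhat_component[OF h[OF a] p] Zp_closed_Qp by blast
    ultimately show ?thesis by (simp add: Qp_dist_eq)
  qed
  show ?thesis
  proof
    assume L: "uniformly_sums g h S"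
    show ?R
    proof (intro ballI allI)
      fix p K assume "p \<in> primes"
      then have p: "prime p" by simp
      interpret prime_padic p by unfold_locales fact
      let ?B = "{z \<in> carrier (Zp p). Qp_abs p z < 1 / real p ^ K}"
      let ?U = "{z \<in> topspace Zhat_topology. z p \<in> ?B}"
      have "continuous_map Zhat_topology (Zp_topology p) (\<lambda>z. z p)"
        unfolding Zhat_topology_def using p by (intro continuous_map_product_projection) simp
      then have "openin Zhat_topology ?U"
        by (rule openin_continuous_map_preimage) (use p_pos in \<open>simp add: openin_Zp_ball\<close>)
      moreover have "\<zero>\<^bsub>Zhat\<^esub> \<in> ?U"
        using p p_pos Zp_zero_one_closed by (simp add: topspace_Zhat) (simp add: Zhat_simps)
      ultimately have "\<forall>\<^sub>F m in sequentially. \<forall>a\<in>S. ?t m a \<in> ?U"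
        using L unfolding uniformly_sums_def by blast
      then show "\<forall>\<^sub>F m in sequentially. \<forall>a\<in>S.
          Qp_dist p (\<Oplus>\<^bsub>Qp p\<^esub>n\<in>{..<m}. g n a p) (h a p) \<le> 1 / real p ^ K"
        by (rule eventually_mono) (use t_apply[OF _ p] in force)
    qed
  next
    assume R: ?R
    show "uniformly_sums g h S"
      unfolding uniformly_sums_def
    proof (intro allI impI)
      fix U assume "openin Zhat_topology U \<and> \<zero>\<^bsub>Zhat\<^esub> \<in> U"
      then obtain F K where F: "finite F" "F \<subseteq> primes"
        "\<And>z. z \<in> carrier Zhat \<Longrightarrow> (\<forall>p\<in>F. Qp_abs p (z p) \<le> 1 / real p ^ K p) \<Longrightarrow> z \<in> U"
        using Zhat_nhds_zero by metis
      have "\<forall>\<^sub>F m in sequentially. \<forall>p\<in>F. \<forall>a\<in>S.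
          Qp_dist p (\<Oplus>\<^bsub>Qp p\<^esub>n\<in>{..<m}. g n a p) (h a p) \<le> 1 / real p ^ K p"
        using F R by (intro eventually_ball_finite) auto
      then show "\<forall>\<^sub>F m in sequentially. \<forall>a\<in>S. ?t m a \<in> U"
        by (rule eventually_mono) (use F(2,3) t_closed t_apply in \<open>simp add: subset_iff\<close>)
    qed
  qed
qed

section \<open>Bases and integer-valued polynomials\<close>

lemma is_Z_basis_mem: "is_Z_basis M f \<Longrightarrow> f n \<in> M"
  unfolding is_Z_basis_def using module.span_base[OF module_zscale, of "f n" "range f"] by simp

text \<open>Reindexes a finite combination of members of \<open>range f\<close> by natural numbers
  and pads it with zeros, so that coordinates of different polynomials can be compared index by
  index.\<close>

lemma is_Z_basis_expand:
  assumes "is_Z_basis M f" "g \<in> M"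
  shows "\<exists>d N. (\<forall>n\<ge>N. d n = 0) \<and> g = (\<Sum>n<N. zscale (d n) (f n))"
proof -
  have inj: "inj f" and span: "g \<in> module.span zscale (range f)"
    using assms by (auto simp: is_Z_basis_def)
  obtain t r where t: "finite t" "t \<subseteq> range f" "g = (\<Sum>a\<in>t. zscale (r a) a)"
    using span unfolding module.span_explicit[OF module_zscale] by blast
  obtain I where I: "finite I" "t = f ` I"
    using finite_subset_image[OF t(1,2)] by blast
  obtain N where N: "I \<subseteq> {..<N}" using I(1) finite_nat_iff_bounded by blast
  define d where "d n = (if n \<in> I then r (f n) else 0)" for n
  have "g = (\<Sum>n\<in>I. zscale (r (f n)) (f n))"
    unfolding t(3) I(2) using inj by (subst sum.reindex) (auto intro: inj_on_subset)
  also have "\<dots> = (\<Sum>n\<in>I. zscale (d n) (f n))" by (simp add: d_def)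
  also have "\<dots> = (\<Sum>n<N. zscale (d n) (f n))"
    using N by (intro sum.mono_neutral_left) (auto simp: d_def)
  finally show ?thesis using N by (intro exI[of _ d] exI[of _ N]) (auto simp: d_def)
qed

lemma is_Z_basis_independent:
  assumes "is_Z_basis M f" "(\<Sum>n<N. zscale (d n) (f n)) = 0" "n < N"
  shows "d n = 0"
proof -
  have inj: "inj f" and indep: "\<not> module.dependent zscale (range f)"
    using assms by (auto simp: is_Z_basis_def)
  have "(\<Sum>a\<in>f ` {..<N}. zscale (d (inv_into UNIV f a)) a) = (\<Sum>n<N. zscale (d n) (f n))"
    using inj by (subst sum.reindex) (auto intro: inj_on_subset simp: inv_f_f)
  then have "(\<Sum>a\<in>f ` {..<N}. zscale (d (inv_into UNIV f a)) a) = 0" using assms(2) by simp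
  then have "d (inv_into UNIV f (f n)) = 0"
    using module.independentD[OF module_zscale indep, of "f ` {..<N}" "\<lambda>a. d (inv_into UNIV f a)" "f n"]
      assms(3) by auto
  then show ?thesis using inj by (simp add: inv_f_f)
qed

text \<open>Multiplied by \<open>D\<close>, the \<open>n\<close>-th coefficients of the members of
  degree at most \<open>n\<close> form a subgroup of the integers; it contains \<open>D\<close>
  because of \<open>monom 1 n\<close>, and by Euclidean division its least positive element
  generates it.\<close>

lemma ex_generating_leading_coeff:
  assumes add: "\<And>f g. f \<in> M \<Longrightarrow> g \<in> M \<Longrightarrow> f + g \<in> M"
    and scale: "\<And>k f. f \<in> M \<Longrightarrow> zscale k f \<in> M"
    and monom: "monom 1 n \<in> M"
    and D: "D > 0" "\<And>f. f \<in> M \<Longrightarrow> degree f \<le> n \<Longrightarrow> of_int D * coeff f n \<in> \<int>"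
  shows "\<exists>f\<in>M. degree f = n \<and> coeff f n \<noteq> 0 \<and>
    (\<forall>g\<in>M. degree g \<le> n \<longrightarrow> (\<exists>z. coeff g n = of_int z * coeff f n))"
proof -
  define P where "P k \<longleftrightarrow> k > 0 \<and> (\<exists>f\<in>M. degree f \<le> n \<and> of_int D * coeff f n = (of_nat k :: rat))" for k
  have "P (nat D)"
    unfolding P_def using D(1) monom by (auto intro!: bexI[of _ "monom 1 n"] simp: degree_monom_eq)
  define k where "k = (LEAST k. P k)"
  have "P k" unfolding k_def using \<open>P (nat D)\<close> by (rule LeastI)
  then obtain f where k: "k > 0" and f: "f \<in> M" "degree f \<le> n" "of_int D * coeff f n = of_nat k"
    unfolding P_def by blast
  have nz: "coeff f n \<noteq> 0" using f(3) k by auto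
  have "\<exists>z. coeff g n = of_int z * coeff f n" if g: "g \<in> M" "degree g \<le> n" for g
  proof -
    obtain j where j: "of_int D * coeff g n = of_int j" using D(2)[OF g] by (auto elim: Ints_cases)
    define h where "h = g + zscale (- (j div int k)) f"
    have h: "h \<in> M" "degree h \<le> n"
      unfolding h_def using f g
      by (blast intro: add scale, intro degree_add_le order_trans[OF degree_smult_le])
    have "of_int D * coeff h n = of_int D * coeff g n - of_int (j div int k) * (of_int D * coeff f n)"
      by (simp add: h_def algebra_simps)
    also have "\<dots> = of_int (j - j div int k * int k)" unfolding j f(3) by simp
    also have "j - j div int k * int k = j mod int k" by (rule minus_div_mult_eq_mod)
    finally have r: "of_int D * coeff h n = of_int (j mod int k)" .
    have "j mod int k = 0"
    proof (rule ccontr)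
      assume "j mod int k \<noteq> 0"
      moreover have "0 \<le> j mod int k" "j mod int k < int k" using k by simp_all
      ultimately have "P (nat (j mod int k))" "nat (j mod int k) < k"
        unfolding P_def using h r by auto
      then show False using not_less_Least unfolding k_def by blast
    qed
    with r D(1) have "coeff h n = 0" by simp
    then have "coeff g n = of_int (j div int k) * coeff f n" by (simp add: h_def)
    then show ?thesis ..
  qed
  moreover have "degree f = n" using f(2) nz by (simp add: le_antisym le_degree)
  ultimately show ?thesis using f(1) nz by blast
qed

text \<open>Triangularity with respect to the degree: in a relation the term of highest degree
  cannot cancel, and subtracting an integer multiple of \<open>F n\<close> kills the coefficient of
  degree \<open>n\<close>.\<close>

lemma regular_basis:
  assumes zero: "0 \<in> M" and add: "\<And>f g. f \<in> M \<Longrightarrow> g \<in> M \<Longrightarrow> f + g \<in> M"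
    and scale: "\<And>k f. f \<in> M \<Longrightarrow> zscale k f \<in> M"
    and deg: "\<And>n. degree (F n) = n" and mem: "\<And>n. F n \<in> M" and nz: "\<And>n. coeff (F n) n \<noteq> 0"
    and gen: "\<And>n g. g \<in> M \<Longrightarrow> degree g \<le> n \<Longrightarrow> \<exists>z. coeff g n = of_int z * coeff (F n) n"
  shows "is_Z_basis M F"
  unfolding is_Z_basis_def
proof (intro conjI)
  interpret Z: module zscale by (rule module_zscale)
  show "inj F" using deg by (metis injI)
  show "\<not> Z.dependent (range F)"
  proof
    assume "Z.dependent (range F)"
    then obtain t u where t: "finite t" "t \<subseteq> range F" "(\<Sum>v\<in>t. zscale (u v) v) = 0"
      and ne: "{v\<in>t. u v \<noteq> 0} \<noteq> {}"
      unfolding Z.dependent_explicit by blast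
    define m where "m = Max (degree ` {v\<in>t. u v \<noteq> 0})"
    have "m \<in> degree ` {v\<in>t. u v \<noteq> 0}" unfolding m_def using t(1) ne by (intro Max_in) auto
    then obtain v where v: "v \<in> t" "u v \<noteq> 0" "degree v = m" by auto
    then have vF: "v = F m" using t(2) deg by auto
    have other: "coeff (zscale (u w) w) m = 0" if "w \<in> t - {v}" for w
    proof (cases "u w = 0")
      case False
      then have "degree w \<le> m" unfolding m_def using that t(1) by (intro Max_ge) auto
      moreover have "degree w \<noteq> m" using that t(2) deg vF by auto
      ultimately show ?thesis by (simp add: coeff_eq_0)
    qed simp
    have "(\<Sum>w\<in>t - {v}. coeff (zscale (u w) w) m) = 0"
      by (intro sum.neutral ballI) (rule other)
    then have "coeff (\<Sum>v\<in>t. zscale (u v) v) m = coeff (zscale (u v) v) m"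
      unfolding sum.remove[OF t(1) v(1)] by (simp only: coeff_add coeff_sum add_0_right)
    then show False using t(3) v(2) vF nz by simp
  qed
  \<comment> \<open>Induction on a bound from which on the coefficients vanish, instead of on the
    degree, so that the zero polynomial is the base case and constants are one step.\<close>
  have "g \<in> Z.span (range F)" if "g \<in> M" "\<And>i. i \<ge> n \<Longrightarrow> coeff g i = 0" for n g
    using that
  proof (induction n arbitrary: g)
    case 0
    then have "g = 0" by (simp add: poly_eqI)
    then show ?case by (simp add: Z.span_zero)
  next
    case (Suc n)
    then have "degree g \<le> n" by (simp add: degree_le)
    then obtain z where z: "coeff g n = of_int z * coeff (F n) n" using gen Suc.prems(1) by blast
    define h where "h = g + zscale (- z) (F n)"
    have "h \<in> M" unfolding h_def using add scale Suc.prems(1) mem by blast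
    moreover have "coeff h i = 0" if "i \<ge> n" for i
    proof (cases "i = n")
      case False
      then show ?thesis using that Suc.prems(2)[of i] deg[of n] by (simp add: h_def coeff_eq_0)
    qed (use z in \<open>simp add: h_def\<close>)
    ultimately have "h \<in> Z.span (range F)" using Suc.IH by blast
    moreover have "zscale z (F n) \<in> Z.span (range F)" by (intro Z.span_scale Z.span_base) simp
    ultimately have "h + zscale z (F n) \<in> Z.span (range F)" by (rule Z.span_add)
    then show ?case by (simp add: h_def)
  qed
  then have "g \<in> Z.span (range F)" if "g \<in> M" for g
    using that by (metis coeff_eq_0 Suc_le_eq)
  moreover have "Z.span (range F) \<subseteq> M"
    using mem add scale zero by (intro Z.span_minimal) (auto simp: Z.subspace_def)
  ultimately show "Z.span (range F) = M" by blast
qed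

section \<open>Bounding a coefficient by the values at separated points\<close>

context prime_padic
begin

text \<open>The coefficient of degree \<open>n\<close> of \<open>f\<close> is its \<open>n\<close>-th divided difference at the points \<open>x i\<close>.\<close>

lemma coeff_bound_by_values:
  assumes "\<And>i. i \<le> n \<Longrightarrow> padic_abs p (poly f (x i)) \<le> C"
    and "\<And>i j. i < j \<Longrightarrow> j \<le> n \<Longrightarrow> \<delta> \<le> padic_abs p (x i - x j)"
    and "0 < \<delta>" "degree f \<le> n"
  shows "padic_abs p (coeff f n) \<le> C / \<delta> ^ n"
  using assms
proof (induction n arbitrary: f C)
  case 0
  then obtain a where "f = [:a:]" using degree_eq_zeroE by auto
  with 0(1)[of 0] show ?case by simp
next
  case (Suc n)
  let ?c = "x (Suc n)"
  have "poly (f - [:poly f ?c:]) ?c = 0" by simp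
  \<comment> \<open>One step of the divided differences: dividing out the linear factor at the last
    point keeps the top coefficient and costs one factor \<open>\<delta>\<close> in the bound on the
    values.\<close>
  then obtain g where g: "f - [:poly f ?c:] = [:- ?c, 1:] * g"
    unfolding poly_eq_0_iff_dvd by blast
  have dg: "degree g \<le> n"
  proof (cases "g = 0")
    case False
    have "degree (f - [:poly f ?c:]) = degree g + 1"
      unfolding g using False by (subst degree_mult_eq) auto
    moreover have "degree (f - [:poly f ?c:]) \<le> Suc n"
      using Suc.prems(4) by (intro degree_diff_le) auto
    ultimately show ?thesis by simp
  qed simp
  have "padic_abs p (poly g (x i)) \<le> C / \<delta>" if i: "i \<le> n" for i
  proof -
    have ne: "\<delta> \<le> padic_abs p (x i - ?c)" using Suc.prems(2)[of i "Suc n"] i by simp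
    have "poly f (x i) - poly f ?c = (x i - ?c) * poly g (x i)"
      using arg_cong[OF g, of "\<lambda>h. poly h (x i)"] by (simp add: algebra_simps)
    moreover have "padic_abs p (poly f (x i) - poly f ?c) \<le> C"
      using Suc.prems(1)[of i] Suc.prems(1)[of "Suc n"] i by (intro padic_abs_diff_le) auto
    ultimately have "padic_abs p (x i - ?c) * padic_abs p (poly g (x i)) \<le> C"
      by (simp add: padic_abs_mult)
    moreover have "\<delta> * padic_abs p (poly g (x i)) \<le> padic_abs p (x i - ?c) * padic_abs p (poly g (x i))"
      using ne by (intro mult_right_mono) auto
    ultimately show ?thesis using Suc.prems(3) by (simp add: field_simps)
  qed
  then have "padic_abs p (coeff g n) \<le> C / \<delta> / \<delta> ^ n"
    using Suc.prems(2,3) dg by (intro Suc.IH) auto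
  moreover have "coeff f (Suc n) = coeff g n"
    using arg_cong[OF g, of "\<lambda>h. coeff h (Suc n)"] dg by (simp add: coeff_eq_0)
  ultimately show ?case by simp
qed

text \<open>The points are replaced by integers closer to them than they are to each other, so that
  the bound for rational points applies with the same separation and with values still integral at
  \<open>p\<close>.\<close>

lemma coeff_bound_on_Zp:
  assumes a: "\<And>i. i \<le> n \<Longrightarrow> a i \<in> carrier (Zp p)"
    and dist: "\<And>i j. i < j \<Longrightarrow> j \<le> n \<Longrightarrow> 1 / real p ^ k \<le> Qp_dist p (a i) (a j)"
    and f: "\<And>i. i \<le> n \<Longrightarrow> Qp_abs p (Qp_eval p f (a i)) \<le> 1" and deg: "degree f \<le> n"
  shows "padic_abs p (coeff f n) \<le> real p ^ (k * n)"
proof -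
  \<comment> \<open>\<open>Suc k\<close> puts the integers strictly within the separation
    \<open>1 / real p ^ k\<close>, so by the ultrametric inequality they inherit it; exponent 0 is
    enough to keep the values integral.\<close>
  have "\<forall>i. \<exists>m. i \<le> n \<longrightarrow> Qp_dist p (a i) (Qp_of_rat p (of_int m)) \<le> 1 / real p ^ Suc k \<and>
      Qp_dist p (Qp_eval p f (a i)) (Qp_of_rat p (poly f (of_int m))) \<le> 1 / real p ^ 0"
    using Qp_eval_approx[OF a] by blast
  from choice[OF this] obtain m where
    "\<forall>i. i \<le> n \<longrightarrow> Qp_dist p (a i) (Qp_of_rat p (of_int (m i))) \<le> 1 / real p ^ Suc k \<and>
      Qp_dist p (Qp_eval p f (a i)) (Qp_of_rat p (poly f (of_int (m i)))) \<le> 1 / real p ^ 0" ..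
  then have m: "\<And>i. i \<le> n \<Longrightarrow> Qp_dist p (a i) (Qp_of_rat p (of_int (m i))) \<le> 1 / real p ^ Suc k"
    "\<And>i. i \<le> n \<Longrightarrow> Qp_dist p (Qp_eval p f (a i)) (Qp_of_rat p (poly f (of_int (m i)))) \<le> 1"
    by simp_all
  have "padic_abs p (coeff f n) \<le> 1 / (1 / real p ^ k) ^ n"
  proof (rule coeff_bound_by_values[where x = "\<lambda>i. of_int (m i)"])
    show "padic_abs p (poly f (of_int (m i))) \<le> 1" if i: "i \<le> n" for i
      using Qp_abs_le_if_dist_le[of "Qp_of_rat p (poly f (of_int (m i)))" "Qp_eval p f (a i)" 1]
        m(2)[OF i] f[OF i] Zp_closed_Qp[OF a[OF i]] by (simp add: Qp_dist_commute)
    show "1 / real p ^ k \<le> padic_abs p (of_int (m i) - of_int (m j))" if ij: "i < j" "j \<le> n" for i j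
    proof (rule ccontr)
      assume "\<not> 1 / real p ^ k \<le> padic_abs p (of_int (m i) - of_int (m j))"
      then have lt: "Qp_dist p (Qp_of_rat p (of_int (m i))) (Qp_of_rat p (of_int (m j))) < 1 / real p ^ k"
        by simp
      have small: "1 / real p ^ Suc k < 1 / real p ^ k"
        using p_gt_1 by (intro divide_strict_left_mono) auto
      have c: "a i \<in> carrier (Qp p)" "a j \<in> carrier (Qp p)" using a ij Zp_closed_Qp by auto
      have "Qp_dist p (a i) (a j) \<le> max (Qp_dist p (a i) (Qp_of_rat p (of_int (m i))))
          (Qp_dist p (Qp_of_rat p (of_int (m i))) (a j))"
        using c by (intro Qp_dist_ultra) auto
      moreover have "Qp_dist p (Qp_of_rat p (of_int (m i))) (a j)
          \<le> max (Qp_dist p (Qp_of_rat p (of_int (m i))) (Qp_of_rat p (of_int (m j))))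
             (Qp_dist p (Qp_of_rat p (of_int (m j))) (a j))"
        using c by (intro Qp_dist_ultra) auto
      moreover have "Qp_dist p (Qp_of_rat p (of_int (m j))) (a j) \<le> 1 / real p ^ Suc k"
        using m(1)[of j] ij by (simp add: Qp_dist_commute)
      ultimately have "Qp_dist p (a i) (a j) < 1 / real p ^ k"
        using m(1)[of i] ij lt small by linarith
      with dist[OF ij] show False by simp
    qed
  qed (use p_pos deg in auto)
  then show ?thesis by (simp add: power_one_over power_mult)
qed

text \<open>By discreteness a distance below 1 is at most \<open>1 / real p\<close>, so the
  difference divided by \<open>p\<close> is still integral. Read backwards, points in distinct
  residue classes are at distance at least 1.\<close>

lemma dist_less_1_imp_same_residue_class:
  assumes a: "a \<in> carrier (Zp p)" and b: "b \<in> carrier (Zp p)" and lt: "Qp_dist p a b < 1"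
  shows "cgenideal (Zp p) (Qp_of_rat p (of_nat p)) +>\<^bsub>Zp p\<^esub> a
    = cgenideal (Zp p) (Qp_of_rat p (of_nat p)) +>\<^bsub>Zp p\<^esub> b"
proof -
  interpret Zp: cring "Zp p" by (rule cring_Zp)
  let ?p = "Qp_of_rat p (of_nat p)" and ?I = "cgenideal (Zp p) (Qp_of_rat p (of_nat p))"
  have p: "?p \<in> carrier (Zp p)" using Zp_of_int[of "int p"] by simp
  have aQ: "a \<in> carrier (Qp p)" and bQ: "b \<in> carrier (Qp p)" using a b Zp_closed_Qp by auto
  define c where "c = (a \<ominus>\<^bsub>Qp p\<^esub> b) \<otimes>\<^bsub>Qp p\<^esub> Qp_of_rat p (1 / of_nat p)"
  have ab: "a \<ominus>\<^bsub>Qp p\<^esub> b \<in> carrier (Qp p)" using aQ bQ by simp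
  have "Qp_abs p (a \<ominus>\<^bsub>Qp p\<^esub> b) \<le> 1 / real p"
    using Qp_abs_lt_imp_le[OF ab, of 1] lt aQ bQ p_pos by (simp add: Qp_dist_eq)
  moreover have "Qp_abs p c = Qp_abs p (a \<ominus>\<^bsub>Qp p\<^esub> b) / padic_abs p (of_nat p ^ 1)"
    using ab by (simp add: c_def Qp_abs_mult padic_abs_divide)
  ultimately have "Qp_abs p c \<le> 1"
    using p_pos unfolding padic_abs_p_power by (simp add: field_simps)
  then have c: "c \<in> carrier (Zp p)" using ab by (simp add: Zp_carrier c_def)
  have "c \<otimes>\<^bsub>Qp p\<^esub> ?p = a \<ominus>\<^bsub>Qp p\<^esub> b"
    using ab p_pos by (simp add: c_def cls.S.m_assoc Qp_of_rat_mult Qp_of_rat_1)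
  moreover have "c \<otimes>\<^bsub>Zp p\<^esub> ?p \<in> ?I" using c by (auto simp: cgenideal_def)
  ultimately have mem: "a \<ominus>\<^bsub>Qp p\<^esub> b \<in> ?I" by simp
  have "a = (a \<ominus>\<^bsub>Qp p\<^esub> b) \<oplus>\<^bsub>Qp p\<^esub> b" using aQ bQ by algebra
  then have "a \<in> ?I +>\<^bsub>Zp p\<^esub> b"
    using mem unfolding a_r_coset_def' by auto
  moreover have "ideal ?I (Zp p)" using p by (rule Zp.cgenideal_ideal)
  then have "subgroup ?I (add_monoid (Zp p))"
    by (simp add: ideal_def additive_subgroup_def)
  ultimately show ?thesis
    using Zp.a_repr_independence[of a ?I b] b by simp
qed

end

section \<open>Integer-valued polynomials as a conjunction of local conditions\<close>

locale adelic_product =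
  fixes E :: "nat \<Rightarrow> padic set"
  assumes E_subset: "prime p \<Longrightarrow> E p \<subseteq> carrier (Zp p)"
    and E_nonempty: "prime p \<Longrightarrow> E p \<noteq> {}"
begin

abbreviation E_prod :: "(nat \<Rightarrow> padic) set" where
  "E_prod \<equiv> Pi\<^sub>E primes E"

abbreviation Int_E :: "rat poly set" where
  "Int_E \<equiv> Int_Q E_prod"

text \<open>Nonemptiness of the other factors makes each point of \<open>E p\<close> a coordinate of
  a point of the product, which is how conditions on the product are read off at one prime.\<close>

lemma E_prod_extend:
  assumes "prime p" "x \<in> E p"
  obtains a where "a \<in> E_prod" "a p = x"
proof -
  define a where "a = (\<lambda>q\<in>primes. if q = p then x else (SOME b. b \<in> E q))"
  have "a \<in> E_prod"
    using assms E_nonempty by (auto simp: a_def some_in_eq)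
  moreover have "a p = x" using assms by (simp add: a_def)
  ultimately show ?thesis using that by blast
qed

lemma Int_E_iff:
  "f \<in> Int_E \<longleftrightarrow> (\<forall>p x. prime p \<longrightarrow> x \<in> E p \<longrightarrow> Qp_abs p (Qp_eval p f x) \<le> 1)" (is "_ \<longleftrightarrow> ?R")
proof
  assume f: "f \<in> Int_E"
  show ?R
  proof (intro allI impI)
    fix p :: nat and x assume px: "prime p" "x \<in> E p"
    obtain a where a: "a \<in> E_prod" "a p = x" using E_prod_extend[OF px] .
    have "adelic_eval f a \<in> carrier Zhat" using f a by (auto simp: Int_Q_def)
    from Zhat_component[OF this px(1)] show "Qp_abs p (Qp_eval p f x) \<le> 1"
      using px a by (simp add: adelic_eval_def Zp_carrier)
  qed
next
  assume R: ?R
  have "adelic_eval f a \<in> carrier Zhat" if a: "a \<in> E_prod" for a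
    unfolding adelic_eval_def
  proof (rule Zhat_restrictI)
    fix p :: nat assume p: "prime p"
    interpret prime_padic p by unfold_locales fact
    have ap: "a p \<in> E p" using a p by auto
    then have "a p \<in> carrier (Qp p)" using E_subset[OF p] Zp_closed_Qp by blast
    moreover have "Qp_abs p (Qp_eval p f (a p)) \<le> 1" using R p ap by simp
    ultimately show "Qp_eval p f (a p) \<in> carrier (Zp p)" by (simp add: Zp_carrier)
  qed
  then show "f \<in> Int_E" by (auto simp: Int_Q_def)
qed

lemma E_carrier: "prime p \<Longrightarrow> x \<in> E p \<Longrightarrow> x \<in> carrier (Qp p)"
  using E_subset by (auto simp: Zp_carrier)

lemma Int_E_eval: "f \<in> Int_E \<Longrightarrow> prime p \<Longrightarrow> x \<in> E p \<Longrightarrow> Qp_eval p f x \<in> carrier (Zp p)"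
  using Int_E_iff[of f] E_carrier[of p x]
  by (simp add: Zp_carrier prime_padic.Qp_eval_closed prime_padic_def)

lemma Int_E_add:
  assumes "f \<in> Int_E" "g \<in> Int_E"
  shows "f + g \<in> Int_E"
  unfolding Int_E_iff
proof (intro allI impI)
  fix p :: nat and x assume px: "prime p" "x \<in> E p"
  interpret prime_padic p by unfold_locales fact
  show "Qp_abs p (Qp_eval p (f + g) x) \<le> 1"
    using Zp_add_closed[OF Int_E_eval[OF assms(1) px] Int_E_eval[OF assms(2) px]] E_carrier[OF px]
    by (simp add: Qp_eval_add Zp_carrier)
qed

lemma Int_E_scale:
  assumes "f \<in> Int_E"
  shows "zscale k f \<in> Int_E"
  unfolding Int_E_iff
proof (intro allI impI)
  fix p :: nat and x assume px: "prime p" "x \<in> E p"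
  interpret prime_padic p by unfold_locales fact
  show "Qp_abs p (Qp_eval p (zscale k f) x) \<le> 1"
    using Zp_mult_closed[OF Zp_of_int[of k] Int_E_eval[OF assms px]] E_carrier[OF px]
    by (simp add: Qp_eval_smult Zp_carrier)
qed

lemma Int_E_sum: "(\<And>n. n < N \<Longrightarrow> f n \<in> Int_E) \<Longrightarrow> 0 \<in> Int_E \<Longrightarrow> (\<Sum>n<N. zscale (d n) (f n)) \<in> Int_E"
  for f :: "nat \<Rightarrow> rat poly"
  by (induction N) (auto intro: Int_E_add Int_E_scale)

lemma Int_E_if_coeffs:
  assumes "\<And>p i. prime p \<Longrightarrow> padic_abs p (coeff f i) \<le> 1"
  shows "f \<in> Int_E"
  unfolding Int_E_iff
proof (intro allI impI)
  fix p :: nat and x assume px: "prime p" "x \<in> E p"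
  interpret prime_padic p by unfold_locales fact
  have "x \<in> carrier (Zp p)" using px E_subset by blast
  with assms[OF px(1)] show "Qp_abs p (Qp_eval p f x) \<le> 1" by (intro Qp_eval_bound(1))
qed

lemma Int_E_0: "0 \<in> Int_E"
  by (rule Int_E_if_coeffs) simp

lemma Int_E_monom: "monom 1 n \<in> Int_E"
  using prime_padic.padic_abs_one by (intro Int_E_if_coeffs) (auto simp: coeff_monom prime_padic_def)

text \<open>Dividing by \<open>p ^ K\<close> leaves the conditions at the other primes untouched,
  since \<open>p\<close> is a unit there; at \<open>p\<close> the smallness of the values
  compensates for the division.\<close>

lemma Int_E_divide:
  assumes f: "f \<in> Int_E" and p: "prime p"
    and le: "\<And>x. x \<in> E p \<Longrightarrow> Qp_abs p (Qp_eval p f x) \<le> 1 / real p ^ K"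
  shows "smult (1 / of_nat p ^ K) f \<in> Int_E"
  unfolding Int_E_iff
proof (intro allI impI)
  fix q :: nat and x assume qx: "prime q" "x \<in> E q"
  interpret Q: prime_padic q by unfold_locales fact
  have eq: "Qp_abs q (Qp_eval q (smult (1 / of_nat p ^ K) f) x)
      = Qp_abs q (Qp_eval q f x) / padic_abs q (of_nat p ^ K)"
    using E_carrier[OF qx] by (simp add: Q.Qp_eval_smult Q.Qp_abs_mult Q.padic_abs_divide)
  show "Qp_abs q (Qp_eval q (smult (1 / of_nat p ^ K) f) x) \<le> 1"
  proof (cases "q = p")
    case True
    then have "padic_abs q (of_nat p ^ K) = 1 / real p ^ K"
      using Q.padic_abs_p_power[of K] by simp
    moreover have "Qp_abs q (Qp_eval q f x) \<le> 1 / real p ^ K" using le qx True by simp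
    ultimately show ?thesis unfolding eq using Q.p_pos True by (simp add: le_divide_eq)
  next
    case False
    then show ?thesis using f qx eq Q.padic_abs_other_prime_power[OF p] by (simp add: Int_E_iff)
  qed
qed

text \<open>At \<open>p\<close> the polynomial is integral on \<open>E p\<close> because it
  approximates an integral function; at the other primes the factor \<open>N\<close> makes its
  coefficients integral. As \<open>N\<close> is congruent to 1 modulo \<open>p ^ K\<close>, it moves
  the values at \<open>p\<close> by no more than the permitted error.\<close>

lemma Int_E_dense:
  assumes p: "prime p" and compact: "compactin (Zp_topology p) (E p)"
    and \<phi>: "continuous_map (subtopology (Zp_topology p) (E p)) (Zp_topology p) \<phi>"
  shows "\<exists>g\<in>Int_E. \<forall>x\<in>E p. Qp_dist p (Qp_eval p g x) (\<phi> x) \<le> 1 / real p ^ K"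
proof -
  interpret prime_padic p by unfold_locales fact
  have \<phi>_closed: "\<phi> x \<in> carrier (Zp p)" if "x \<in> E p" for x
    using \<phi> that E_subset[OF p] by (auto simp: continuous_map_def topspace_Zp Pi_iff)
  obtain g where g: "\<And>x. x \<in> E p \<Longrightarrow> Qp_dist p (Qp_eval p g x) (\<phi> x) \<le> 1 / real p ^ K"
    using poly_dense[OF E_subset[OF p] compact \<phi>] by blast
  obtain N :: int where N: "int p ^ K dvd N - 1"
    "\<And>q i. prime q \<Longrightarrow> q \<noteq> p \<Longrightarrow> padic_abs q (of_int N * coeff g i) \<le> 1"
    using clear_other_denominators[of K g] by blast
  have gx: "Qp_abs p (Qp_eval p g x) \<le> 1" if x: "x \<in> E p" for x
    using Qp_abs_le_if_dist_le[of "Qp_eval p g x" "\<phi> x" 1] g[OF x] inverse_p_power_le_1[of K]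
      \<phi>_closed[OF x] E_carrier[OF p x] by (simp add: Zp_carrier)
  have "zscale N g \<in> Int_E"
    unfolding Int_E_iff
  proof (intro allI impI)
    fix q :: nat and x assume qx: "prime q" "x \<in> E q"
    interpret Q: prime_padic q by unfold_locales fact
    show "Qp_abs q (Qp_eval q (zscale N g) x) \<le> 1"
    proof (cases "q = p")
      case True
      then show ?thesis
        using qx gx[of x] E_carrier[OF qx] padic_abs_of_int_le_1[of N]
        by (simp add: Qp_eval_smult Qp_abs_mult mult_le_one)
    next
      case False
      have "x \<in> carrier (Zp q)" using qx E_subset by blast
      with N(2)[OF qx(1) False] show ?thesis by (intro Q.Qp_eval_bound(1)) auto
    qed
  qed
  moreover have "Qp_dist p (Qp_eval p (zscale N g) x) (\<phi> x) \<le> 1 / real p ^ K" if x: "x \<in> E p" for x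
  proof -
    have xQ: "x \<in> carrier (Qp p)" using E_carrier[OF p x] .
    have "Qp_dist p (Qp_eval p (zscale N g) x) (Qp_eval p g x) = Qp_abs p (Qp_eval p (zscale N g - g) x)"
      using xQ by (simp only: Qp_dist_eq Qp_eval_closed Qp_eval_minus)
    also have "zscale N g - g = zscale (N - 1) g" by (simp add: smult_diff_left)
    also have "Qp_abs p (Qp_eval p (zscale (N - 1) g) x)
        = padic_abs p (of_int (N - 1)) * Qp_abs p (Qp_eval p g x)"
      using xQ by (simp only: Qp_eval_smult Qp_abs_mult Qp_abs_of_rat Qp_of_rat_closed Qp_eval_closed)
    also have "\<dots> \<le> 1 / real p ^ K * 1"
      using N(1)[folded padic_abs_of_int_le_iff] gx[OF x] xQ by (intro mult_mono) auto
    finally have "Qp_dist p (Qp_eval p (zscale N g) x) (Qp_eval p g x) \<le> 1 / real p ^ K" by simp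
    with g[OF x] show ?thesis
      using Qp_dist_trans_le \<phi>_closed[OF x] Zp_closed_Qp xQ by (metis Qp_eval_closed)
  qed
  ultimately show ?thesis by blast
qed

end

section \<open>Expansions in a basis\<close>

lemma smult_sum_right: "smult c (sum f I) = (\<Sum>i\<in>I. smult c (f i))"
  by (induction I rule: infinite_finite_induct) (simp_all add: smult_add_right)

section \<open>Denominators of coefficients and existence of a basis\<close>

context prime_padic
begin

lemma obtain_separation:
  assumes "A \<subseteq> carrier (Qp p)" "finite A"
  obtains k where "\<And>a b. a \<in> A \<Longrightarrow> b \<in> A \<Longrightarrow> a \<noteq> b \<Longrightarrow> 1 / real p ^ k \<le> Qp_dist p a b"
proof -
  let ?D = "(\<lambda>(a, b). Qp_dist p a b) ` {(a, b) \<in> A \<times> A. a \<noteq> b}"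
  have fin: "finite ?D" using assms(2) by (auto intro: finite_subset[of _ "A \<times> A"])
  have "Qp_dist p a b > 0" if "a \<in> A" "b \<in> A" "a \<noteq> b" for a b
  proof -
    have "a \<in> carrier (Qp p)" "b \<in> carrier (Qp p)" using that assms(1) by auto
    then show ?thesis
      using Qp_dist_eq_0_iff[of a b] Qp_dist_nonneg[of a b] that(3) by linarith
  qed
  then have "\<forall>d\<in>?D. d > 0" by auto
  \<comment> \<open>Inserting \<open>1\<close> keeps the minimum meaningful when \<open>A\<close>
    has fewer than two points.\<close>
  then have "Min (insert 1 ?D) > 0" using fin by (subst Min_gr_iff) auto
  then obtain k where k: "1 / real p ^ k < Min (insert 1 ?D)" using obtain_p_power_less by blast
  have "1 / real p ^ k \<le> Qp_dist p a b" if "a \<in> A" "b \<in> A" "a \<noteq> b" for a b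
  proof -
    have "Min (insert 1 ?D) \<le> Qp_dist p a b" using fin that by (intro Min_le) auto
    with k show ?thesis by linarith
  qed
  with that show ?thesis by blast
qed

end

context adelic_product
begin

lemma coeff_bound_from_separated_points:
  assumes p: "prime p" and A: "A \<subseteq> E p" "card A = Suc n"
    and sep: "\<And>a b. a \<in> A \<Longrightarrow> b \<in> A \<Longrightarrow> a \<noteq> b \<Longrightarrow> 1 / real p ^ k \<le> Qp_dist p a b"
    and f: "f \<in> Int_E" "degree f \<le> n"
  shows "padic_abs p (coeff f n) \<le> real p ^ (k * n)"
proof -
  interpret prime_padic p by unfold_locales fact
  have "finite A" using A(2) by (simp add: card_ge_0_finite)
  then obtain a where a: "bij_betw a {0..<Suc n} A"
    using ex_bij_betw_nat_finite[of A] A(2) by auto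
  have aA: "a i \<in> A" if "i \<le> n" for i using bij_betwE[OF a] that by auto
  show ?thesis
  proof (rule coeff_bound_on_Zp[of n a k])
    show "a i \<in> carrier (Zp p)" if "i \<le> n" for i using aA[OF that] A(1) E_subset[OF p] by blast
    show "1 / real p ^ k \<le> Qp_dist p (a i) (a j)" if "i < j" "j \<le> n" for i j
    proof (rule sep)
      show "a i \<noteq> a j"
        using that inj_on_eq_iff[OF bij_betw_imp_inj_on[OF a], of i j] by simp
    qed (use aA that in auto)
    show "Qp_abs p (Qp_eval p f (a i)) \<le> 1" if "i \<le> n" for i
      using f(1) aA[OF that] A(1) p by (auto simp: Int_E_iff)
  qed (fact f(2))
qed

text \<open>Points from \<open>n + 1\<close> different residue classes are at distance at least 1
  from each other, so the separation exponent is 0 and \<open>p\<close> does not occur in the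
  denominator.\<close>

lemma coeff_bound_many_residues:
  assumes p: "prime p" and card: "card (residue_classes p (E p)) > n"
    and f: "f \<in> Int_E" "degree f \<le> n"
  shows "padic_abs p (coeff f n) \<le> 1"
proof -
  interpret prime_padic p by unfold_locales fact
  let ?r = "\<lambda>a. cgenideal (Zp p) (Qp_of_rat p (of_nat p)) +>\<^bsub>Zp p\<^esub> a"
  obtain T where T: "T \<subseteq> residue_classes p (E p)" "card T = Suc n"
    using obtain_subset_with_card_n[of "Suc n" "residue_classes p (E p)"] card by auto
  obtain A where A: "A \<subseteq> E p" "inj_on ?r A" "T = ?r ` A"
    using T(1) unfolding residue_classes_def subset_image_inj by blast
  have "card A = Suc n" using T(2) A(2,3) by (simp add: card_image)
  moreover have "1 / real p ^ 0 \<le> Qp_dist p a b" if "a \<in> A" "b \<in> A" "a \<noteq> b" for a b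
    using dist_less_1_imp_same_residue_class[of a b] inj_onD[OF A(2), of a b] that A(1) E_subset[OF p]
    by (auto simp: not_le[symmetric])
  ultimately have "padic_abs p (coeff f n) \<le> real p ^ (0 * n)"
    using f A(1) p by (intro coeff_bound_from_separated_points)
  then show ?thesis by simp
qed

text \<open>Serves the finitely many primes with too few residue classes: any \<open>n + 1\<close>
  points of \<open>E p\<close> have a positive minimal distance, and the resulting exponent is
  independent of the polynomial.\<close>

lemma coeff_bound_infinite:
  assumes p: "prime p" and inf: "infinite (E p)"
  shows "\<exists>k. \<forall>f\<in>Int_E. degree f \<le> n \<longrightarrow> padic_abs p (coeff f n) \<le> real p ^ k"
proof -
  interpret prime_padic p by unfold_locales fact
  obtain A where A: "A \<subseteq> E p" "finite A" "card A = Suc n"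
    using infinite_arbitrarily_large[OF inf] by metis
  have "A \<subseteq> carrier (Qp p)" using A(1) E_carrier[OF p] by blast
  then obtain k where "\<And>a b. a \<in> A \<Longrightarrow> b \<in> A \<Longrightarrow> a \<noteq> b \<Longrightarrow> 1 / real p ^ k \<le> Qp_dist p a b"
    using obtain_separation A(2) by blast
  then have "\<forall>f\<in>Int_E. degree f \<le> n \<longrightarrow> padic_abs p (coeff f n) \<le> real p ^ (k * n)"
    using coeff_bound_from_separated_points[OF p A(1,3)] by blast
  then show ?thesis ..
qed

lemma common_denominator_leading_coeff:
  assumes inf: "\<And>p. prime p \<Longrightarrow> infinite (E p)"
    and residues: "finite {p \<in> primes. \<not> card (residue_classes p (E p)) > n}"
  shows "\<exists>D>0. \<forall>f\<in>Int_E. degree f \<le> n \<longrightarrow> of_int D * coeff f n \<in> \<int>"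
proof -
  define B where "B = {p \<in> primes. \<not> card (residue_classes p (E p)) > n}"
  have B: "finite B" "\<And>p. p \<in> B \<Longrightarrow> prime p" using residues by (auto simp: B_def)
  obtain k where k: "\<And>p f. prime p \<Longrightarrow> f \<in> Int_E \<Longrightarrow> degree f \<le> n \<Longrightarrow>
      padic_abs p (coeff f n) \<le> real p ^ k p"
    using coeff_bound_infinite[OF _ inf, of _ n] by metis
  \<comment> \<open>Only the exceptional primes in \<open>B\<close> can occur in the denominators,
    each to a bounded power.\<close>
  define D where "D = (\<Prod>p\<in>B. int p ^ k p)"
  have "D > 0" unfolding D_def using B(2) by (intro prod_pos) (auto simp: prime_gt_0_nat)
  moreover have "of_int D * coeff f n \<in> \<int>" if f: "f \<in> Int_E" "degree f \<le> n" for f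
  proof (rule rat_is_int_if_padic_abs_le_1)
    fix p :: nat assume p: "prime p"
    interpret prime_padic p by unfold_locales fact
    show "padic_abs p (of_int D * coeff f n) \<le> 1"
    proof (cases "p \<in> B")
      case True
      then have "int p ^ k p dvd D" unfolding D_def using B(1) by (intro dvd_prodI)
      then have "padic_abs p (of_int D) \<le> 1 / real p ^ k p" by (simp add: padic_abs_of_int_le_iff)
      then have "padic_abs p (of_int D) * padic_abs p (coeff f n) \<le> 1 / real p ^ k p * real p ^ k p"
        using k[OF p f] by (intro mult_mono) auto
      then show ?thesis using p_pos by (simp add: padic_abs_mult)
    next
      case False
      then have "card (residue_classes p (E p)) > n" using p by (simp add: B_def)
      from coeff_bound_many_residues[OF p this f] show ?thesis
        using padic_abs_of_int_le_1[of D] by (simp add: padic_abs_mult mult_le_one)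
    qed
  qed
  ultimately show ?thesis by blast
qed

lemma ex_Z_basis:
  assumes inf: "\<And>p. prime p \<Longrightarrow> infinite (E p)"
    and residues: "\<And>n. finite {p \<in> primes. \<not> card (residue_classes p (E p)) > n}"
  shows "\<exists>f. is_Z_basis Int_E f"
proof -
  have "\<exists>f\<in>Int_E. degree f = n \<and> coeff f n \<noteq> 0 \<and>
      (\<forall>g\<in>Int_E. degree g \<le> n \<longrightarrow> (\<exists>z. coeff g n = of_int z * coeff f n))" for n
  proof -
    obtain D where "D > 0" "\<forall>f\<in>Int_E. degree f \<le> n \<longrightarrow> of_int D * coeff f n \<in> \<int>"
      using common_denominator_leading_coeff[OF inf residues] by blast
    then show ?thesis
      by (intro ex_generating_leading_coeff[where D = D] Int_E_add Int_E_scale Int_E_monom) auto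
  qed
  then obtain F where F: "\<And>n. F n \<in> Int_E" "\<And>n. degree (F n) = n" "\<And>n. coeff (F n) n \<noteq> 0"
    "\<And>n g. g \<in> Int_E \<Longrightarrow> degree g \<le> n \<Longrightarrow> \<exists>z. coeff g n = of_int z * coeff (F n) n"
    by metis
  have "is_Z_basis Int_E F"
    by (rule regular_basis[OF Int_E_0 Int_E_add Int_E_scale F(2,1,3,4)])
  then show ?thesis by (rule exI[of "is_Z_basis Int_E" F])
qed

section \<open>The expansion at a single prime\<close>

definition local_sums :: "(nat \<Rightarrow> rat poly) \<Rightarrow> nat \<Rightarrow> (nat \<Rightarrow> padic) \<Rightarrow> (padic \<Rightarrow> padic) \<Rightarrow> bool" where
  "local_sums f p c \<phi> \<longleftrightarrow> (\<forall>K. \<forall>\<^sub>F m in sequentially. \<forall>x\<in>E p.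
    Qp_dist p (\<Oplus>\<^bsub>Qp p\<^esub>n\<in>{..<m}. c n \<otimes>\<^bsub>Qp p\<^esub> Qp_eval p (f n) x) (\<phi> x) \<le> 1 / real p ^ K)"

text \<open>The combination divided by \<open>p ^ K\<close> is again integer-valued and so has
  integer coordinates; independence identifies \<open>p ^ K\<close> times these with the original
  ones. Thus the basis stays independent modulo \<open>p ^ K\<close> as a family of functions on
  \<open>E p\<close>.\<close>

lemma basis_coeffs_dvd:
  assumes basis: "is_Z_basis Int_E f" and p: "prime p"
    and le: "\<And>x. x \<in> E p \<Longrightarrow> Qp_abs p (Qp_eval p (\<Sum>n<N. zscale (d n) (f n)) x) \<le> 1 / real p ^ K"
    and n: "n < N"
  shows "int p ^ K dvd d n"
proof -
  have p0: "p > 0" using p by (rule prime_gt_0_nat)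
  let ?g = "\<Sum>n<N. zscale (d n) (f n)"
  have "?g \<in> Int_E" using is_Z_basis_mem[OF basis] by (intro Int_E_sum Int_E_0)
  then have "smult (1 / of_nat p ^ K) ?g \<in> Int_E" using le p by (intro Int_E_divide)
  from is_Z_basis_expand[OF basis this] obtain e M where e: "\<forall>n\<ge>M. e n = 0"
    "smult (1 / of_nat p ^ K) ?g = (\<Sum>n<M. zscale (e n) (f n))"
    by (elim exE conjE) (rule that)
  \<comment> \<open>The quotient may a priori involve basis elements beyond \<open>N\<close>, so
    both expansions are padded to a common length.\<close>
  define L where "L = max M N"
  define d' where "d' n = (if n < N then d n else 0)" for n
  have "?g = (\<Sum>n<L. zscale (d' n) (f n))"
    unfolding L_def by (intro sum.mono_neutral_cong_left) (auto simp: d'_def)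
  moreover have "(\<Sum>n<M. zscale (e n) (f n)) = (\<Sum>n<L. zscale (e n) (f n))"
    unfolding L_def by (intro sum.mono_neutral_left) (auto simp: e(1))
  moreover have "?g = zscale (int p ^ K) (smult (1 / of_nat p ^ K) ?g)" using p0 by simp
  ultimately have "(\<Sum>n<L. zscale (d' n) (f n)) = zscale (int p ^ K) (\<Sum>n<L. zscale (e n) (f n))"
    using e(2) by metis
  then have "(\<Sum>n<L. zscale (d' n - int p ^ K * e n) (f n)) = 0"
    by (simp add: smult_diff_left sum_subtractf smult_sum_right)
  moreover have "n < L" using n by (simp add: L_def)
  ultimately have "d' n - int p ^ K * e n = 0" by (rule is_Z_basis_independent[OF basis])
  then show ?thesis using n by (simp add: d'_def)
qed

text \<open>At precision \<open>K\<close> the coefficients are rounded to integers; both rounded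
  partial sums approximate \<open>\<phi>\<close>, so their difference is an integer combination
  small on \<open>E p\<close>, and its coordinates are divisible by \<open>p ^ K\<close>. Since
  \<open>K\<close> is arbitrary, the coefficients coincide.\<close>

lemma local_sums_unique:
  assumes basis: "is_Z_basis Int_E f" and p: "prime p"
    and c: "\<And>n. c n \<in> carrier (Zp p)" "\<And>n. c' n \<in> carrier (Zp p)"
    and \<phi>: "\<And>x. x \<in> E p \<Longrightarrow> \<phi> x \<in> carrier (Zp p)"
    and sums: "local_sums f p c \<phi>" "local_sums f p c' \<phi>"
  shows "c n = c' n"
proof -
  interpret prime_padic p by unfold_locales fact
  have "Qp_dist p (c n) (c' n) \<le> 1 / real p ^ K" for K
  proof -
    let ?S = "\<lambda>c m x. \<Oplus>\<^bsub>Qp p\<^esub>n\<in>{..<m}. c n \<otimes>\<^bsub>Qp p\<^esub> Qp_eval p (f n) x"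
    have "\<forall>\<^sub>F m in sequentially. (\<forall>x\<in>E p. Qp_dist p (?S c m x) (\<phi> x) \<le> 1 / real p ^ K) \<and>
        (\<forall>x\<in>E p. Qp_dist p (?S c' m x) (\<phi> x) \<le> 1 / real p ^ K) \<and> n < m"
      using sums eventually_gt_at_top[of n] unfolding local_sums_def by (intro eventually_conj) auto
    \<comment> \<open>The common length \<open>m\<close> must exceed \<open>n\<close>, so that the
      coefficients to be compared occur in the partial sums.\<close>
    then obtain m where "n < m"
      and m: "\<And>x. x \<in> E p \<Longrightarrow> Qp_dist p (?S c m x) (\<phi> x) \<le> 1 / real p ^ K"
        "\<And>x. x \<in> E p \<Longrightarrow> Qp_dist p (?S c' m x) (\<phi> x) \<le> 1 / real p ^ K"
      by (auto simp: eventually_sequentially)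
    let ?i = "\<lambda>m. Qp_of_rat p (of_int m)"
    have "\<forall>n. \<exists>m. Qp_dist p (c n) (?i m) \<le> 1 / real p ^ K" using Zp_approx_by_int[OF c(1)] by blast
    from choice[OF this] obtain d where d: "\<And>n. Qp_dist p (c n) (?i (d n)) \<le> 1 / real p ^ K" by blast
    have "\<forall>n. \<exists>m. Qp_dist p (c' n) (?i m) \<le> 1 / real p ^ K" using Zp_approx_by_int[OF c(2)] by blast
    from choice[OF this] obtain d' where d': "\<And>n. Qp_dist p (c' n) (?i (d' n)) \<le> 1 / real p ^ K" by blast
    have "int p ^ K dvd d n - d' n"
    proof (rule basis_coeffs_dvd[OF basis p _ \<open>n < m\<close>])
      fix x assume x: "x \<in> E p"
      have xQ: "x \<in> carrier (Qp p)" using E_carrier[OF p x] .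
      have fx: "Qp_eval p (f n) x \<in> carrier (Zp p)" for n
        using is_Z_basis_mem[OF basis] p x by (rule Int_E_eval)
      have cQ: "c n \<in> carrier (Qp p)" "c' n \<in> carrier (Qp p)" "Qp_eval p (f n) x \<in> carrier (Qp p)" for n
        using c xQ Zp_closed_Qp by auto
      have \<phi>Q: "\<phi> x \<in> carrier (Qp p)" using \<phi>[OF x] Zp_closed_Qp by blast
      let ?P = "\<lambda>d. \<Sum>n<m. zscale (d n) (f n)"
      have S: "?S c m x \<in> carrier (Qp p)" "?S c' m x \<in> carrier (Qp p)"
        using cQ by (auto intro!: cls.S.finsum_closed)
      have "Qp_dist p (Qp_eval p (?P d) x) (?S c m x) \<le> 1 / real p ^ K"
        unfolding Qp_eval_sum[OF xQ]
        by (intro Qp_dist_finsum_le) (use cQ fx d in \<open>simp_all add: Qp_dist_commute\<close>)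
      from Qp_dist_trans_le[OF this m(1)[OF x]]
      have 1: "Qp_dist p (Qp_eval p (?P d) x) (\<phi> x) \<le> 1 / real p ^ K" using S xQ \<phi>Q by simp
      have "Qp_dist p (Qp_eval p (?P d') x) (?S c' m x) \<le> 1 / real p ^ K"
        unfolding Qp_eval_sum[OF xQ]
        by (intro Qp_dist_finsum_le) (use cQ fx d' in \<open>simp_all add: Qp_dist_commute\<close>)
      from Qp_dist_trans_le[OF this m(2)[OF x]]
      have 2: "Qp_dist p (\<phi> x) (Qp_eval p (?P d') x) \<le> 1 / real p ^ K"
        using S xQ \<phi>Q by (simp add: Qp_dist_commute)
      have "(\<Sum>n<m. zscale (d n - d' n) (f n)) = ?P d - ?P d'"
        by (simp add: smult_diff_left sum_subtractf)
      then show "Qp_abs p (Qp_eval p (\<Sum>n<m. zscale (d n - d' n) (f n)) x) \<le> 1 / real p ^ K"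
        using Qp_dist_trans_le[OF 1 2] xQ \<phi>Q by (simp add: Qp_eval_minus Qp_dist_eq)
    qed
    then have "Qp_dist p (?i (d n)) (?i (d' n)) \<le> 1 / real p ^ K"
      unfolding Qp_dist_of_rat using padic_abs_of_int_le_iff by (metis of_int_diff)
    from Qp_dist_trans_le[OF d this]
    have "Qp_dist p (c n) (?i (d' n)) \<le> 1 / real p ^ K" using c Zp_closed_Qp by simp
    moreover have "Qp_dist p (?i (d' n)) (c' n) \<le> 1 / real p ^ K" using d' by (simp add: Qp_dist_commute)
    ultimately show ?thesis
      using Qp_dist_trans_le[of "c n" "?i (d' n)" "1 / real p ^ K" "c' n"] c Zp_closed_Qp by simp
  qed
  then have "\<not> Qp_dist p (c n) (c' n) > 0"
    using obtain_p_power_less by (metis not_less)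
  then have "Qp_dist p (c n) (c' n) = 0" using Qp_dist_nonneg[of "c n" "c' n"] by linarith
  then show ?thesis using Qp_dist_eq_0_iff c Zp_closed_Qp by blast
qed

text \<open>If \<open>g\<^sub>K\<close> approximates \<open>\<phi>\<close> modulo \<open>p ^ K\<close>, then \<open>(g\<^sub>K\<^sub>+\<^sub>1 - g\<^sub>K) / p ^ K\<close> is again
  integer-valued, so that it has integer coordinates \<open>d K n\<close>; the coefficients sought are the series
  \<open>\<Sum>K. p ^ K * d K n\<close>.\<close>

lemma local_sums_exist:
  assumes basis: "is_Z_basis Int_E f" and p: "prime p"
    and compact: "compactin (Zp_topology p) (E p)"
    and \<phi>: "continuous_map (subtopology (Zp_topology p) (E p)) (Zp_topology p) \<phi>"
  shows "\<exists>c. (\<forall>n. c n \<in> carrier (Zp p)) \<and>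
    (\<forall>K. \<forall>\<^sub>F n in sequentially. Qp_abs p (c n) \<le> 1 / real p ^ K) \<and> local_sums f p c \<phi>"
proof -
  interpret prime_padic p by unfold_locales fact
  have \<phi>_closed: "\<phi> x \<in> carrier (Qp p)" "Qp_abs p (\<phi> x) \<le> 1" if "x \<in> E p" for x
    using \<phi> that E_subset[OF p] by (auto simp: continuous_map_def topspace_Zp Pi_iff Zp_carrier)
  obtain h where h: "\<And>K. h K \<in> Int_E"
    "\<And>K x. x \<in> E p \<Longrightarrow> Qp_dist p (Qp_eval p (h K) x) (\<phi> x) \<le> 1 / real p ^ K"
    using Int_E_dense[OF p compact \<phi>] by metis
  \<comment> \<open>Starting at the zero polynomial makes the differences telescope to
    \<open>g K\<close> itself; precision 0 is automatic because \<open>\<phi>\<close> takes integral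
    values.\<close>
  define g where "g K = (if K = 0 then 0 else h K)" for K
  have g_mem: "g K \<in> Int_E" for K using h Int_E_0 by (simp add: g_def)
  have g: "Qp_dist p (Qp_eval p (g K) x) (\<phi> x) \<le> 1 / real p ^ K" if x: "x \<in> E p" for K x
  proof (cases "K = 0")
    case True
    have "Qp_dist p (\<phi> x) \<zero>\<^bsub>Qp p\<^esub> = Qp_abs p (\<phi> x)" using \<phi>_closed[OF x] by (simp add: Qp_dist_zero)
    then show ?thesis
      using True \<phi>_closed[OF x] E_carrier[OF p x] by (simp add: g_def Qp_eval_0 Qp_dist_commute)
  qed (use h(2)[OF x] in \<open>simp add: g_def\<close>)
  have "smult (1 / of_nat p ^ K) (g (Suc K) - g K) \<in> Int_E" for K
  proof (rule Int_E_divide[OF _ p])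
    show "g (Suc K) - g K \<in> Int_E"
      using Int_E_add[OF g_mem[of "Suc K"] Int_E_scale[OF g_mem[of K], of "-1"]] by simp
    fix x assume x: "x \<in> E p"
    have "Qp_dist p (Qp_eval p (g (Suc K)) x) (\<phi> x) \<le> 1 / real p ^ K"
      using g[OF x, of "Suc K"] inverse_p_power_le[of K "Suc K"] by simp
    moreover have "Qp_dist p (\<phi> x) (Qp_eval p (g K) x) \<le> 1 / real p ^ K"
      using g[OF x] by (simp add: Qp_dist_commute)
    ultimately have "Qp_dist p (Qp_eval p (g (Suc K)) x) (Qp_eval p (g K) x) \<le> 1 / real p ^ K"
      by (rule Qp_dist_trans_le) (use \<phi>_closed[OF x] E_carrier[OF p x] in auto)
    then show "Qp_abs p (Qp_eval p (g (Suc K) - g K) x) \<le> 1 / real p ^ K"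
      using E_carrier[OF p x] by (simp add: Qp_eval_minus Qp_dist_eq)
  qed
  then have "\<forall>K. \<exists>d N. (\<forall>n\<ge>N. d n = 0) \<and>
      smult (1 / of_nat p ^ K) (g (Suc K) - g K) = (\<Sum>n<N. zscale (d n) (f n))"
    using is_Z_basis_expand[OF basis] by blast
  then obtain d N where d: "\<And>K n. n \<ge> N K \<Longrightarrow> d K n = 0"
    "\<And>K. smult (1 / of_nat p ^ K) (g (Suc K) - g K) = (\<Sum>n<N K. zscale (d K n) (f n))"
    by metis
  have step: "g (Suc K) - g K = (\<Sum>n<m. zscale (int p ^ K * d K n) (f n))" if "m \<ge> N K" for K m
  proof -
    have "g (Suc K) - g K = smult (of_nat p ^ K) (\<Sum>n<N K. zscale (d K n) (f n))"
      using d(2)[of K, symmetric] p_pos by simp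
    also have "(\<Sum>n<N K. zscale (d K n) (f n)) = (\<Sum>n<m. zscale (d K n) (f n))"
      using that by (intro sum.mono_neutral_left) (auto simp: d(1))
    finally show ?thesis by (simp add: smult_sum_right)
  qed
  \<comment> \<open>\<open>s K n\<close> is at once the \<open>n\<close>-th coordinate of
    \<open>g K\<close> and the \<open>K\<close>-th partial sum of the series defining
    \<open>c n\<close>.\<close>
  define s where "s K n = (\<Sum>k<K. int p ^ k * d k n)" for K n
  have g_eq: "g K = (\<Sum>n<m. zscale (s K n) (f n))" if "\<And>k. k < K \<Longrightarrow> m \<ge> N k" for K m
    using that
  proof (induction K)
    case (Suc K)
    have "g (Suc K) = g K + (\<Sum>n<m. zscale (int p ^ K * d K n) (f n))"
      using step[of K m] Suc.prems by (simp add: algebra_simps)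
    also have "g K = (\<Sum>n<m. zscale (s K n) (f n))" using Suc by simp
    finally show ?case by (simp add: s_def smult_add_left sum.distrib)
  qed (simp add: s_def g_def)
  obtain c where c: "\<And>n. c n \<in> carrier (Zp p)"
    "\<And>n K. Qp_dist p (c n) (Qp_of_rat p (of_int (s K n))) \<le> 1 / real p ^ K"
    unfolding s_def using int_series_limit[of "\<lambda>k. d k _"] by metis
  have cQ: "c n \<in> carrier (Qp p)" for n using c(1) Zp_closed_Qp by blast
  \<comment> \<open>A common upper bound of the first \<open>K\<close> lengths \<open>N k\<close>:
    from index \<open>M K\<close> on, \<open>s K\<close> vanishes. This yields the decay of
    \<open>c\<close> as well as the length after which the series has precision
    \<open>K\<close>.\<close>
  define M where "M K = (\<Sum>k<K. N k)" for K
  have M: "N k \<le> M K" if "k < K" for k K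
    unfolding M_def using that by (intro member_le_sum) auto
  have "\<forall>\<^sub>F n in sequentially. Qp_abs p (c n) \<le> 1 / real p ^ K" for K
  proof (rule eventually_sequentiallyI)
    fix n assume n: "M K \<le> n"
    have "d k n = 0" if "k < K" for k using d(1) M[OF that] n by (meson order_trans)
    then have "s K n = 0" by (simp add: s_def)
    with c(2)[of n K] show "Qp_abs p (c n) \<le> 1 / real p ^ K"
      using cQ by (simp add: Qp_of_rat_0 Qp_dist_zero)
  qed
  moreover have "local_sums f p c \<phi>"
    unfolding local_sums_def
  proof (intro allI eventually_sequentiallyI ballI)
    fix K m x assume m: "M K \<le> m" and x: "x \<in> E p"
    have xQ: "x \<in> carrier (Qp p)" using E_carrier[OF p x] .
    have fx: "Qp_eval p (f n) x \<in> carrier (Zp p)" for n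
      using is_Z_basis_mem[OF basis] p x by (rule Int_E_eval)
    have "g K = (\<Sum>n<m. zscale (s K n) (f n))" using M m by (intro g_eq) (auto intro: order_trans)
    then have gx: "Qp_eval p (g K) x
        = (\<Oplus>\<^bsub>Qp p\<^esub>n\<in>{..<m}. Qp_of_rat p (of_int (s K n)) \<otimes>\<^bsub>Qp p\<^esub> Qp_eval p (f n) x)"
      using Qp_eval_sum[OF xQ] by simp
    have "Qp_dist p (\<Oplus>\<^bsub>Qp p\<^esub>n\<in>{..<m}. c n \<otimes>\<^bsub>Qp p\<^esub> Qp_eval p (f n) x) (Qp_eval p (g K) x) \<le> 1 / real p ^ K"
      unfolding gx by (intro Qp_dist_finsum_le) (use cQ c(2) fx in simp_all)
    moreover have "(\<Oplus>\<^bsub>Qp p\<^esub>n\<in>{..<m}. c n \<otimes>\<^bsub>Qp p\<^esub> Qp_eval p (f n) x) \<in> carrier (Qp p)"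
      using cQ xQ by (auto intro!: cls.S.finsum_closed)
    ultimately show "Qp_dist p (\<Oplus>\<^bsub>Qp p\<^esub>n\<in>{..<m}. c n \<otimes>\<^bsub>Qp p\<^esub> Qp_eval p (f n) x) (\<phi> x) \<le> 1 / real p ^ K"
      using g[OF x, of K] xQ \<phi>_closed(1)[OF x] by (intro Qp_dist_trans_le[OF _ g[OF x, of K]]) simp_all
  qed
  ultimately show ?thesis using c(1) by blast
qed

text \<open>\<open>local_sums\<close> is the component at \<open>p\<close> of uniform convergence:
  the coordinates at \<open>p\<close> of the points of the product run through all of
  \<open>E p\<close>, so both quantifications agree.\<close>

lemma uniformly_sums_local:
  assumes f: "\<And>n. f n \<in> Int_E" and c: "\<And>n. c n \<in> carrier Zhat"
    and \<phi>: "\<And>p x. prime p \<Longrightarrow> x \<in> E p \<Longrightarrow> \<phi> p x \<in> carrier (Zp p)"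
  shows "uniformly_sums (\<lambda>n a. c n \<otimes>\<^bsub>Zhat\<^esub> adelic_eval (f n) a) (family_map \<phi>) E_prod \<longleftrightarrow>
    (\<forall>p\<in>primes. local_sums f p (\<lambda>n. c n p) (\<phi> p))"
proof -
  have g: "c n \<otimes>\<^bsub>Zhat\<^esub> adelic_eval (f n) a \<in> carrier Zhat" if "a \<in> E_prod" for n a
    using Zhat_closed(2)[OF c[of n]] f[of n] that by (auto simp: Int_Q_def)
  have h: "family_map \<phi> a \<in> carrier Zhat" if "a \<in> E_prod" for a
    unfolding family_map_def using \<phi> that by (intro Zhat_restrictI) auto
  have eq: "(\<forall>a\<in>E_prod. Qp_dist p (\<Oplus>\<^bsub>Qp p\<^esub>n\<in>{..<m}. (c n \<otimes>\<^bsub>Zhat\<^esub> adelic_eval (f n) a) p) (family_map \<phi> a p) \<le> e)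
      \<longleftrightarrow> (\<forall>x\<in>E p. Qp_dist p (\<Oplus>\<^bsub>Qp p\<^esub>n\<in>{..<m}. c n p \<otimes>\<^bsub>Qp p\<^esub> Qp_eval p (f n) x) (\<phi> p x) \<le> e)"
    (is "?L \<longleftrightarrow> ?R") if p: "prime p" for p m e
  proof
    assume L: ?L
    show ?R
    proof
      fix x assume "x \<in> E p"
      then obtain a where a: "a \<in> E_prod" "a p = x" using E_prod_extend[OF p] by blast
      from L a(1) have "Qp_dist p (\<Oplus>\<^bsub>Qp p\<^esub>n\<in>{..<m}. (c n \<otimes>\<^bsub>Zhat\<^esub> adelic_eval (f n) a) p) (family_map \<phi> a p) \<le> e" ..
      then show "Qp_dist p (\<Oplus>\<^bsub>Qp p\<^esub>n\<in>{..<m}. c n p \<otimes>\<^bsub>Qp p\<^esub> Qp_eval p (f n) x) (\<phi> p x) \<le> e"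
        using p a(2) by (simp add: Zhat_mult_apply adelic_eval_def family_map_def)
    qed
  next
    assume R: ?R
    show ?L
    proof
      fix a assume "a \<in> E_prod"
      then have "a p \<in> E p" using p by auto
      with R show "Qp_dist p (\<Oplus>\<^bsub>Qp p\<^esub>n\<in>{..<m}. (c n \<otimes>\<^bsub>Zhat\<^esub> adelic_eval (f n) a) p) (family_map \<phi> a p) \<le> e"
        using p by (simp add: Zhat_mult_apply adelic_eval_def family_map_def)
    qed
  qed
  have "uniformly_sums (\<lambda>n a. c n \<otimes>\<^bsub>Zhat\<^esub> adelic_eval (f n) a) (family_map \<phi>) E_prod \<longleftrightarrow>
    (\<forall>p\<in>primes. \<forall>K. \<forall>\<^sub>F m in sequentially. \<forall>a\<in>E_prod. Qp_dist p
      (\<Oplus>\<^bsub>Qp p\<^esub>n\<in>{..<m}. (c n \<otimes>\<^bsub>Zhat\<^esub> adelic_eval (f n) a) p) (family_map \<phi> a p) \<le> 1 / real p ^ K)"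
    using g h by (rule uniformly_sums_iff)
  then show ?thesis by (simp add: local_sums_def eq)
qed

text \<open>The component of the series at \<open>p\<close> involves only the components of the
  coefficients at \<open>p\<close>; hence coefficient sequences chosen for each prime can be glued,
  and uniqueness is checked componentwise.\<close>

lemma ex1_expansion:
  assumes basis: "is_Z_basis Int_E f"
    and compact: "\<And>p. prime p \<Longrightarrow> compactin (Zp_topology p) (E p)"
    and \<phi>: "\<And>p. prime p \<Longrightarrow>
      continuous_map (subtopology (Zp_topology p) (E p)) (Zp_topology p) (\<phi> p)"
  shows "\<exists>!c. (\<forall>n. c n \<in> carrier Zhat) \<and> limitin Zhat_topology c \<zero>\<^bsub>Zhat\<^esub> sequentially \<and>
    uniformly_sums (\<lambda>n a. c n \<otimes>\<^bsub>Zhat\<^esub> adelic_eval (f n) a) (family_map \<phi>) E_prod"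
proof (rule ex_ex1I)
  have \<phi>_closed: "\<phi> p x \<in> carrier (Zp p)" if p: "prime p" and x: "x \<in> E p" for p x
  proof -
    interpret prime_padic p by unfold_locales fact
    show ?thesis using \<phi>[OF p] x E_subset[OF p] by (auto simp: continuous_map_def topspace_Zp Pi_iff)
  qed
  note sums_iff = uniformly_sums_local[OF is_Z_basis_mem[OF basis] _ \<phi>_closed]
  show "\<exists>c. (\<forall>n. c n \<in> carrier Zhat) \<and> limitin Zhat_topology c \<zero>\<^bsub>Zhat\<^esub> sequentially \<and>
    uniformly_sums (\<lambda>n a. c n \<otimes>\<^bsub>Zhat\<^esub> adelic_eval (f n) a) (family_map \<phi>) E_prod"
  proof -
    have "\<forall>p. \<exists>c. prime p \<longrightarrow> (\<forall>n. c n \<in> carrier (Zp p)) \<and>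
      (\<forall>K. \<forall>\<^sub>F n in sequentially. Qp_abs p (c n) \<le> 1 / real p ^ K) \<and> local_sums f p c (\<phi> p)"
      using local_sums_exist[OF basis _ compact \<phi>] by blast
    from choice[OF this] obtain c where c: "\<And>p n. prime p \<Longrightarrow> c p n \<in> carrier (Zp p)"
      "\<And>p K. prime p \<Longrightarrow> \<forall>\<^sub>F n in sequentially. Qp_abs p (c p n) \<le> 1 / real p ^ K"
      "\<And>p. prime p \<Longrightarrow> local_sums f p (c p) (\<phi> p)" by blast
    define C where "C n = (\<lambda>p\<in>primes. c p n)" for n
    have C: "C n \<in> carrier Zhat" for n unfolding C_def using c(1) by (intro Zhat_restrictI)
    have "limitin Zhat_topology C \<zero>\<^bsub>Zhat\<^esub> sequentially"
      using C by (rule limitin_Zhat_zeroI) (simp add: C_def c(2))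
    moreover have "uniformly_sums (\<lambda>n a. C n \<otimes>\<^bsub>Zhat\<^esub> adelic_eval (f n) a) (family_map \<phi>) E_prod"
      using C by (subst sums_iff) (auto simp: C_def c(3))
    ultimately show ?thesis using C by blast
  qed
  fix c c'
  assume "(\<forall>n. c n \<in> carrier Zhat) \<and> limitin Zhat_topology c \<zero>\<^bsub>Zhat\<^esub> sequentially \<and>
      uniformly_sums (\<lambda>n a. c n \<otimes>\<^bsub>Zhat\<^esub> adelic_eval (f n) a) (family_map \<phi>) E_prod"
    and "(\<forall>n. c' n \<in> carrier Zhat) \<and> limitin Zhat_topology c' \<zero>\<^bsub>Zhat\<^esub> sequentially \<and>
      uniformly_sums (\<lambda>n a. c' n \<otimes>\<^bsub>Zhat\<^esub> adelic_eval (f n) a) (family_map \<phi>) E_prod"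
  then have c: "\<And>n. c n \<in> carrier Zhat" "\<And>n. c' n \<in> carrier Zhat"
    and "uniformly_sums (\<lambda>n a. c n \<otimes>\<^bsub>Zhat\<^esub> adelic_eval (f n) a) (family_map \<phi>) E_prod"
    and "uniformly_sums (\<lambda>n a. c' n \<otimes>\<^bsub>Zhat\<^esub> adelic_eval (f n) a) (family_map \<phi>) E_prod"
    by simp_all
  then have sums: "\<And>p. prime p \<Longrightarrow> local_sums f p (\<lambda>n. c n p) (\<phi> p)"
      "\<And>p. prime p \<Longrightarrow> local_sums f p (\<lambda>n. c' n p) (\<phi> p)"
    by (simp_all add: sums_iff)
  show "c = c'"
  proof (rule ext, rule Zhat_eqI)
    fix n and p :: nat assume p: "prime p"
    show "c n p = c' n p"
      by (rule local_sums_unique[OF basis p Zhat_component[OF c(1) p] Zhat_component[OF c(2) p]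
            \<phi>_closed[OF p] sums(1)[OF p] sums(2)[OF p]])
  qed (use c in auto)
qed

end

theorem theorem1p6:
  fixes E :: "nat \<Rightarrow> padic set"
  assumes subset: "\<And>p. prime p \<Longrightarrow> E p \<subseteq> carrier (Zp p)"
    and compact: "compactin Zhat_topology (Pi\<^sub>E primes E)"
    and infinite: "\<And>p. prime p \<Longrightarrow> infinite (E p)"
    and residues: "\<And>n :: nat. finite {p \<in> primes. \<not> card (residue_classes p (E p)) > n}"
  shows "(\<exists>f. is_Z_basis (Int_Q (Pi\<^sub>E primes E)) f) \<and>
    (\<forall>f. is_Z_basis (Int_Q (Pi\<^sub>E primes E)) f \<longrightarrow>
      (\<forall>\<phi>. (\<forall>p\<in>primes.
              continuous_map (subtopology (Zp_topology p) (E p)) (Zp_topology p) (\<phi> p)) \<longrightarrow>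
        (\<exists>!c. (\<forall>n. c n \<in> carrier Zhat) \<and>
              limitin Zhat_topology c \<zero>\<^bsub>Zhat\<^esub> sequentially \<and>
              uniformly_sums (\<lambda>n a. c n \<otimes>\<^bsub>Zhat\<^esub> adelic_eval (f n) a) (family_map \<phi>)
                (Pi\<^sub>E primes E))))"
proof -
  have nonempty: "E p \<noteq> {}" if "prime p" for p using infinite[OF that] by auto
  interpret adelic_product E by unfold_locales (use subset nonempty in auto)
  have "Pi\<^sub>E primes E \<noteq> {}" using nonempty by (auto simp: PiE_eq_empty_iff)
  \<comment> \<open>Compactness of a product passes to its factors only when the product is
    nonempty.\<close>
  then have compact_E: "compactin (Zp_topology p) (E p)" if "prime p" for p
    using compact that unfolding Zhat_topology_def compactin_PiE by auto
  show ?thesis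
    using ex_Z_basis[OF infinite residues] ex1_expansion[OF _ compact_E] by simp
qed

end
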